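(* Let $\delta\in(0,1]$ and $\lambda>0$ be constants with $$\lambda>\frac{1}{(\sqrt{2\delta}+\sqrt{1-\delta})^2}.$$ Then there exists a constant $\epsilon>0$ depending only on $\lambda$ and $\delta$ such that, for $(H^*,G)$ generated from the planted cycles model $\mathcal{G}(n,\lambda,\delta)$ and any estimator $\hat H$, $$\mathbb{P}\left(\ell(H^*,\hat H)\ge \epsilon/2\right)\ge 1-n^{-\Omega(\log n)}.$$ It follows that for all sufficiently large $n$, $\mathbb{E}[\ell(H^*,\hat H)]\ge\epsilon/4$.
   Context: Planted cycles model $\mathcal{G}(n,\lambda,\delta)$: generate an Erdős–Rényi graph $G_0\sim\mathcal{G}(n,\lambda/n)$ on vertex set $[n]$; independently choose a uniformly random set $V\subseteq[n]$ of $\lfloor\delta n\rfloor$ vertices; then choose a uniformly random labeled $2$-factor $H^*$ on $V$, i.e. a vertex-disjoint union of cycles spanning all vertices of $V$. Output the simple graph $G=G_0\cup H^*$. Graphs are identified with their edge sets. An estimator $\hat H=\hat H(G)$ is a (possibly randomized) function of $G$ that outputs a set of edges of the complete graph $K_n$; its reconstruction error is $\ell(H^*,\hat H)=|H^*\Delta\hat H|/|H^*|$, with $\Delta$ the symmetric difference. Asymptotic notation is as $n\to\infty$. *)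

theory Defs
  imports "HOL-Probability.Probability"
begin

type_synonym edge_set = "nat set set"

definition complete_edges :: "nat \<Rightarrow> edge_set" where
  "complete_edges n = {e. e \<subseteq> {1..n} \<and> card e = 2}"

definition cycle_edges :: "nat list \<Rightarrow> edge_set" where
  "cycle_edges xs = {{xs ! i, xs ! (Suc i mod length xs)} | i. i < length xs}"

(* Each cycle is given by a list of its vertices in cyclic order. A two-factor itself is an
   edge set, so rotations and reversals of these lists yield the same two-factor. *)
definition two_factor :: "nat set \<Rightarrow> edge_set \<Rightarrow> bool" where
  "two_factor V H \<longleftrightarrow>
     (\<exists>C. (\<forall>xs\<in>C. distinct xs \<and> 3 \<le> length xs) \<and>
          disjoint_family_on set C \<and>
          (\<Union>xs\<in>C. set xs) = V \<and>
          (\<Union>xs\<in>C. cycle_edges xs) = H)"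

(* bernoulli_pmf truncates its parameter to [0, 1], which for lam > 0 only matters if n < lam. *)
definition erdos_renyi :: "nat \<Rightarrow> real \<Rightarrow> edge_set pmf" where
  "erdos_renyi n p =
     map_pmf (\<lambda>b. {e \<in> complete_edges n. b e})
       (Pi_pmf (complete_edges n) False (\<lambda>_. bernoulli_pmf p))"

(* Yields the pair (H*, G). The set of two-factors is empty, and pmf_of_set then
   unspecified, only if the planted vertex set has 1 or 2 elements; for fixed del > 0
   this happens for finitely many n. *)
definition planted_cycles :: "nat \<Rightarrow> real \<Rightarrow> real \<Rightarrow> (edge_set \<times> edge_set) pmf" where
  "planted_cycles n lam del =
     do {
       G\<^sub>0 \<leftarrow> erdos_renyi n (lam / real n);
       V \<leftarrow> pmf_of_set {V. V \<subseteq> {1..n} \<and> card V = nat \<lfloor>del * real n\<rfloor>};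
       H \<leftarrow> pmf_of_set {H. two_factor V H};
       return_pmf (H, G\<^sub>0 \<union> H)
     }"

(* Randomized estimators as Markov kernels; since K_n has finitely many edge sets, kernels into
   pmfs lose no generality. *)
definition estimators :: "nat \<Rightarrow> (edge_set \<Rightarrow> edge_set pmf) set" where
  "estimators n =
     {est. \<forall>G \<subseteq> complete_edges n. set_pmf (est G) \<subseteq> Pow (complete_edges n)}"

definition planted_and_estimate ::
    "nat \<Rightarrow> real \<Rightarrow> real \<Rightarrow> (edge_set \<Rightarrow> edge_set pmf) \<Rightarrow> (edge_set \<times> edge_set) pmf" where
  "planted_and_estimate n lam del est =
     do {
       (H, G) \<leftarrow> planted_cycles n lam del;
       H' \<leftarrow> est G;
       return_pmf (H, H')
     }"

definition reconstruction_error :: "edge_set \<Rightarrow> edge_set \<Rightarrow> real" where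
  "reconstruction_error H H' = real (card (sym_diff H H')) / real (card H)"

end

(*
Given the observed graph G, the planted two-factor is uniform among all two-factors of the right size
inside G. An estimator that is often close to it would therefore force a positive fraction of these
candidates into one small ball, while a first-moment bound shows that a ball of radius eps * n around
the truth contains at most exp(o(1) * n) of them as eps -> 0. So it suffices to find exponentially many
two-factors in G. These come from alternating cycles: if every planted vertex of a cycle C touches a
planted edge of C and exactly half of the edges of C are planted, then H + C (symmetric difference) is
again a two-factor of the same size.

A path of linear length with this local structure is found by depth-first search in a first share of
the random edges. Arriving at a planted vertex, the path follows the planted cycle in one of two
directions for i + 1 edges and so drops i vertices; arriving outside the planted set it adds a vertex.
The difference of both counts (the level) is kept in {0..L}; the largest growth rate under this
constraint tends to lam * (sqrt (2 * del) + sqrt (1 - del))^2 as L grows. The failure probability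
is bounded by an exponential supermartingale, by induction over the states of the search. Vertices of
equal level cut the path into balanced segments; blocks of many segments are joined by the remaining
random edges, and any two large disjoint sets of blocks are joined, so that every set of blocks
contains a cycle through all but few of them.
*)
theory Submission
  imports Defs
begin

text \<open>Flipping a cycle preserves the number of edges only if exactly half of the cycle is
  planted. The search therefore cannot maximise growth freely, and the level enters the weights
  \<open>\<phi>\<close>. The gap above criticality is divided: one share pays for cutting off the
  levels at \<open>L\<close>, one for targets lost to used vertices, short planted cycles and
  rounding, one for the fluctuation of the answers (\<open>\<alpha> < 1\<close>), and one for a
  potential that falls with every used vertex, so that a search without a long path exhausts it.
  Short planted cycles are an obstacle because a stretch could wrap around them; counting
  two-factors shows that, up to an exponentially small probability, few vertices lie on them. The
  edges kept for joining may have an arbitrarily small density \<open>lam2 / n\<close>, yet have to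
  beat a union bound over exponentially many pairs of sets of blocks. Hence blocks with
  \<open>K\<close> entries and \<open>K\<close> exits: for a fixed number of cut points, the
  exponent available per block grows like \<open>K\<close>. All failure probabilities are
  exponentially small, which is more than \<open>n^(- ln n)\<close>.\<close>

section \<open>Level weights\<close>

text \<open>
  The weight \<open>\<phi>\<close> is the critical exponential tilt \<open>\<theta>^-b\<close> times the parabola \<open>(b + 1)(L + 1 - b)\<close>;
  at criticality the linear term cancels, and the parabola is negative where the sum is cut off.
\<close>

lemma level_weights:
  fixes del lam :: real
  assumes "0 < del" "del \<le> 1" "0 < lam" "lam * (sqrt (2 * del) + sqrt (1 - del))\<^sup>2 > 1"
  shows "\<exists>(L::nat) (\<phi> :: nat \<Rightarrow> real) \<eta>. \<eta> > 0 \<and> (\<forall>b\<le>L. \<phi> b > 0) \<and> \<phi> (Suc L) = 0 \<and>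
    (\<forall>b\<le>L. lam * ((1 - del) * \<phi> (Suc b) + 2 * del * (\<Sum>c\<le>b. \<phi> c)) \<ge> (1 + 3 * \<eta>) * \<phi> b)"
proof (cases "del = 1")
  case True
  have "lam * 2 > 1" using assms True by simp
  define \<eta> where "\<eta> = (lam * 2 - 1) / 3"
  \<comment> \<open>Without outside vertices the tilt used below would degenerate to 0. The single
    level 0 is enough: every arrival is planted and offers two directions.\<close>
  define \<phi> :: "nat \<Rightarrow> real" where "\<phi> = (\<lambda>b. if b = 0 then 1 else 0)"
  have "\<eta> > 0" "1 + 3 * \<eta> = lam * 2" using \<open>lam * 2 > 1\<close> by (simp_all add: \<eta>_def field_simps)
  thus ?thesis using True
    by (intro exI[where x = "0::nat"] exI[where x = \<phi>] exI[where x = \<eta>]) (simp add: \<phi>_def)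
next
  case False
  define a where "a = sqrt (2 * del)"
  define c where "c = sqrt (1 - del)"
  have ac: "a > 0" "c > 0" "a^2 = 2 * del" "c^2 = 1 - del"
    using assms False by (auto simp: a_def c_def)
  \<comment> \<open>Far from both ends, the weights \<open>\<theta>^-b\<close> grow by the factor
    \<open>c^2 / \<theta> + a^2 / (1 - \<theta>)\<close>. Its minimum over \<open>\<theta>\<close>
    is \<open>(a + c)^2\<close>, attained at \<open>th\<close>: this is the origin of the threshold.
    The vanishing derivative there is the cancellation of the linear term below.\<close>
  define th where "th = c / (a + c)"
  have th: "0 < th" "th < 1" "1 - th = a / (a + c)"
    using ac by (auto simp: th_def field_simps)
  \<comment> \<open>\<open>al\<close>, \<open>be\<close>, \<open>ga\<close> are the sums of
    \<open>j^i * th^j\<close> over all \<open>j \<ge> 0\<close>, for \<open>i = 0, 1, 2\<close>. As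
    \<open>\<psi> (b - j)\<close> extends to \<open>\<psi> b - j * (L - 2 * b) - j^2\<close>, the
    function \<open>G\<close> below is the sum of \<open>th^j * \<psi> (b - j)\<close> continued to
    negative arguments of the parabola. These contribute at most 0, whence \<open>F\<close>.\<close>
  define al where "al = 1 / (1 - th)"
  define be where "be = th / (1 - th)^2"
  define ga where "ga = th * (al + 2 * be) / (1 - th)"
  have pos: "al > 0" "be > 0" "ga > 0" 
    using th(1,2) by (simp_all add: al_def be_def ga_def add_pos_pos)
  have r1: "al = 1 + th * al" using th by (simp add: al_def field_simps)
  have "be * (1 - th) = th * al" using th(1,2) by (simp add: be_def al_def power2_eq_square)
  hence r2: "be = th * (al + be)" by (simp add: algebra_simps)
  have "ga * (1 - th) = th * (al + 2 * be)" using th(1,2) by (simp add: ga_def)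
  hence r3: "ga = th * (al + 2 * be + ga)" by (simp add: algebra_simps)
  have al': "al = (a + c) / a" using ac th(3) by (simp add: al_def)
  have be': "be = c * (a + c) / a^2"
  proof -
    have "a + c > 0" using ac(1,2) by simp
    thus ?thesis unfolding be_def th(3) th_def power_divide using ac(1)
      by (simp add: power2_eq_square divide_simps)
  qed
  define Cst where "Cst = (1 - del) / th + 2 * del * ga"
  define \<eta> where "\<eta> = (lam * (a + c)^2 - 1) / 4"
  have eta: "\<eta> > 0" "lam * (a + c)^2 = 1 + 4 * \<eta>" using assms(4) by (auto simp: \<eta>_def a_def c_def diff_divide_distrib)
  \<comment> \<open>The second-order terms cost \<open>lam * Cst\<close>, which does not depend on
    \<open>L\<close>, while \<open>\<psi> b \<ge> L + 1\<close> for all \<open>b \<le> L\<close>. A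
    large \<open>L\<close> therefore hides them in one of the four \<open>\<eta>\<close>.\<close>
  obtain L :: nat where L: "real L \<ge> lam * Cst / \<eta>" using real_arch_simple by blast
  define \<psi> where "\<psi> = (\<lambda>b::nat. (real b + 1) * (real L + 1 - real b))"
  define G where "G = (\<lambda>b::nat. al * \<psi> b - be * (real L - 2 * real b) - ga)"
  have F: "(\<Sum>i\<le>b. th ^ (b - i) * \<psi> i) \<ge> G b" for b
  proof (induction b)
    case 0
    have "G 0 = (real L + 1) * al - be * real L - ga" by (simp add: G_def \<psi>_def)
    also have "\<dots> = (real L + 1) * (1 + th * al) - th * (al + be) * real L - th * (al + 2 * be + ga)"
      using r1 r2 r3 by simp
    also have "\<dots> = (real L + 1) - th * (be * real L + 2 * be + ga)"
      by (simp add: algebra_simps)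
    also have "\<dots> \<le> real L + 1" using th pos by simp
    finally show ?case by (simp add: \<psi>_def)
  next
    case (Suc b)
    have "(\<Sum>i\<le>Suc b. th ^ (Suc b - i) * \<psi> i) = \<psi> (Suc b) + th * (\<Sum>i\<le>b. th ^ (b - i) * \<psi> i)"
      by (simp add: sum_distrib_left Suc_diff_le mult.assoc)
    moreover have "\<dots> \<ge> \<psi> (Suc b) + th * G b" using Suc th by simp
    moreover have "\<psi> (Suc b) + th * G b = G (Suc b)"
    proof -
      have ps: "\<psi> b = \<psi> (Suc b) - (real L - 2 * real (Suc b)) - 1"
        by (simp add: \<psi>_def algebra_simps)
      have "\<psi> (Suc b) + th * G b = (1 + th * al) * \<psi> (Suc b) - th * (al + be) * (real L - 2 * real (Suc b))
          - th * (al + 2 * be + ga)"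
        unfolding G_def ps by (simp add: algebra_simps)
      thus ?thesis using r1 r2 r3 by (simp add: G_def)
    qed
    ultimately show ?case by linarith
  qed
  define \<phi> where "\<phi> = (\<lambda>b::nat. \<psi> b / th ^ b)"
  have key: "lam * ((1 - del) * \<phi> (Suc b) + 2 * del * (\<Sum>i\<le>b. \<phi> i)) \<ge> (1 + 3 * \<eta>) * \<phi> b" if "b \<le> L" for b
  proof -
    have s: "(\<Sum>i\<le>b. \<phi> i) = (\<Sum>i\<le>b. th ^ (b - i) * \<psi> i) / th ^ b"
      unfolding sum_divide_distrib \<phi>_def
      using th by (intro sum.cong refl) (simp add: power_diff)
    have e: "(1 - del) / th = c * (a + c)" "2 * del * al = a * (a + c)" "2 * del * be = c * (a + c)"
      using ac(1,2) by (simp_all add: th_def al' be' ac(3,4)[symmetric] power2_eq_square)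
    have "(1 - del) / th * \<psi> (Suc b) + 2 * del * G b =
       ((1 - del) / th + 2 * del * al) * \<psi> b + ((1 - del) / th - 2 * del * be) * (real L - 2 * real b) - Cst"
      by (simp add: G_def Cst_def \<psi>_def algebra_simps add_divide_distrib diff_divide_distrib)
    hence eq: "(1 - del) / th * \<psi> (Suc b) + 2 * del * G b = (a + c)^2 * \<psi> b - Cst"
      unfolding e by (simp add: algebra_simps power2_eq_square)
    have psb: "\<psi> b \<ge> real L + 1"
    proof -
      have "\<psi> b - (real L + 1) = real b * (real L - real b)" by (simp add: \<psi>_def algebra_simps)
      also have "\<dots> \<ge> 0" using that by simp
      finally show ?thesis by simp
    qed
    have "lam * Cst \<le> \<eta> * real L" using L eta(1) by (simp add: field_simps)
    also have "\<dots> \<le> \<eta> * \<psi> b" using psb eta(1) by (intro mult_left_mono) auto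
    finally have "(1 + 3 * \<eta>) * \<psi> b \<le> lam * (a + c)^2 * \<psi> b - lam * Cst"
      by (simp add: eta(2) algebra_simps)
    also have "\<dots> = lam * ((1 - del) / th * \<psi> (Suc b) + 2 * del * G b)"
      unfolding eq by (simp add: algebra_simps)
    also have "\<dots> \<le> lam * ((1 - del) / th * \<psi> (Suc b) + 2 * del * (\<Sum>i\<le>b. th ^ (b - i) * \<psi> i))"
      using F[of b] assms by (intro mult_left_mono add_left_mono) auto
    finally have "(1 + 3 * \<eta>) * \<psi> b / th ^ b \<le>
       lam * ((1 - del) / th * \<psi> (Suc b) + 2 * del * (\<Sum>i\<le>b. th ^ (b - i) * \<psi> i)) / th ^ b"
      using th by (intro divide_right_mono) auto
    also have "\<dots> = lam * ((1 - del) * \<phi> (Suc b) + 2 * del * (\<Sum>i\<le>b. \<phi> i))"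
      unfolding s by (simp add: \<phi>_def add_divide_distrib distrib_left mult_ac)
    finally show ?thesis by (simp add: \<phi>_def)
  qed
  have "\<forall>b\<le>L. \<phi> b > 0" using th by (auto simp: \<phi>_def \<psi>_def)
  moreover have "\<phi> (Suc L) = 0" by (simp add: \<phi>_def \<psi>_def)
  ultimately show ?thesis using key eta(1) by blast
qed

section \<open>Two-regular edge sets\<close>

definition incident :: "edge_set \<Rightarrow> nat \<Rightarrow> edge_set" where
  "incident H v = {e \<in> H. v \<in> e}"

text \<open>The degree form of a two-factor. In this form the effect of flipping a cycle is checked
  vertex by vertex, without tracing how cycles split and merge; \<open>two_factor_iff\<close> links
  it to lists of cycles.\<close>

definition two_regular :: "nat set \<Rightarrow> edge_set \<Rightarrow> bool" where
  "two_regular V H \<longleftrightarrow> finite V \<and> (\<forall>e\<in>H. e \<subseteq> V \<and> card e = 2) \<and>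
     (\<forall>v\<in>V. card (incident H v) = 2)"

fun path_edges :: "nat list \<Rightarrow> nat set list" where
  "path_edges [] = []"
| "path_edges [x] = []"
| "path_edges (x # y # r) = {x, y} # path_edges (y # r)"

lemma two_regular_finite: "two_regular V H \<Longrightarrow> finite H"
  unfolding two_regular_def
  by (metis finite_Pow_iff finite_subset Pow_iff subsetI)

lemma two_regular_card:
  assumes "two_regular V H"
  shows "card H = card V"
proof -
  have fin: "finite V" "finite H"
    using assms two_regular_finite by (auto simp: two_regular_def)
  have "(\<Sum>v\<in>V. card (incident H v)) = (\<Sum>v\<in>V. \<Sum>e\<in>H. if v \<in> e then 1 else 0)"
    using fin by (intro sum.cong refl) (simp add: incident_def sum.If_cases Int_def conj_commute)
  also have "\<dots> = (\<Sum>e\<in>H. \<Sum>v\<in>V. if v \<in> e then 1 else 0)"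
    by (rule sum.swap)
  also have "\<dots> = (\<Sum>e\<in>H. card e)"
  proof (intro sum.cong refl)
    fix e assume "e \<in> H"
    hence "V \<inter> {v. v \<in> e} = e" using assms by (auto simp: two_regular_def)
    thus "(\<Sum>v\<in>V. if v \<in> e then 1 else 0) = card e"
      using fin by (simp add: sum.If_cases)
  qed
  also have "\<dots> = 2 * card H"
    using assms by (simp add: two_regular_def)
  finally show ?thesis
    using assms by (simp add: two_regular_def)
qed

lemma two_regular_Union:
  assumes "two_regular V H"
  shows "\<Union>H = V"
proof
  show "\<Union>H \<subseteq> V" using assms by (auto simp: two_regular_def)
  show "V \<subseteq> \<Union>H"
  proof
    fix v assume "v \<in> V"
    hence "incident H v \<noteq> {}" using assms by (auto simp: two_regular_def)
    thus "v \<in> \<Union>H" by (auto simp: incident_def)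
  qed
qed

lemma two_regular_Un:
  assumes "two_regular V H" "two_regular V' H'" "V \<inter> V' = {}"
  shows "two_regular (V \<union> V') (H \<union> H')"
proof -
  have sub: "e \<in> H \<Longrightarrow> e \<subseteq> V" "e \<in> H' \<Longrightarrow> e \<subseteq> V'" for e
    using assms by (auto simp: two_regular_def)
  have "incident (H \<union> H') v = incident H v" if "v \<in> V" for v
    using that assms(3) sub unfolding incident_def by blast
  moreover have "incident (H \<union> H') v = incident H' v" if "v \<in> V'" for v
    using that assms(3) sub unfolding incident_def by blast
  ultimately show ?thesis using assms by (auto simp: two_regular_def)
qed

section \<open>Edges of paths and cycles\<close>

lemma length_path_edges: "length (path_edges xs) = length xs - 1"
  by (induction xs rule: path_edges.induct) auto

lemma nth_path_edges: "Suc i < length xs \<Longrightarrow> path_edges xs ! i = {xs ! i, xs ! Suc i}"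
proof (induction xs arbitrary: i rule: path_edges.induct)
  case (3 x y r)
  thus ?case by (cases i) auto
qed auto

lemma path_edges_append:
  "xs \<noteq> [] \<Longrightarrow> ys \<noteq> [] \<Longrightarrow>
    path_edges (xs @ ys) = path_edges xs @ {last xs, hd ys} # path_edges ys"
proof (induction xs rule: path_edges.induct)
  case (2 x)
  thus ?case by (cases ys) auto
qed auto

lemma path_edges_subset: "e \<in> set (path_edges xs) \<Longrightarrow> e \<subseteq> set xs"
  by (induction xs rule: path_edges.induct) auto

lemma path_edges_card: "distinct xs \<Longrightarrow> e \<in> set (path_edges xs) \<Longrightarrow> card e = 2"
  by (induction xs rule: path_edges.induct) auto

lemma path_edges_distinct: "distinct xs \<Longrightarrow> distinct (path_edges xs)"
proof (induction xs rule: path_edges.induct)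
  case (3 x y r)
  moreover have "{x, y} \<notin> set (path_edges (y # r))"
    using 3(2) path_edges_subset[of "{x,y}" "y # r"] by auto
  ultimately show ?case by auto
qed auto

lemma cycle_edges_conv:
  assumes "xs \<noteq> []"
  shows "cycle_edges xs = insert {last xs, hd xs} (set (path_edges xs))"
proof -
  define l where "l = length xs"
  have l: "l > 0" using assms by (simp add: l_def)
  have "{i. i < l} = insert (l - 1) {i. Suc i < l}" using l by auto
  moreover have "cycle_edges xs = (\<lambda>i. {xs ! i, xs ! (Suc i mod l)}) ` {i. i < l}"
    unfolding cycle_edges_def l_def[symmetric] by blast
  ultimately have "cycle_edges xs = (\<lambda>i. {xs ! i, xs ! (Suc i mod l)}) ` insert (l - 1) {i. Suc i < l}"
    by simp
  also have "\<dots> = insert {xs ! (l - 1), xs ! 0} ((\<lambda>i. {xs ! i, xs ! Suc i}) ` {i. Suc i < l})"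
    using l by simp
  also have "(\<lambda>i. {xs ! i, xs ! Suc i}) ` {i. Suc i < l} = (\<lambda>i. path_edges xs ! i) ` {i. Suc i < l}"
    by (intro image_cong refl) (simp add: nth_path_edges l_def)
  also have "\<dots> = set (path_edges xs)"
    by (auto simp: set_conv_nth length_path_edges l_def intro!: imageI)
  finally show ?thesis
    using assms by (simp add: l_def last_conv_nth hd_conv_nth)
qed

lemma cycle_edges_swap: "cycle_edges (xs @ ys) = cycle_edges (ys @ xs)"
proof (cases "xs = [] \<or> ys = []")
  case False
  thus ?thesis
    by (simp add: cycle_edges_conv path_edges_append insert_commute Un_commute)
qed auto

lemma closing_edge_notin:
  assumes "distinct xs" "3 \<le> length xs"
  shows "{last xs, hd xs} \<notin> set (path_edges xs)"
proof -
  obtain x y r where xs: "xs = x # y # r" "r \<noteq> []"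
    using assms(2) by (cases xs; cases "tl xs"; cases "tl (tl xs)") auto
  have "last r \<in> set r" using xs by auto
  thus ?thesis using assms(1) xs path_edges_subset[of _ "y # r"]
    by (auto simp: doubleton_eq_iff)
qed

lemma card_cycle_edges:
  assumes "distinct xs" "3 \<le> length xs"
  shows "card (cycle_edges xs) = length xs"
proof -
  have "xs \<noteq> []" using assms by auto
  have "length xs - 1 + 1 = length xs" using assms by linarith
  thus ?thesis using closing_edge_notin[OF assms] path_edges_distinct[OF assms(1)] \<open>xs \<noteq> []\<close>
    by (simp add: cycle_edges_conv distinct_card length_path_edges)
qed

lemma two_regular_cycle:
  assumes "distinct xs" "3 \<le> length xs"
  shows "two_regular (set xs) (cycle_edges xs)"
  unfolding two_regular_def
proof (intro conjI ballI)
  have ne: "xs \<noteq> []" using assms by auto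
  fix e assume e: "e \<in> cycle_edges xs"
  show "e \<subseteq> set xs" using e ne path_edges_subset[of e xs] by (auto simp: cycle_edges_conv)
  have "last xs \<noteq> hd xs"
    using assms by (cases xs) (auto split: if_splits)
  thus "card e = 2" using e ne assms path_edges_card[of xs e] by (auto simp: cycle_edges_conv)
next
  fix v assume "v \<in> set xs"
  then obtain as bs where xs: "xs = as @ v # bs" by (meson split_list)
  define ys where "ys = v # bs @ as"
  have ys: "distinct ys" "3 \<le> length ys" "cycle_edges xs = cycle_edges ys"
    using assms cycle_edges_swap[of as "v # bs"] by (auto simp: xs ys_def)
  obtain y r where yr: "ys = v # y # r" "r \<noteq> []"
    using ys(1,2) unfolding ys_def
    by (cases "bs @ as"; cases "tl (bs @ as)") auto
  have "incident (cycle_edges ys) v = {{v, y}, {last r, v}}"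
    using yr ys(1) path_edges_subset[of _ "y # r"]
    by (auto simp: incident_def cycle_edges_conv insert_commute)
  moreover have "last r \<noteq> y" "y \<noteq> v" "last r \<noteq> v" using yr ys(1) last_in_set[of r] by auto
  ultimately show "card (incident (cycle_edges xs) v) = 2"
    using ys(3) by (simp add: doubleton_eq_iff)
qed auto

section \<open>Two-regular edge sets are exactly the two-factors\<close>

lemma two_regular_Union_family:
  assumes "finite C" "\<forall>xs\<in>C. two_regular (f xs) (g xs)" "disjoint_family_on f C"
  shows "two_regular (\<Union>xs\<in>C. f xs) (\<Union>xs\<in>C. g xs)"
  using assms
proof (induction C)
  case empty
  show ?case by (simp add: two_regular_def)
next
  case (insert x C)
  have "f x \<inter> (\<Union>xs\<in>C. f xs) = {}"
    using insert(2,5) by (auto simp: disjoint_family_on_def)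
  moreover have "disjoint_family_on f C"
    using insert(5) by (auto simp: disjoint_family_on_def)
  ultimately show ?case using insert two_regular_Un by simp
qed

lemma finite_cycle_lists:
  assumes "finite V" "\<forall>xs\<in>C. distinct xs" "(\<Union>xs\<in>C. set xs) = V"
  shows "finite C"
proof (rule finite_subset)
  show "C \<subseteq> {xs. set xs \<subseteq> V \<and> length xs \<le> card V}"
    using assms by (auto simp: distinct_card[symmetric] intro!: card_mono)
  show "finite {xs. set xs \<subseteq> V \<and> length xs \<le> card V}"
    using assms(1) by (rule finite_lists_length_le)
qed

lemma two_factor_imp_two_regular:
  assumes "two_factor V H" "finite V"
  shows "two_regular V H"
proof -
  obtain C where C: "\<forall>xs\<in>C. distinct xs \<and> 3 \<le> length xs" "disjoint_family_on set C"
     "(\<Union>xs\<in>C. set xs) = V" "(\<Union>xs\<in>C. cycle_edges xs) = H"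
    using assms(1) by (auto simp: two_factor_def)
  show ?thesis
    using two_regular_Union_family[of C set cycle_edges] finite_cycle_lists[OF assms(2) _ C(3)] C
      two_regular_cycle by auto
qed

lemma two_regular_Diff:
  assumes "two_regular V H" "W \<subseteq> V" "\<forall>e\<in>H. e \<inter> W \<noteq> {} \<longrightarrow> e \<subseteq> W"
  shows "two_regular (V - W) {e \<in> H. e \<inter> W = {}}" "two_regular W {e \<in> H. e \<subseteq> W}"
proof -
  have "incident {e \<in> H. e \<inter> W = {}} v = incident H v" if "v \<in> V - W" for v
    using that assms by (auto simp: incident_def)
  moreover have "incident {e \<in> H. e \<subseteq> W} v = incident H v" if "v \<in> W" for v
    using that assms by (auto simp: incident_def)
  ultimately show "two_regular (V - W) {e \<in> H. e \<inter> W = {}}" "two_regular W {e \<in> H. e \<subseteq> W}"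
    using assms finite_subset[of W V] by (auto simp: two_regular_def subset_iff)
qed

lemma card_two_other: "card e = 2 \<Longrightarrow> v \<in> e \<Longrightarrow> \<exists>y. y \<noteq> v \<and> e = {v, y}"
  by (auto simp: card_2_iff)

lemma incident_pair:
  assumes "two_regular V H" "v \<in> V"
  obtains y z where "incident H v = {{v, y}, {v, z}}" "y \<noteq> z" "y \<noteq> v" "z \<noteq> v" "y \<in> V" "z \<in> V"
proof -
  obtain e f where ef: "incident H v = {e, f}" "e \<noteq> f"
    using assms unfolding two_regular_def by (meson card_2_iff)
  hence "v \<in> e" "v \<in> f" "e \<in> H" "f \<in> H" by (auto simp: incident_def)
  moreover from this have "card e = 2" "card f = 2" "e \<subseteq> V" "f \<subseteq> V"
    using assms(1) by (auto simp: two_regular_def)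
  ultimately obtain y z where "e = {v, y}" "f = {v, z}" "y \<noteq> v" "z \<noteq> v"
    by (meson card_two_other)
  thus ?thesis using that[of y z] ef \<open>e \<subseteq> V\<close> \<open>f \<subseteq> V\<close> by auto
qed

text \<open>Take a longest path. The second neighbour \<open>q\<close> of its last vertex
  \<open>x\<close> must lie on it, and by the degree condition only its first vertex is possible, so
  the edge from \<open>x\<close> to \<open>q\<close> closes the path.\<close>

lemma two_regular_find_cycle:
  assumes "two_regular V H" "V \<noteq> {}"
  shows "\<exists>xs. distinct xs \<and> 3 \<le> length xs \<and> set xs \<subseteq> V \<and> cycle_edges xs \<subseteq> H"
proof -
  define P where "P = (\<lambda>xs. distinct xs \<and> set xs \<subseteq> V \<and> set (path_edges xs) \<subseteq> H)"
  have finV: "finite V" using assms by (auto simp: two_regular_def)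
  have bd: "length xs \<le> card V" if "P xs" for xs
    using that finV by (auto simp: P_def distinct_card[symmetric] intro!: card_mono)
  obtain v where v: "v \<in> V" using assms by auto
  obtain y z where yz: "incident H v = {{v, y}, {v, z}}" "y \<noteq> z" "y \<noteq> v" "z \<noteq> v" "y \<in> V" "z \<in> V"
    using incident_pair[OF assms(1) v] .
  have "{y, v} \<in> H" "{v, z} \<in> H" using yz(1) by (auto simp: incident_def insert_commute)
  hence P3: "P [y, v, z]" using yz v by (auto simp: P_def)
  have "P [y,v,z] \<Longrightarrow> \<exists>xs. P xs \<and> (\<forall>ys. P ys \<longrightarrow> length ys \<le> length xs)"
    using bd by (intro ex_has_greatest_nat[where b = "Suc (card V)"]) (auto simp: less_Suc_eq_le)
  then obtain xs where xs: "P xs" "\<And>ys. P ys \<Longrightarrow> length ys \<le> length xs"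
    using P3 by auto
  have len: "3 \<le> length xs" using xs(2)[OF P3] by simp
  \<comment> \<open>Reversing exposes the last vertex \<open>x\<close> and its predecessor
    \<open>p\<close> to pattern matching.\<close>
  obtain x p r where zs: "rev xs = x # p # r" "r \<noteq> []"
  proof -
    have "3 \<le> length (rev xs)" using len by simp
    thus ?thesis using that
      by (cases "rev xs"; cases "tl (rev xs)"; cases "tl (tl (rev xs))") (simp_all del: length_rev)
  qed
  have xs_eq: "xs = rev r @ [p, x]" using arg_cong[OF zs(1), of rev] by simp
  have xs_last: "{p, x} \<in> H" using xs(1) zs(2) by (auto simp: P_def xs_eq path_edges_append)
  have xV: "x \<in> V" using xs(1) by (auto simp: P_def xs_eq)
  obtain a b where ab: "incident H x = {{x, a}, {x, b}}" "a \<noteq> b" "a \<noteq> x" "b \<noteq> x" "a \<in> V" "b \<in> V"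
    using incident_pair[OF assms(1) xV] .
  have "{x, p} \<in> incident H x" using xs_last by (auto simp: incident_def insert_commute)
  hence "p = a \<or> p = b" using ab by (auto simp: doubleton_eq_iff)
  then obtain q where q: "incident H x = {{x, p}, {x, q}}" "q \<noteq> p" "q \<noteq> x" "q \<in> V"
    using ab by (metis insert_commute)
  have qH: "{x, q} \<in> H" using q(1) by (auto simp: incident_def)
  have "q \<in> set xs"
  proof (rule ccontr)
    assume "q \<notin> set xs"
    moreover have "xs \<noteq> []" "last xs = x" by (auto simp: xs_eq)
    ultimately have "P (xs @ [q])" using xs(1) qH q(4) by (auto simp: P_def path_edges_append)
    from xs(2)[OF this] show False by simp
  qed
  hence qr: "q \<in> set r" using q xs_eq by auto
  then obtain r1 r2 where r: "r = r1 @ q # r2" by (meson split_list)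
  \<comment> \<open>Otherwise \<open>q\<close> would be an inner vertex of the path, and its two
    path edges together with the edge to \<open>x\<close> would give it degree three.\<close>
  have "r2 = []"
  proof (rule ccontr)
    assume "r2 \<noteq> []"
    then obtain s r3 where r2: "r2 = s # r3" by (cases r2) auto
    obtain t r0 where t: "rev (p # r1) = t # r0" by (cases "rev (p # r1)") auto
    have xs2: "xs = rev r3 @ [s] @ [q] @ (t # r0) @ [x]"
      using t by (simp add: xs_eq r r2)
    have "{s, q} \<in> set (path_edges xs)" "{q, t} \<in> set (path_edges xs)"
      unfolding xs2 by (cases "rev r3 = []"; simp add: path_edges_append)+
    hence "{s, q} \<in> incident H q" "{q, t} \<in> incident H q" "{x, q} \<in> incident H q"
      using xs(1) qH by (auto simp: P_def incident_def)
    moreover have "distinct [s, q, t, x]" using xs(1) unfolding P_def xs2 by auto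
    hence "card {{s,q},{q,t},{x,q}} = 3" by (auto simp: doubleton_eq_iff card_insert_if)
    ultimately have "3 \<le> card (incident H q)"
      using card_mono[of "incident H q" "{{s,q},{q,t},{x,q}}"] two_regular_finite[OF assms(1)]
      by (simp add: incident_def)
    thus False using assms(1) q(4) by (simp add: two_regular_def)
  qed
  hence "hd xs = q" "last xs = x" using xs_eq r by auto
  moreover have "xs \<noteq> []" using len by auto
  ultimately have "cycle_edges xs = insert {x, q} (set (path_edges xs))"
    using cycle_edges_conv[of xs] by simp
  hence "cycle_edges xs \<subseteq> H" using xs(1) qH by (simp add: P_def)
  thus ?thesis using xs(1) len by (auto simp: P_def)
qed

text \<open>A cycle inside \<open>H\<close> uses up the degree of its vertices, so no further edge
  of \<open>H\<close> touches it and the rest is two-regular on fewer vertices.\<close>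

lemma two_regular_imp_two_factor:
  "two_regular V H \<Longrightarrow> two_factor V H"
proof (induction "card V" arbitrary: V H rule: less_induct)
  case less
  have finV: "finite V" using less(2) by (auto simp: two_regular_def)
  show ?case
  proof (cases "V = {}")
    case True
    hence "H = {}" using less(2) by (auto simp: two_regular_def)
    thus ?thesis using True by (auto simp: two_factor_def disjoint_family_on_def intro!: exI[of _ "{}"])
  next
    case False
    obtain xs where xs: "distinct xs" "3 \<le> length xs" "set xs \<subseteq> V" "cycle_edges xs \<subseteq> H"
      using two_regular_find_cycle[OF less(2) False] by auto
    note cyc = two_regular_cycle[OF xs(1,2)]
    have inc: "incident H v = incident (cycle_edges xs) v" if "v \<in> set xs" for v
    proof (rule sym, rule card_subset_eq)
      show "finite (incident H v)" using two_regular_finite[OF less(2)] by (simp add: incident_def)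
      show "incident (cycle_edges xs) v \<subseteq> incident H v" using xs(4) by (auto simp: incident_def)
      show "card (incident (cycle_edges xs) v) = card (incident H v)"
        using cyc less(2) that xs(3) by (auto simp: two_regular_def)
    qed
    have touch: "e \<in> cycle_edges xs" if "e \<in> H" "v \<in> e" "v \<in> set xs" for e v
    proof -
      have "e \<in> incident H v" using that by (simp add: incident_def)
      thus ?thesis unfolding inc[OF that(3)] by (simp add: incident_def)
    qed
    have closed: "\<forall>e\<in>H. e \<inter> set xs \<noteq> {} \<longrightarrow> e \<subseteq> set xs"
    proof (intro ballI impI)
      fix e assume "e \<in> H" "e \<inter> set xs \<noteq> {}"
      hence "e \<in> cycle_edges xs" using touch by blast
      thus "e \<subseteq> set xs" using cyc unfolding two_regular_def by blast
    qed
    define H' where "H' = {e \<in> H. e \<inter> set xs = {}}"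
    have H_eq: "H = cycle_edges xs \<union> H'"
      using touch xs(4) by (auto simp: H'_def)
    have "hd xs \<in> set xs" using xs(2) by (intro hd_in_set) auto
    hence "card (V - set xs) < card V"
      using xs(3) finV by (intro psubset_card_mono) blast+
    from less(1)[OF this] have "two_factor (V - set xs) H'"
      using two_regular_Diff(1)[OF less(2) xs(3) closed] by (simp add: H'_def)
    then obtain C where C: "\<forall>xs\<in>C. distinct xs \<and> 3 \<le> length xs" "disjoint_family_on set C"
       "(\<Union>xs\<in>C. set xs) = V - set xs" "(\<Union>xs\<in>C. cycle_edges xs) = H'"
      by (auto simp: two_factor_def)
    have "disjoint_family_on set (insert xs C)"
      using C(2,3) by (auto simp: disjoint_family_on_def)
    thus ?thesis unfolding two_factor_def
      using C xs H_eq by (intro exI[of _ "insert xs C"]) auto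
  qed
qed

lemma two_factor_iff: "finite V \<Longrightarrow> two_factor V H \<longleftrightarrow> two_regular V H"
  using two_factor_imp_two_regular two_regular_imp_two_factor by blast

text \<open>An orientation of all cycles at once. Stretches of planted cycles then become iterates
  of \<open>nx\<close> or of its inverse, and the lists of the single cycles can be
  forgotten.\<close>

lemma two_regular_successor:
  assumes "two_regular V H"
  obtains nx where "bij_betw nx V V" "H = (\<lambda>v. {v, nx v}) ` V"
    "\<And>v. v \<in> V \<Longrightarrow> nx v \<noteq> v \<and> nx (nx v) \<noteq> v"
proof -
  have finV: "finite V" using assms by (auto simp: two_regular_def)
  obtain C where C: "\<forall>xs\<in>C. distinct xs \<and> 3 \<le> length xs" "disjoint_family_on set C"
     "(\<Union>xs\<in>C. set xs) = V" "(\<Union>xs\<in>C. cycle_edges xs) = H"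
    using two_regular_imp_two_factor[OF assms] by (auto simp: two_factor_def)
  define f where "f = (\<lambda>xs v. the (map_of (zip xs (rotate1 xs)) (v::nat)))"
  have f: "f xs (xs ! i) = xs ! (Suc i mod length xs)" if "xs \<in> C" "i < length xs" for xs i
    using that C(1) by (simp add: f_def map_of_zip_nth nth_rotate1)
  define pick where "pick = (\<lambda>v. THE xs. xs \<in> C \<and> v \<in> set xs)"
  have pick: "pick v = xs" if "xs \<in> C" "v \<in> set xs" for v xs
    unfolding pick_def using that C(2) by (intro the_equality) (auto simp: disjoint_family_on_def)
  define nx where "nx = (\<lambda>v. f (pick v) v)"
  have nx: "nx (xs ! i) = xs ! (Suc i mod length xs)" if "xs \<in> C" "i < length xs" for xs i
    using f[OF that] pick[of xs "xs ! i"] that by (simp add: nx_def)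
  have idx: "\<exists>xs i. xs \<in> C \<and> i < length xs \<and> v = xs ! i" if "v \<in> V" for v
    using that C(3) by (force simp: in_set_conv_nth)
  have surj: "V \<subseteq> nx ` V"
  proof
    fix v assume "v \<in> V"
    then obtain xs i where xi: "xs \<in> C" "i < length xs" "v = xs ! i" using idx by blast
    define j where "j = (if i = 0 then length xs - 1 else i - 1)"
    have j: "j < length xs" "Suc j mod length xs = i" using xi(2) by (auto simp: j_def)
    hence "nx (xs ! j) = v" using nx[OF xi(1) j(1)] xi by simp
    moreover have "xs ! j \<in> V" using C(3) xi(1) j(1) by force
    ultimately show "v \<in> nx ` V" by blast
  qed
  have into: "nx ` V \<subseteq> V"
  proof safe
    fix v assume "v \<in> V"
    then obtain xs i where xi: "xs \<in> C" "i < length xs" "v = xs ! i" using idx by blast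
    have "Suc i mod length xs < length xs" using xi(2) by (intro mod_less_divisor) auto
    thus "nx v \<in> V" using nx[OF xi(1,2)] xi C(3) by (force simp: in_set_conv_nth)
  qed
  have bij: "bij_betw nx V V"
    using surj into finV by (metis bij_betw_def endo_inj_surj finite_surj_inj subset_antisym)
  have H_eq: "H = (\<lambda>v. {v, nx v}) ` V"
  proof
    show "H \<subseteq> (\<lambda>v. {v, nx v}) ` V"
    proof
      fix e assume "e \<in> H"
      then obtain xs i where "xs \<in> C" "i < length xs" "e = {xs ! i, xs ! (Suc i mod length xs)}"
        using C(4) by (auto simp: cycle_edges_def)
      moreover have "xs ! i \<in> V" using C(3) calculation by force
      ultimately show "e \<in> (\<lambda>v. {v, nx v}) ` V" using nx by (intro image_eqI[of _ _ "xs ! i"]) auto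
    qed
    show "(\<lambda>v. {v, nx v}) ` V \<subseteq> H"
    proof safe
      fix v assume "v \<in> V"
      then obtain xs i where xi: "xs \<in> C" "i < length xs" "v = xs ! i" using idx by blast
      have "{v, nx v} \<in> cycle_edges xs" using nx[OF xi(1,2)] xi by (auto simp: cycle_edges_def)
      thus "{v, nx v} \<in> H" using C(4) xi(1) by auto
    qed
  qed
  have "nx v \<noteq> v \<and> nx (nx v) \<noteq> v" if "v \<in> V" for v
  proof -
    obtain xs i where xi: "xs \<in> C" "i < length xs" "v = xs ! i" using idx[OF \<open>v \<in> V\<close>] by blast
    have len: "3 \<le> length xs" "distinct xs" using C(1) xi(1) by auto
    let ?l = "length xs"
    have s: "Suc i mod ?l < ?l" using xi(2) by (intro mod_less_divisor) auto
    hence s2: "Suc (Suc i mod ?l) mod ?l < ?l" by (intro mod_less_divisor) auto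
    have "Suc i mod ?l \<noteq> i" using xi(2) len by (cases "Suc i = ?l") auto
    moreover have "Suc (Suc i mod ?l) mod ?l \<noteq> i"
      using xi(2) len by (cases "Suc i = ?l"; cases "Suc (Suc i) = ?l") auto
    ultimately show ?thesis
      using nx[OF xi(1,2)] nx[OF xi(1) s] xi s s2 len by (simp add: nth_eq_iff_index_eq)
  qed
  thus ?thesis using that bij H_eq by blast
qed

section \<open>Counting two-regular edge sets\<close>

definition two_regulars :: "nat set \<Rightarrow> edge_set set" where
  "two_regulars V = {H. two_regular V H}"

lemma finite_two_regulars: "finite V \<Longrightarrow> finite (two_regulars V)"
  by (rule finite_subset[of _ "Pow (Pow V)"]) (auto simp: two_regulars_def two_regular_def)

lemma two_regulars_nonempty:
  assumes "finite V" "3 \<le> card V"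
  shows "two_regulars V \<noteq> {}"
proof -
  have "two_regular V (cycle_edges (sorted_list_of_set V))"
    using two_regular_cycle[of "sorted_list_of_set V"] assms by simp
  thus ?thesis by (auto simp: two_regulars_def)
qed

lemma two_regular_image:
  assumes "two_regular V H" "inj_on f V"
  shows "two_regular (f ` V) ((`) f ` H)"
  unfolding two_regular_def
proof (intro conjI ballI)
  show "finite (f ` V)" using assms by (simp add: two_regular_def)
  fix e assume "e \<in> (`) f ` H"
  then obtain d where d: "d \<in> H" "e = f ` d" by auto
  hence "d \<subseteq> V" "card d = 2" using assms by (auto simp: two_regular_def)
  thus "e \<subseteq> f ` V" "card e = 2" using d assms(2) by (auto simp: card_image inj_on_subset)
next
  fix w assume "w \<in> f ` V"
  then obtain v where v: "v \<in> V" "w = f v" by auto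
  have sub: "\<And>d. d \<in> H \<Longrightarrow> d \<subseteq> V" using assms by (auto simp: two_regular_def)
  have "f v \<in> f ` d \<longleftrightarrow> v \<in> d" if "d \<in> H" for d
    using inj_on_image_mem_iff[OF assms(2) v(1) sub[OF that]] .
  hence "incident ((`) f ` H) w = (`) f ` incident H v"
    unfolding incident_def v(2) by blast
  moreover have "inj_on ((`) f) (incident H v)"
    by (rule inj_on_subset[OF inj_on_image_Pow[OF assms(2)]]) (use sub in \<open>auto simp: incident_def\<close>)
  ultimately show "card (incident ((`) f ` H) w) = 2"
    using assms(1) v(1) by (simp add: card_image two_regular_def)
qed

lemma card_two_regulars_le:
  assumes "finite V" "finite W" "card V = card W"
  shows "card (two_regulars V) \<le> card (two_regulars W)"
proof -
  obtain f where f: "bij_betw f V W" using finite_same_card_bij[OF assms] by auto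
  hence inj: "inj_on f V" "f ` V = W" by (auto simp: bij_betw_def)
  show ?thesis
  proof (rule card_inj_on_le)
    show "inj_on ((`) ((`) f)) (two_regulars V)"
      by (rule inj_on_subset[OF inj_on_image_Pow[OF inj_on_image_Pow[OF inj(1)]]])
        (auto simp: two_regulars_def two_regular_def)
    show "(`) ((`) f) ` two_regulars V \<subseteq> two_regulars W"
      using two_regular_image inj by (auto simp: two_regulars_def)
    show "finite (two_regulars W)" using assms finite_two_regulars by auto
  qed
qed

text \<open>Two-regular sets are carried over by a bijection of the vertex sets. Equal counts make
  the law of the planted two-factor uniform over all vertex sets together, which the posterior
  argument relies on.\<close>

lemma card_two_regulars_cong:
  assumes "finite V" "finite W" "card V = card W"
  shows "card (two_regulars V) = card (two_regulars W)"
  using card_two_regulars_le[of V W] card_two_regulars_le[of W V] assms by auto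

lemma two_regular_subdivide:
  assumes "two_regular V H" "e \<in> H" "x \<notin> V"
  shows "two_regular (insert x V) ((H - {e}) \<union> (\<lambda>u. {u, x}) ` e)"
proof -
  let ?H' = "(H - {e}) \<union> (\<lambda>u. {u, x}) ` e"
  have fin: "finite V" "finite H" and sub: "\<And>d. d \<in> H \<Longrightarrow> d \<subseteq> V" "card e = 2" "e \<subseteq> V"
    using assms two_regular_finite by (auto simp: two_regular_def)
  hence xe: "x \<notin> e" using assms by auto
  have inj: "inj_on (\<lambda>u. {u, x}) e" using xe by (auto simp: inj_on_def doubleton_eq_iff)
  have card2: "card d = 2" if "d \<in> H" for d using that assms by (auto simp: two_regular_def)
  show ?thesis unfolding two_regular_def
  proof (intro conjI ballI)
    show "finite (insert x V)" using fin by simp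
    fix d assume "d \<in> ?H'"
    thus "d \<subseteq> insert x V" "card d = 2" using sub card2 xe by (auto simp: card_insert_if)
  next
    fix v assume v: "v \<in> insert x V"
    show "card (incident ?H' v) = 2"
    proof (cases "v = x")
      case True
      have "incident ?H' x = (\<lambda>u. {u, x}) ` e"
        using sub(1) assms(3) by (auto simp: incident_def)
      thus ?thesis using True inj sub by (simp add: card_image)
    next
      case False
      hence vV: "v \<in> V" using v by simp
      have c: "card (incident H v) = 2" using assms(1) vV by (simp add: two_regular_def)
      show ?thesis
      proof (cases "v \<in> e")
        case True
        have "incident ?H' v = insert {v, x} (incident H v - {e})"
          using True False xe by (auto simp: incident_def)
        moreover have "{v, x} \<notin> incident H v - {e}" using sub(1) assms(3) by (auto simp: incident_def)
        moreover have "e \<in> incident H v" "finite (incident H v)"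
          using True assms fin by (auto simp: incident_def)
        ultimately show ?thesis using c by simp
      next
        case F2: False
        have "incident ?H' v = incident H v" using False F2 by (auto simp: incident_def)
        thus ?thesis using c by simp
      qed
    qed
  qed
qed

text \<open>The new vertex can subdivide any of the \<open>card H = card V\<close> edges. The result
  determines both \<open>H\<close> and the edge, because the neighbours of \<open>x\<close> are the
  ends of the subdivided edge.\<close>

lemma card_two_regulars_insert:
  assumes "finite V" "x \<notin> V"
  shows "card (two_regulars V) * card V \<le> card (two_regulars (insert x V))"
proof -
  define S where "S = (SIGMA H:two_regulars V. H)"
  define g where "g = (\<lambda>(H, e). (H - {e}) \<union> (\<lambda>u. {u, x}) ` e)"
  have "card S = (\<Sum>H\<in>two_regulars V. card H)"
    unfolding S_def using finite_two_regulars[OF assms(1)]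
    by (intro card_SigmaI) (auto simp: two_regulars_def two_regular_finite)
  also have "\<dots> = card (two_regulars V) * card V"
    by (simp add: two_regulars_def two_regular_card)
  finally have S: "card S = card (two_regulars V) * card V" .
  have rec: "e = {u. {u, x} \<in> g (H, e) \<and> u \<noteq> x}" "H = insert e {d \<in> g (H, e). x \<notin> d}"
    if "(H, e) \<in> S" for H e
  proof -
    have H: "two_regular V H" "e \<in> H" using that by (auto simp: S_def two_regulars_def)
    hence sub: "\<And>d. d \<in> H \<Longrightarrow> x \<notin> d" using assms(2) by (auto simp: two_regular_def)
    show "e = {u. {u, x} \<in> g (H, e) \<and> u \<noteq> x}"
      using sub[OF H(2)] sub by (auto simp: g_def doubleton_eq_iff)
    show "H = insert e {d \<in> g (H, e). x \<notin> d}"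
      using sub H(2) by (auto simp: g_def)
  qed
  have "inj_on g S"
  proof (rule inj_onI, clarify)
    fix H e H' e' assume *: "(H, e) \<in> S" "(H', e') \<in> S" "g (H, e) = g (H', e')"
    have "e = e'" using rec(1)[OF *(1)] rec(1)[OF *(2)] *(3) by simp
    thus "H = H' \<and> e = e'" using rec(2)[OF *(1)] rec(2)[OF *(2)] *(3) by simp
  qed
  moreover have "g ` S \<subseteq> two_regulars (insert x V)"
    using two_regular_subdivide assms(2) by (auto simp: S_def g_def two_regulars_def)
  ultimately show ?thesis
    using card_inj_on_le[of g S "two_regulars (insert x V)"] finite_two_regulars assms(1) S by simp
qed

lemma card_two_regulars_extend:
  assumes "finite V" "finite W" "V \<inter> W = {}"
  shows "card (two_regulars V) * card V ^ card W \<le> card (two_regulars (V \<union> W))"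
  using assms(2,3)
proof (induction W)
  case (insert x W)
  have "card (two_regulars V) * card V ^ card (insert x W) =
      (card (two_regulars V) * card V ^ card W) * card V" using insert by simp
  also have "\<dots> \<le> card (two_regulars (V \<union> W)) * card (V \<union> W)"
    using insert assms(1) by (intro mult_mono) (auto intro: card_mono)
  also have "\<dots> \<le> card (two_regulars (insert x (V \<union> W)))"
    using insert assms(1) by (intro card_two_regulars_insert) auto
  finally show ?case by simp
qed simp

section \<open>Many small components are rare\<close>

definition closed_family :: "nat \<Rightarrow> nat set \<Rightarrow> edge_set \<Rightarrow> nat set set \<Rightarrow> bool" where
  "closed_family j V H F \<longleftrightarrow> finite F \<and> disjoint F \<and>
     (\<forall>W\<in>F. W \<subseteq> V \<and> card W = j \<and> (\<forall>e\<in>H. e \<inter> W \<noteq> {} \<longrightarrow> e \<subseteq> W))"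

text \<open>Only closedness under the edges of \<open>H\<close> is recorded, not connectedness: it
  is all that is used to split \<open>H\<close> into a part on \<open>W\<close> and a part off
  \<open>W\<close>.\<close>

definition many_components :: "nat \<Rightarrow> nat \<Rightarrow> nat set \<Rightarrow> edge_set set" where
  "many_components j k V = {H. two_regular V H \<and> (\<exists>F. closed_family j V H F \<and> card F = k)}"

lemma many_componentsI:
  assumes "two_regular V H" "finite F" "card F = k" "disjoint F"
    "\<And>W. W \<in> F \<Longrightarrow> W \<subseteq> V \<and> card W = j \<and> (\<forall>e\<in>H. e \<inter> W \<noteq> {} \<longrightarrow> e \<subseteq> W)"
  shows "H \<in> many_components j k V"
proof -
  have "closed_family j V H F" using assms by (simp add: closed_family_def)
  thus ?thesis using assms by (auto simp: many_components_def)
qed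

text \<open>Double counting of the pairs of \<open>H\<close> and one of its \<open>Suc k\<close>
  closed sets \<open>W\<close>. Such a pair is determined by \<open>W\<close>, the edges within
  \<open>W\<close> (at most \<open>2 ^ 2 ^ j\<close> possibilities) and the remaining edges, which
  keep the other \<open>k\<close> closed sets.\<close>

lemma many_components_step:
  assumes "finite V"
  shows "Suc k * card (many_components j (Suc k) V) \<le>
    (\<Sum>W | W \<subseteq> V \<and> card W = j. 2 ^ 2 ^ j * card (many_components j k (V - W)))"
proof -
  let ?B = "many_components j (Suc k) V"
  have finB: "finite (many_components j i U)" if "finite U" for i U
    by (rule finite_subset[OF _ finite_two_regulars[OF that]]) (auto simp: many_components_def two_regulars_def)
  have "\<exists>F. \<forall>H\<in>?B. finite (F H) \<and> card (F H) = Suc k \<and> disjoint (F H) \<and>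
     (\<forall>W\<in>F H. W \<subseteq> V \<and> card W = j \<and> (\<forall>e\<in>H. e \<inter> W \<noteq> {} \<longrightarrow> e \<subseteq> W))"
    by (intro bchoice) (auto simp: many_components_def closed_family_def two_regulars_def)
  then obtain F where F: "\<And>H. H \<in> ?B \<Longrightarrow> finite (F H) \<and> card (F H) = Suc k \<and> disjoint (F H) \<and>
     (\<forall>W\<in>F H. W \<subseteq> V \<and> card W = j \<and> (\<forall>e\<in>H. e \<inter> W \<noteq> {} \<longrightarrow> e \<subseteq> W))"
    by metis
  define S where "S = (SIGMA H:?B. F H)"
  define T where "T = (SIGMA W:{W. W \<subseteq> V \<and> card W = j}. Pow (Pow W) \<times> many_components j k (V - W))"
  define g where "g = (\<lambda>(H, W). (W, ({e \<in> H. e \<subseteq> W}, {e \<in> H. e \<inter> W = {}})) :: nat set \<times> nat set set \<times> nat set set)"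
  have "card S = (\<Sum>H\<in>?B. card (F H))"
    unfolding S_def using F finB[OF assms] by (intro card_SigmaI) auto
  also have "\<dots> = (\<Sum>H\<in>?B. Suc k)"
    using F by (intro sum.cong) auto
  finally have cS: "card S = Suc k * card ?B" by simp
  have "card T = (\<Sum>W | W \<subseteq> V \<and> card W = j. card (Pow (Pow W) \<times> many_components j k (V - W)))"
    unfolding T_def using assms finite_subset[OF _ assms] finB by (intro card_SigmaI) auto
  also have "\<dots> = (\<Sum>W | W \<subseteq> V \<and> card W = j. 2 ^ 2 ^ j * card (many_components j k (V - W)))"
    using finite_subset[OF _ assms] by (intro sum.cong) (auto simp: card_cartesian_product card_Pow)
  finally have cT: "card T = (\<Sum>W | W \<subseteq> V \<and> card W = j. 2 ^ 2 ^ j * card (many_components j k (V - W)))" .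
  have "card S \<le> card T"
  proof (rule card_inj_on_le)
    show "finite T" unfolding T_def using assms finite_subset[OF _ assms] finB
      by (intro finite_SigmaI) auto
    have un: "H = {e \<in> H. e \<subseteq> W} \<union> {e \<in> H. e \<inter> W = {}}" if "(H, W) \<in> S" for H W
    proof -
      have "H \<in> ?B" "W \<in> F H" using that by (auto simp: S_def)
      hence "\<forall>e\<in>H. e \<inter> W \<noteq> {} \<longrightarrow> e \<subseteq> W" using F by blast
      thus ?thesis by blast
    qed
    show "inj_on g S"
    proof (rule inj_onI, clarify)
      fix H W H' W' assume *: "(H, W) \<in> S" "(H', W') \<in> S" "g (H, W) = g (H', W')"
      note eqs = *(3)[unfolded g_def prod.case prod.inject]
      have "H = {e \<in> H. e \<subseteq> W} \<union> {e \<in> H. e \<inter> W = {}}" by (rule un[OF *(1)])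
      also have "\<dots> = {e \<in> H'. e \<subseteq> W'} \<union> {e \<in> H'. e \<inter> W' = {}}"
        by (rule arg_cong2[OF conjunct1[OF conjunct2[OF eqs]] conjunct2[OF conjunct2[OF eqs]]])
      also have "\<dots> = H'" by (rule un[OF *(2), symmetric])
      finally show "H = H' \<and> W = W'" using conjunct1[OF eqs] by (rule conjI)
    qed
    show "g ` S \<subseteq> T"
    proof (rule image_subsetI)
      fix x assume "x \<in> S"
      then obtain H W where x: "x = (H, W)" and "(H, W) \<in> S" by (cases x) auto
      hence HW: "H \<in> ?B" "W \<in> F H" by (auto simp: S_def)
      note FH = F[OF HW(1)]
      have W: "W \<subseteq> V" "card W = j" "\<forall>e\<in>H. e \<inter> W \<noteq> {} \<longrightarrow> e \<subseteq> W" using FH HW(2) by auto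
      let ?H' = "{e \<in> H. e \<inter> W = {}}"
      have "two_regular V H" using HW(1) by (simp add: many_components_def)
      hence "two_regular (V - W) ?H'" using two_regular_Diff W by blast
      moreover have "finite (F H - {W})" using FH by blast
      moreover have "card (F H - {W}) = k" using FH HW(2) by (simp add: card_Diff_singleton)
      moreover have "disjoint (F H - {W})" using FH by (blast intro: pairwise_subset)
      moreover have "U \<subseteq> V - W \<and> card U = j \<and> (\<forall>e\<in>?H'. e \<inter> U \<noteq> {} \<longrightarrow> e \<subseteq> U)"
        if U: "U \<in> F H - {W}" for U
      proof -
        have "disjnt U W" using FH HW(2) U by (blast dest: pairwiseD)
        thus ?thesis using FH U unfolding disjnt_def by blast
      qed
      ultimately have "?H' \<in> many_components j k (V - W)"
        by (rule many_componentsI)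
      moreover have "{e \<in> H. e \<subseteq> W} \<in> Pow (Pow W)" by blast
      moreover have "W \<in> {W. W \<subseteq> V \<and> card W = j}" using W(1,2) by blast
      ultimately show "g x \<in> T" unfolding x g_def T_def prod.case by (intro SigmaI)
    qed
  qed
  thus ?thesis unfolding cS cT .
qed

text \<open>Each step has at most \<open>m ^ j\<close> choices of \<open>W\<close>, while deleting
  \<open>W\<close> divides the number of two-regular sets by at least \<open>(m - j) ^ j\<close>.
  Since \<open>2 * j \<le> m\<close>, the quotient is at most \<open>2 ^ j\<close>. The factors
  \<open>Suc k\<close> of the double counting build up the factorial, so linearly many closed sets
  of one size are very unlikely.\<close>

lemma card_many_components:
  assumes "finite V" "j * k + j \<le> card V"
  shows "real (card (many_components j k V)) \<le>
    (2 ^ 2 ^ j * 2 ^ j) ^ k / fact k * real (card (two_regulars V))"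
  using assms
proof (induction k arbitrary: V)
  case 0
  have "card (many_components j 0 V) \<le> card (two_regulars V)"
    using finite_two_regulars[OF 0(1)] by (intro card_mono) (auto simp: many_components_def closed_family_def two_regulars_def)
  thus ?case by simp
next
  case (Suc k)
  define m where "m = card V"
  define C :: real where "C = 2 ^ 2 ^ j * 2 ^ j"
  define a where "a = real (card (two_regulars V))"
  have m: "2 * j \<le> m" using Suc.prems by (simp add: m_def)
  have each: "real (2 ^ 2 ^ j * card (many_components j k (V - W))) * real ((m - j) ^ j) \<le>
     2 ^ 2 ^ j * (C ^ k / fact k) * a" if "W \<subseteq> V" "card W = j" for W
  proof -
    have W: "finite W" "V - W \<union> W = V" "(V - W) \<inter> W = {}" "card (V - W) = m - j"
      using that finite_subset[OF _ Suc.prems(1)] by (auto simp: m_def card_Diff_subset)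
    have ih: "real (card (many_components j k (V - W))) \<le> C ^ k / fact k * real (card (two_regulars (V - W)))"
      unfolding C_def using Suc.prems W by (intro Suc.IH) (auto simp: m_def)
    have ex: "card (two_regulars (V - W)) * (m - j) ^ j \<le> card (two_regulars V)"
      using card_two_regulars_extend[of "V - W" W] W Suc.prems(1) that by simp
    have "real (card (many_components j k (V - W))) * real ((m - j) ^ j) \<le>
        C ^ k / fact k * real (card (two_regulars (V - W))) * real ((m - j) ^ j)"
      using ih by (rule mult_right_mono) simp
    also have "\<dots> = C ^ k / fact k * real (card (two_regulars (V - W)) * (m - j) ^ j)" by simp
    also have "\<dots> \<le> C ^ k / fact k * a"
      unfolding a_def using ex by (intro mult_left_mono of_nat_mono) (auto simp: C_def)
    finally have "2 ^ 2 ^ j * (real (card (many_components j k (V - W))) * real ((m - j) ^ j))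
       \<le> 2 ^ 2 ^ j * (C ^ k / fact k * a)" by (rule mult_left_mono) simp
    thus ?thesis by (simp add: mult_ac)
  qed
  have numW: "card {W. W \<subseteq> V \<and> card W = j} \<le> m ^ j"
    using n_subsets[OF Suc.prems(1), of j] binomial_le_pow[of j m] m by (simp add: m_def)
  have mj: "m ^ j \<le> 2 ^ j * (m - j) ^ j"
    unfolding power_mult_distrib[symmetric] using m by (intro power_mono) auto
  have "real (Suc k) * real (card (many_components j (Suc k) V)) * real ((m - j) ^ j) =
      real (Suc k * card (many_components j (Suc k) V)) * real ((m - j) ^ j)" by (simp only: of_nat_mult)
  also have "\<dots> \<le> real (\<Sum>W | W \<subseteq> V \<and> card W = j. 2 ^ 2 ^ j * card (many_components j k (V - W))) * real ((m - j) ^ j)"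
    using many_components_step[OF Suc.prems(1), of k j] by (intro mult_right_mono of_nat_mono) auto
  also have "\<dots> = (\<Sum>W | W \<subseteq> V \<and> card W = j. real (2 ^ 2 ^ j * card (many_components j k (V - W))) * real ((m - j) ^ j))"
    by (simp only: of_nat_sum sum_distrib_right)
  also have "\<dots> \<le> (\<Sum>W | W \<subseteq> V \<and> card W = j. 2 ^ 2 ^ j * (C ^ k / fact k) * a)"
    using each by (intro sum_mono) auto
  also have "\<dots> = real (card {W. W \<subseteq> V \<and> card W = j}) * (2 ^ 2 ^ j * (C ^ k / fact k) * a)" by simp
  also have "\<dots> \<le> real (2 ^ j * (m - j) ^ j) * (2 ^ 2 ^ j * (C ^ k / fact k) * a)"
    using numW mj by (intro mult_right_mono of_nat_mono) (auto simp: C_def a_def)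
  also have "\<dots> = C ^ Suc k / fact k * a * real ((m - j) ^ j)"
    by (simp add: C_def)
  finally have "real (Suc k) * real (card (many_components j (Suc k) V)) * real ((m - j) ^ j) \<le>
      C ^ Suc k / fact k * a * real ((m - j) ^ j)" .
  moreover have "real ((m - j) ^ j) > 0" using m by (cases "j = 0") auto
  ultimately have "real (Suc k) * real (card (many_components j (Suc k) V)) \<le> C ^ Suc k / fact k * a"
    by (metis mult_le_cancel_right not_less_iff_gr_or_eq)
  hence "real (card (many_components j (Suc k) V)) \<le> C ^ Suc k / fact k * a / real (Suc k)"
    by (simp only: pos_le_divide_eq of_nat_0_less_iff zero_less_Suc mult.commute)
  also have "\<dots> = C ^ Suc k / fact (Suc k) * a" by (simp add: mult_ac)
  finally show ?case unfolding C_def a_def .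
qed

text \<open>The orbits of the vertices of short period are closed, pairwise disjoint and have at
  most \<open>D\<close> elements; fewer than \<open>k\<close> of them have any given size.\<close>

lemma few_short_cycle_vertices:
  assumes H: "two_regular V H" and nx: "bij_betw nx V V" "H = (\<lambda>v. {v, nx v}) ` V"
    and few: "\<And>j. j \<le> D \<Longrightarrow> 1 \<le> j \<Longrightarrow> H \<notin> many_components j k V"
  shows "card {v \<in> V. \<exists>d\<in>{1..D}. (nx ^^ d) v = v} \<le> D * D * k"
proof -
  have finV: "finite V" using H by (auto simp: two_regular_def)
  define bad where "bad = {v \<in> V. \<exists>d\<in>{1..D}. (nx ^^ d) v = v}"
  define orb where "orb = (\<lambda>v. range (\<lambda>d. (nx ^^ d) v))"
  have pow: "(nx ^^ d) v \<in> V" if "v \<in> V" for v d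
    using that nx(1) by (induction d) (auto simp: bij_betw_def)
  have orbV: "orb v \<subseteq> V" if "v \<in> V" for v using pow[OF that] by (auto simp: orb_def)
  have mem: "v \<in> orb v" for v unfolding orb_def by (rule range_eqI[of _ _ 0]) simp
  have orb_sub: "orb x \<subseteq> orb v" if x: "x \<in> orb v" for x v
  proof -
    obtain a where a: "x = (nx ^^ a) v" using x by (auto simp: orb_def)
    have "(nx ^^ d) x = (nx ^^ (d + a)) v" for d by (simp add: a funpow_add)
    thus ?thesis unfolding orb_def by auto
  qed
  have orb_sym: "v \<in> orb x" if vb: "v \<in> bad" and x: "x \<in> orb v" for x v
  proof -
    obtain j where j: "j \<ge> 1" "(nx ^^ j) v = v" using vb by (auto simp: bad_def)
    obtain a where a: "x = (nx ^^ a) v" using x by (auto simp: orb_def)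
    have "(nx ^^ (j * a)) v = v" using j(2)
      by (metis funpow_mod_eq funpow_0 mod_mult_self1_is_0)
    moreover have "j * a = (j * a - a) + a" using j(1) by simp
    ultimately have "(nx ^^ (j * a - a)) x = v"
      unfolding a by (metis funpow_add o_apply)
    thus ?thesis unfolding orb_def by blast
  qed
  have orb_eq: "orb x = orb v" if "v \<in> bad" "x \<in> orb v" for x v
    using orb_sub[OF that(2)] orb_sub[OF orb_sym[OF that]] by auto
  have orb_card: "card (orb v) \<in> {1..D}" if v: "v \<in> bad" for v
  proof -
    obtain j where j: "j \<ge> 1" "j \<le> D" "(nx ^^ j) v = v" using v by (auto simp: bad_def)
    have "orb v \<subseteq> (\<lambda>d. (nx ^^ d) v) ` {..<j}"
    proof
      fix x assume "x \<in> orb v"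
      then obtain a where "x = (nx ^^ a) v" by (auto simp: orb_def)
      hence "x = (nx ^^ (a mod j)) v" using funpow_mod_eq[OF j(3)] by simp
      thus "x \<in> (\<lambda>d. (nx ^^ d) v) ` {..<j}" using j(1) by auto
    qed
    hence "card (orb v) \<le> j" using surj_card_le[of "{..<j}" "orb v"] by simp
    moreover have "finite (orb v)" using orbV[of v] v by (intro finite_subset[OF _ finV]) (auto simp: bad_def)
    moreover have "orb v \<noteq> {}" using mem[of v] by auto
    ultimately show ?thesis using j by (auto simp: Suc_le_eq card_gt_0_iff)
  qed
  have orb_closed: "\<forall>e\<in>H. e \<inter> orb v \<noteq> {} \<longrightarrow> e \<subseteq> orb v" if v: "v \<in> bad" for v
  proof (intro ballI impI)
    fix e assume e: "e \<in> H" "e \<inter> orb v \<noteq> {}"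
    then obtain w where w: "w \<in> V" "e = {w, nx w}" using nx(2) by auto
    have step: "nx x \<in> orb x" for x unfolding orb_def by (rule range_eqI[of _ _ 1]) simp
    show "e \<subseteq> orb v"
    proof (cases "w \<in> orb v")
      case True
      thus ?thesis using w step[of w] orb_sub by blast
    next
      case False
      hence *: "nx w \<in> orb v" using e w by auto
      hence nw: "orb (nx w) = orb v" using orb_eq[OF v] by simp
      obtain j where j: "j \<ge> 1" "(nx ^^ j) v = v" using v by (auto simp: bad_def)
      obtain a where a: "nx w = (nx ^^ a) v" using * by (auto simp: orb_def)
      \<comment> \<open>One full period minus one step leads to the predecessor of
        \<open>nx w\<close> within the orbit; by injectivity of \<open>nx\<close> it is
        \<open>w\<close>.\<close>
      define u where "u = (nx ^^ (a + (j - 1))) v"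
      have "nx u = (nx ^^ Suc (a + (j - 1))) v" by (simp add: u_def)
      also have "Suc (a + (j - 1)) = a + j" using j(1) by simp
      also have "(nx ^^ (a + j)) v = nx w" using a j(2) by (simp add: funpow_add)
      finally have "u = w" using nx(1) w(1) pow[of v "a + (j - 1)"] v
        unfolding bij_betw_def inj_on_def bad_def u_def by blast
      hence "w \<in> orb v" unfolding u_def orb_def by blast
      thus ?thesis using False by simp
    qed
  qed
  define F where "F = orb ` bad"
  have finbad: "finite bad" using finV by (simp add: bad_def)
  have disj: "disjoint F"
  proof (rule pairwiseI)
    fix X Y assume XY: "X \<in> F" "Y \<in> F" "X \<noteq> Y"
    then obtain x y where "x \<in> bad" "y \<in> bad" "X = orb x" "Y = orb y" by (auto simp: F_def)
    thus "disjnt X Y" using orb_eq XY(3) unfolding disjnt_def by blast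
  qed
  have Fj: "card {W \<in> F. card W = j} < k" if j: "j \<in> {1..D}" for j
  proof (rule ccontr)
    assume "\<not> ?thesis"
    then obtain F' where F': "F' \<subseteq> {W \<in> F. card W = j}" "card F' = k" "finite F'"
      using obtain_subset_with_card_n[of k "{W \<in> F. card W = j}"] by (auto simp: not_less)
    have "W \<subseteq> V \<and> card W = j \<and> (\<forall>e\<in>H. e \<inter> W \<noteq> {} \<longrightarrow> e \<subseteq> W)" if "W \<in> F'" for W
    proof -
      have "W \<in> F" "card W = j" using that F'(1) by auto
      then obtain v where "v \<in> bad" "W = orb v" by (auto simp: F_def)
      thus ?thesis using \<open>card W = j\<close> orb_closed orbV[of v] by (auto simp: bad_def)
    qed
    moreover have "disjoint F'" by (rule pairwise_subset[OF disj]) (use F'(1) in auto)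
    ultimately have "H \<in> many_components j k V"
      using H F'(2,3) by (intro many_componentsI[of V H F'])
    thus False using few j by auto
  qed
  have "bad \<subseteq> \<Union>F" using mem by (auto simp: F_def)
  moreover have fF: "finite F" using finbad by (simp add: F_def)
  moreover have finW: "finite W" "card W \<in> {1..D}" if "W \<in> F" for W
    using that orb_card orbV finite_subset[OF _ finV] by (auto simp: F_def bad_def)
  ultimately have "card bad \<le> card (\<Union>F)" by (intro card_mono finite_Union) auto
  also have "\<dots> \<le> (\<Sum>W\<in>F. card W)" using card_Union_le_sum_card by blast
  also have "\<dots> \<le> (\<Sum>W\<in>F. D)" using finW by (intro sum_mono) auto
  also have "\<dots> = D * card F" by simp
  also have "F = (\<Union>j\<in>{1..D}. {W \<in> F. card W = j})" using finW by auto
  hence "card F \<le> (\<Sum>j\<in>{1..D}. card {W \<in> F. card W = j})"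
    using card_UN_le[of "{1..D}" "\<lambda>j. {W \<in> F. card W = j}"] by simp
  also have "\<dots> \<le> (\<Sum>j\<in>{1..D}. k)" using Fj by (intro sum_mono less_imp_le) auto
  also have "D * \<dots> = D * D * k" by simp
  finally show ?thesis by (simp add: bad_def)
qed

section \<open>Random edge sets\<close>

definition random_subset :: "'a set \<Rightarrow> real \<Rightarrow> 'a set pmf" where
  "random_subset A p = map_pmf (\<lambda>b. {e \<in> A. b e}) (Pi_pmf A False (\<lambda>_. bernoulli_pmf p))"

lemma prob_bind_pmf:
  "measure_pmf.prob (bind_pmf M f) S = (\<integral>x. measure_pmf.prob (f x) S \<partial>measure_pmf M)"
proof -
  have "ennreal (measure_pmf.prob (bind_pmf M f) S) = (\<integral>\<^sup>+x. ennreal (measure_pmf.prob (f x) S) \<partial>measure_pmf M)"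
    unfolding measure_pmf.emeasure_eq_measure[symmetric] by (rule emeasure_bind_pmf)
  also have "\<dots> = ennreal (\<integral>x. measure_pmf.prob (f x) S \<partial>measure_pmf M)"
    by (intro nn_integral_eq_integral measure_pmf.integrable_const_bound[where B = 1]) auto
  finally show ?thesis by (subst (asm) ennreal_inj) auto
qed

lemma random_subset_insert:
  assumes "finite A" "e \<notin> A"
  shows "random_subset (insert e A) p =
    bind_pmf (bernoulli_pmf p) (\<lambda>b. map_pmf (\<lambda>X. if b then insert e X else X) (random_subset A p))"
proof -
  have "Pi_pmf (insert e A) False (\<lambda>_. bernoulli_pmf p) =
      bind_pmf (bernoulli_pmf p) (\<lambda>b. map_pmf (\<lambda>f. f(e := b)) (Pi_pmf A False (\<lambda>_. bernoulli_pmf p)))"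
    by (simp add: Pi_pmf_insert'[OF assms] map_pmf_def)
  thus ?thesis
    unfolding random_subset_def using assms(2)
    by (auto simp: map_bind_pmf pmf.map_comp intro!: bind_pmf_cong map_pmf_cong split: if_splits)
qed

text \<open>Reveals a single element. The search is analysed through this identity alone: the pairs
  not yet asked always form a fresh random subset.\<close>

lemma prob_random_subset_split:
  assumes "finite A" "e \<in> A" "0 \<le> p" "p \<le> 1"
  shows "measure_pmf.prob (random_subset A p) S =
    p * measure_pmf.prob (random_subset (A - {e}) p) {X. insert e X \<in> S} +
    (1 - p) * measure_pmf.prob (random_subset (A - {e}) p) S"
proof -
  have "A = insert e (A - {e})" using assms(2) by blast
  hence "measure_pmf.prob (random_subset A p) S = measure_pmf.prob (random_subset (insert e (A - {e})) p) S"
    by (rule arg_cong[where f = "\<lambda>B. measure_pmf.prob (random_subset B p) S"])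
  also have "\<dots> = p * measure_pmf.prob (random_subset (A - {e}) p) {X. insert e X \<in> S} +
    (1 - p) * measure_pmf.prob (random_subset (A - {e}) p) S"
    using assms
    by (subst random_subset_insert) (simp_all add: prob_bind_pmf vimage_def mult.commute)
  finally show ?thesis .
qed

lemma set_random_subset: "finite A \<Longrightarrow> set_pmf (random_subset A p) \<subseteq> Pow A"
  by (auto simp: random_subset_def)

text \<open>Two-round exposure: the random edges are the union of an independent share for the
  search and a share for joining the blocks.\<close>

lemma random_subset_union:
  assumes "finite A" "0 \<le> p" "p \<le> 1" "0 \<le> q" "q \<le> 1" "r = p + q - p * q"
  shows "random_subset A r =
    bind_pmf (random_subset A p) (\<lambda>X. map_pmf (\<lambda>Y. X \<union> Y) (random_subset A q))"
  using assms(1)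
proof (induction A)
  case empty
  show ?case by (simp add: random_subset_def bind_return_pmf)
next
  case (insert e A)
  have r: "bernoulli_pmf r = bind_pmf (bernoulli_pmf p) (\<lambda>a. map_pmf (\<lambda>b. a \<or> b) (bernoulli_pmf q))"
  proof (rule pmf_eqI)
    fix i :: bool
    have *: "map_pmf ((\<or>) a) (bernoulli_pmf q) = (if a then return_pmf True else bernoulli_pmf q)" for a
    proof -
      have "(\<or>) True = (\<lambda>_. True)" "(\<or>) False = (\<lambda>b. b)" by auto
      thus ?thesis by (cases a) (simp_all add: map_pmf_const pmf.map_ident)
    qed
    have "0 \<le> (1 - p) * (1 - q)" "(1 - p) * (1 - q) \<le> 1"
      using assms by (auto intro!: mult_le_one)
    hence "0 \<le> r" "r \<le> 1" using assms by (auto simp: algebra_simps)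
    moreover have "r * 1 = p + (1 - p) * q" using assms by (simp add: algebra_simps)
    ultimately show "pmf (bernoulli_pmf r) i = pmf (bind_pmf (bernoulli_pmf p) (\<lambda>a. map_pmf (\<lambda>b. a \<or> b) (bernoulli_pmf q))) i"
      using assms by (cases i) (simp_all add: *[abs_def] pmf_bind algebra_simps)
  qed
  let ?b = bernoulli_pmf and ?R = "random_subset A"
  have "random_subset (insert e A) r = do {a \<leftarrow> ?b p; b \<leftarrow> ?b q; X \<leftarrow> ?R p; Y \<leftarrow> ?R q;
      return_pmf (if a \<or> b then insert e (X \<union> Y) else X \<union> Y)}"
    unfolding random_subset_insert[OF insert(1,2)] insert(3) r
    by (simp only: map_pmf_def bind_assoc_pmf bind_return_pmf)
  also have "\<dots> = do {a \<leftarrow> ?b p; X \<leftarrow> ?R p; b \<leftarrow> ?b q; Y \<leftarrow> ?R q;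
      return_pmf (if a \<or> b then insert e (X \<union> Y) else X \<union> Y)}"
    by (intro bind_pmf_cong refl) (rule bind_commute_pmf)
  also have "\<dots> = do {a \<leftarrow> ?b p; X \<leftarrow> ?R p; b \<leftarrow> ?b q; Y \<leftarrow> ?R q;
      return_pmf ((if a then insert e X else X) \<union> (if b then insert e Y else Y))}"
    by (intro bind_pmf_cong refl arg_cong[where f = return_pmf]) auto
  also have "\<dots> = bind_pmf (random_subset (insert e A) p) (\<lambda>X. map_pmf (\<lambda>Y. X \<union> Y) (random_subset (insert e A) q))"
    unfolding random_subset_insert[OF insert(1,2)]
    by (simp only: map_pmf_def bind_assoc_pmf bind_return_pmf)
  finally show ?case .
qed

section \<open>Depth-first exploration\<close>

definition iterates :: "(nat \<Rightarrow> nat) \<Rightarrow> nat \<Rightarrow> nat \<Rightarrow> nat list" where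
  "iterates f v k = map (\<lambda>d. (f ^^ d) v) [0..<k]"

text \<open>A node is a level and a stretch of a planted cycle (or a single vertex outside the planted set);
  the path enters the stretch at its head and leaves it at its last vertex, both by random edges.\<close>

type_synonym node = "nat \<times> nat list"

abbreviation exit_vertex :: "node \<Rightarrow> nat" where "exit_vertex x \<equiv> last (snd x)"

text \<open>Excluding planted edges between the two sets, and not only common vertices, ensures that
  an edge joining two parts of the path is never planted. Hence the planted edges of a cycle are
  just those inside its nodes.\<close>

definition separated :: "edge_set \<Rightarrow> nat set \<Rightarrow> nat set \<Rightarrow> bool" where
  "separated H P Q \<longleftrightarrow> P \<inter> Q = {} \<and> (\<forall>e\<in>H. e \<inter> P = {} \<or> e \<inter> Q = {})"

lemma separated_mono: "separated H P Q \<Longrightarrow> P' \<subseteq> P \<Longrightarrow> Q' \<subseteq> Q \<Longrightarrow> separated H P' Q'"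
  unfolding separated_def by blast

lemma separated_sym: "separated H P Q \<Longrightarrow> separated H Q P"
  unfolding separated_def by blast

text \<open>The equation treats both kinds of nodes alike: a stretch of \<open>i + 2\<close> planted
  vertices lowers the level by \<open>i\<close>, a single outside vertex raises it by 1. Between two
  nodes of equal level it makes the nodes two vertices long on average; as every node has one
  planted edge fewer than vertices, half of all edges are planted.\<close>

definition joined :: "edge_set \<Rightarrow> node \<Rightarrow> node \<Rightarrow> bool" where
  "joined E x y \<longleftrightarrow> {last (snd x), hd (snd y)} \<in> E \<and> fst y + length (snd y) = fst x + 2"

locale successor_structure =
  fixes n :: nat and V :: "nat set" and H :: edge_set and nx pv :: "nat \<Rightarrow> nat" and L :: nat
    and \<phi> :: "nat \<Rightarrow> real"
  assumes V_sub: "V \<subseteq> {1..n}"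
    and H_eq: "H = (\<lambda>v. {v, nx v}) ` V"
    and nx_V: "v \<in> V \<Longrightarrow> nx v \<in> V" and pv_V: "v \<in> V \<Longrightarrow> pv v \<in> V"
    and nx_pv: "v \<in> V \<Longrightarrow> nx (pv v) = v" and pv_nx: "v \<in> V \<Longrightarrow> pv (nx v) = v"
    and weight_pos: "b \<le> L \<Longrightarrow> \<phi> b > 0"
begin

text \<open>A forward and a backward walk of up to \<open>L + 2\<close> steps together span
  \<open>2 * (L + 2)\<close> steps. From a good vertex all vertices met on them are
  different.\<close>

definition good :: "nat set" where
  "good = {v \<in> V. \<forall>d\<in>{1..2 * (L + 2)}. (nx ^^ d) v \<noteq> v}"

text \<open>A stretch ends at most \<open>L + 1\<close> steps from its entry vertex. One step more
  captures its planted neighbours, so no planted edge leads from a stretch to a vertex outside the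
  interval.\<close>

definition interval :: "nat \<Rightarrow> nat set" where
  "interval v = (\<lambda>d. (nx ^^ d) v) ` {..L + 2} \<union> (\<lambda>d. (pv ^^ d) v) ` {..L + 2}"

definition footprint :: "nat \<Rightarrow> nat set" where
  "footprint v = (if v \<in> V then interval v else {v})"

definition targets :: "nat \<Rightarrow> nat set \<Rightarrow> nat set" where
  "targets b T = {v \<in> T. if v \<in> V then v \<in> good \<and> interval v \<subseteq> T else b < L}"

text \<open>All possible exits from a stretch are kept as alternatives. Starting with two vertices
  gives the entry vertex a planted edge inside the node, and stopping at \<open>i = b\<close> keeps
  the level nonnegative.\<close>

definition children :: "nat \<Rightarrow> nat \<Rightarrow> node list" where
  "children b v = (if v \<in> V then
      map (\<lambda>i. (b - i, iterates nx v (i + 2))) [0..<Suc b] @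
      map (\<lambda>i. (b - i, iterates pv v (i + 2))) [0..<Suc b]
    else [(Suc b, [v])])"

definition weight :: "node list \<Rightarrow> real" where
  "weight xs = sum_list (map (\<lambda>x. \<phi> (fst x)) xs)"

definition gain :: "nat \<Rightarrow> nat \<Rightarrow> real" where
  "gain b v = weight (children b v)"

definition link :: "node \<Rightarrow> bool" where
  "link x \<longleftrightarrow> fst x \<le> L \<and> snd x \<noteq> [] \<and> distinct (snd x) \<and> set (snd x) \<subseteq> {1..n} \<and>
    (length (snd x) = 1 \<and> set (snd x) \<inter> V = {} \<or>
     2 \<le> length (snd x) \<and> set (snd x) \<subseteq> V \<and> set (path_edges (snd x)) \<subseteq> H)"

text \<open>Every inner list holds the alternatives remaining at one depth, the deepest first, and
  its head is the one on the current path. Siblings share their entry vertex and thus overlap; this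
  is harmless, as at most one of them is on the path, so separation is required only from the groups
  below.\<close>

fun stack :: "edge_set \<Rightarrow> node list list \<Rightarrow> bool" where
  "stack E [] = True"
| "stack E (g # gs) = (g \<noteq> [] \<and> length g \<le> 2 * (L + 1) \<and>
     (\<forall>x\<in>set g. link x \<and> (\<forall>y\<in>set (concat gs). separated H (set (snd y)) (set (snd x))) \<and>
        (gs \<noteq> [] \<longrightarrow> joined E (hd (hd gs)) x)) \<and> stack E gs)"

lemma stack_mono: "stack E gs \<Longrightarrow> E \<subseteq> E' \<Longrightarrow> stack E' gs"
  by (induction gs) (auto simp: joined_def)

lemma stack_length: "stack E gs \<Longrightarrow> length (concat gs) \<le> 2 * (L + 1) * length gs"
  by (induction gs) auto

text \<open>\<open>T\<close> holds the untouched vertices, \<open>A\<close> the pairs not yet asked,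
  \<open>E\<close> the edges found. Distinct exit vertices guarantee that no pair is asked on behalf
  of two different nodes.\<close>

definition state :: "nat set \<Rightarrow> edge_set \<Rightarrow> edge_set \<Rightarrow> node list list \<Rightarrow> bool" where
  "state T A E gs \<longleftrightarrow> T \<subseteq> {1..n} \<and> finite A \<and>
     (\<forall>u\<in>T. \<forall>w\<in>T. u \<noteq> w \<longrightarrow> {u, w} \<in> A) \<and> stack E gs \<and>
     (\<forall>x\<in>set (concat gs). separated H (set (snd x)) T) \<and>
     distinct (map exit_vertex (concat gs))"

section \<open>Iterates along the planted cycles and the nodes made from them\<close>

lemma nx_pow_V: "v \<in> V \<Longrightarrow> (nx ^^ d) v \<in> V"
  by (induction d) (auto simp: nx_V)

lemma pv_pow_V: "v \<in> V \<Longrightarrow> (pv ^^ d) v \<in> V"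
  by (induction d) (auto simp: pv_V)

lemma nx_pv_pow: "v \<in> V \<Longrightarrow> (nx ^^ d) ((pv ^^ d) v) = v"
proof (induction d)
  case (Suc d)
  have "(nx ^^ Suc d) ((pv ^^ Suc d) v) = (nx ^^ d) (nx (pv ((pv ^^ d) v)))"
    by (simp only: funpow_Suc_right funpow.simps o_apply) (simp add: funpow_swap1)
  thus ?case using Suc by (simp add: nx_pv pv_pow_V)
qed simp

lemma pv_nx_pow: "v \<in> V \<Longrightarrow> (pv ^^ d) ((nx ^^ d) v) = v"
proof (induction d)
  case (Suc d)
  have "(pv ^^ Suc d) ((nx ^^ Suc d) v) = (pv ^^ d) (pv (nx ((nx ^^ d) v)))"
    by (simp only: funpow_Suc_right funpow.simps o_apply) (simp add: funpow_swap1)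
  thus ?case using Suc by (simp add: pv_nx nx_pow_V)
qed simp

lemma good_nx_inj:
  assumes "v \<in> good" "i < j" "j \<le> 2 * (L + 2)"
  shows "(nx ^^ i) v \<noteq> (nx ^^ j) v"
proof
  have v: "v \<in> V" using assms by (simp add: good_def)
  assume "(nx ^^ i) v = (nx ^^ j) v"
  also have "j = i + (j - i)" using assms by simp
  also have "(nx ^^ (i + (j - i))) v = (nx ^^ i) ((nx ^^ (j - i)) v)" by (simp add: funpow_add)
  finally have "(pv ^^ i) ((nx ^^ i) v) = (pv ^^ i) ((nx ^^ i) ((nx ^^ (j - i)) v))" by simp
  hence "(nx ^^ (j - i)) v = v" using v by (simp add: pv_nx_pow nx_pow_V)
  moreover have "j - i \<in> {1..2 * (L + 2)}" using assms by auto
  ultimately show False using assms(1) by (auto simp: good_def)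
qed

lemma good_pv_nx:
  assumes "v \<in> good" "1 \<le> i + j" "i + j \<le> 2 * (L + 2)"
  shows "(pv ^^ i) v \<noteq> (nx ^^ j) v"
proof
  have v: "v \<in> V" using assms by (simp add: good_def)
  assume "(pv ^^ i) v = (nx ^^ j) v"
  hence "(nx ^^ i) ((pv ^^ i) v) = (nx ^^ (i + j)) v" by (simp add: funpow_add)
  hence "(nx ^^ 0) v = (nx ^^ (i + j)) v" using v by (simp add: nx_pv_pow)
  moreover have "0 < i + j" using assms(2) by linarith
  ultimately show False using good_nx_inj[OF assms(1) _ assms(3), of 0] by blast
qed

lemma good_pv_inj:
  assumes "v \<in> good" "i < j" "j \<le> 2 * (L + 2)"
  shows "(pv ^^ i) v \<noteq> (pv ^^ j) v"
proof
  have v: "v \<in> V" using assms by (simp add: good_def)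
  assume eq: "(pv ^^ i) v = (pv ^^ j) v"
  have "j = i + (j - i)" using assms by simp
  hence "(pv ^^ j) v = (pv ^^ i) ((pv ^^ (j - i)) v)" by (metis funpow_add o_apply)
  hence "(nx ^^ i) ((pv ^^ i) v) = (nx ^^ i) ((pv ^^ i) ((pv ^^ (j - i)) v))" using eq by simp
  hence "(pv ^^ (j - i)) v = (nx ^^ 0) v" using v by (simp add: nx_pv_pow pv_pow_V)
  moreover have "1 \<le> (j - i) + 0" "(j - i) + 0 \<le> 2 * (L + 2)" using assms(2,3) by simp_all
  ultimately show False using good_pv_nx[OF assms(1)] by blast
qed

lemma card_footprint: "card (footprint v) \<le> 2 * (L + 3)"
proof -
  have "card ((\<lambda>d. (nx ^^ d) v) ` {..L + 2}) \<le> L + 3" "card ((\<lambda>d. (pv ^^ d) v) ` {..L + 2}) \<le> L + 3"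
    by (rule order.trans[OF card_image_le]; simp)+
  hence "card (interval v) \<le> 2 * (L + 3)"
    unfolding interval_def by (intro order.trans[OF card_Un_le]) simp
  thus ?thesis by (simp add: footprint_def)
qed

lemma mem_footprint: "v \<in> footprint v"
  unfolding footprint_def interval_def by (auto intro!: image_eqI[of _ _ 0])

lemma footprint_targets: "v \<in> targets b T \<Longrightarrow> footprint v \<subseteq> T"
  by (auto simp: targets_def footprint_def)

lemma finite_footprint: "finite (footprint v)"
  by (simp add: footprint_def interval_def)

lemma iterates_props:
  "length (iterates f v k) = k" "set (iterates f v k) = (\<lambda>d. (f ^^ d) v) ` {..<k}"
  "k > 0 \<Longrightarrow> iterates f v k \<noteq> []" "k > 0 \<Longrightarrow> hd (iterates f v k) = v"
  "last (iterates f v (Suc k)) = (f ^^ k) v"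
  by (auto simp: iterates_def atLeast0LessThan hd_map last_map)

lemma distinct_iterates:
  assumes "\<And>i j. i < j \<Longrightarrow> j < k \<Longrightarrow> (f ^^ i) v \<noteq> (f ^^ j) v"
  shows "distinct (iterates f v k)"
  unfolding iterates_def distinct_map using assms by (auto intro!: linorder_inj_onI)

lemma nx_edge: "v \<in> V \<Longrightarrow> {v, nx v} \<in> H" and pv_edge: "v \<in> V \<Longrightarrow> {v, pv v} \<in> H"
  using H_eq nx_pv pv_V by (auto intro!: image_eqI[of _ _ "pv v"] simp: insert_commute)

lemma path_edges_iterates:
  "(\<And>d. {(f ^^ d) v, (f ^^ Suc d) v} \<in> H) \<Longrightarrow> set (path_edges (iterates f v k)) \<subseteq> H"
  by (auto simp: set_conv_nth length_path_edges nth_path_edges iterates_props iterates_def)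

text \<open>The last property keeps a new node separated from what remains of \<open>T\<close> after
  its footprint has been removed.\<close>

lemma children_props:
  assumes v: "v \<in> targets b T" "b \<le> L" "T \<subseteq> {1..n}" and x: "x \<in> set (children b v)"
  shows "link x" "set (snd x) \<subseteq> footprint v" "hd (snd x) = v" "fst x + length (snd x) = b + 2"
    "\<And>e. e \<in> H \<Longrightarrow> e \<inter> set (snd x) \<noteq> {} \<Longrightarrow> e \<subseteq> footprint v"
proof -
  have HV: "e \<in> H \<Longrightarrow> e \<subseteq> V" for e using H_eq nx_V by auto
  have vT: "v \<in> T" using v by (simp add: targets_def)
  have "link x \<and> set (snd x) \<subseteq> footprint v \<and> hd (snd x) = v \<and> fst x + length (snd x) = b + 2 \<and>
     (\<forall>e\<in>H. e \<inter> set (snd x) \<noteq> {} \<longrightarrow> e \<subseteq> footprint v)"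
  proof (cases "v \<in> V")
    case False
    hence "x = (Suc b, [v])" "b < L" using x v(1) by (auto simp: children_def targets_def)
    thus ?thesis using False vT v(3) HV by (auto simp: link_def footprint_def)
  next
    case True
    hence g: "v \<in> good" using v(1) by (simp add: targets_def)
    have fp: "footprint v = interval v" using True by (simp add: footprint_def)
    have nxI: "(nx ^^ d) v \<in> interval v" "(pv ^^ d) v \<in> interval v" if "d \<le> L + 2" for d
      using that by (auto simp: interval_def)
    have nb_nx: "e \<subseteq> interval v" if e: "e \<in> H" "(nx ^^ d) v \<in> e" and d: "d \<le> L + 1" for e d
    proof -
      obtain w where w: "w \<in> V" "e = {w, nx w}" using e H_eq by auto
      show ?thesis
      proof (cases "w = (nx ^^ d) v")
        case True
        hence "nx w = (nx ^^ Suc d) v" by simp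
        thus ?thesis using w True nxI(1)[of d] nxI(1)[of "Suc d"] d by simp
      next
        case False
        hence nw: "nx w = (nx ^^ d) v" using e w by auto
        have "w \<in> interval v"
        proof (cases d)
          case 0
          hence "w = (pv ^^ 1) v" using nw pv_nx[OF w(1)] by simp
          thus ?thesis using nxI(2)[of 1] by simp
        next
          case (Suc d')
          have "w = pv (nx w)" using pv_nx w by simp
          also have "\<dots> = (nx ^^ d') v" using nw Suc pv_nx nx_pow_V \<open>v \<in> V\<close> by simp
          finally show ?thesis using nxI(1)[of d'] d Suc by simp
        qed
        thus ?thesis using w nw nxI(1)[of d] d by simp
      qed
    qed
    have nb_pv: "e \<subseteq> interval v" if e: "e \<in> H" "(pv ^^ d) v \<in> e" and d: "d \<le> L + 1" for e d
    proof -
      obtain w where w: "w \<in> V" "e = {w, nx w}" using e H_eq by auto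
      show ?thesis
      proof (cases "w = (pv ^^ d) v")
        case True
        have "nx w \<in> interval v"
        proof (cases d)
          case 0
          thus ?thesis using True nxI(1)[of 1] by simp
        next
          case (Suc d')
          have "nx w = (pv ^^ d') v" using True Suc nx_pv pv_pow_V \<open>v \<in> V\<close> by simp
          thus ?thesis using nxI(2)[of d'] d Suc by simp
        qed
        thus ?thesis using w True nxI(2)[of d] d by simp
      next
        case False
        hence nw: "nx w = (pv ^^ d) v" using e w by auto
        have "w = pv (nx w)" using pv_nx w by simp
        also have "\<dots> = (pv ^^ Suc d) v" using nw by simp
        finally show ?thesis using w nw nxI(2)[of d] nxI(2)[of "Suc d"] d by simp
      qed
    qed
    have inT: "interval v \<subseteq> T" using v(1) True by (simp add: targets_def)
    have "x \<in> (\<lambda>i. (b - i, iterates nx v (i + 2))) ` {0..<Suc b} \<union>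
        (\<lambda>i. (b - i, iterates pv v (i + 2))) ` {0..<Suc b}"
      using x True by (simp add: children_def del: upt_Suc)
    then obtain i where "i < Suc b"
      "x = (b - i, iterates nx v (i + 2)) \<or> x = (b - i, iterates pv v (i + 2))"
      by fastforce
    hence i: "i \<le> b" "x = (b - i, iterates nx v (i + 2)) \<or> x = (b - i, iterates pv v (i + 2))"
      by simp_all
    from i(2) show ?thesis
    proof
      assume xe: "x = (b - i, iterates nx v (i + 2))"
      have sx: "set (snd x) = (\<lambda>d. (nx ^^ d) v) ` {..<i + 2}" using xe by (simp add: iterates_props)
      have sub: "set (snd x) \<subseteq> interval v" unfolding sx using i(1) v(2) nxI by auto
      have "distinct (snd x)"
        unfolding xe snd_conv
        by (rule distinct_iterates, rule good_nx_inj[OF g]) (use i(1) v(2) in simp_all)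
      moreover have "set (path_edges (snd x)) \<subseteq> H"
        unfolding xe snd_conv by (rule path_edges_iterates) (use nx_edge nx_pow_V True in simp)
      moreover have "set (snd x) \<subseteq> V" unfolding sx using nx_pow_V True by auto
      moreover have "set (snd x) \<subseteq> {1..n}" using sub inT v(3) by blast
      moreover have "fst x \<le> L" "snd x \<noteq> []" "2 \<le> length (snd x)"
        using xe i(1) v(2) by (simp_all add: iterates_props)
      ultimately have "link x" unfolding link_def by blast
      moreover have "e \<subseteq> interval v" if "e \<in> H" "e \<inter> set (snd x) \<noteq> {}" for e
        using that nb_nx i(1) v(2) unfolding sx by fastforce
      ultimately show ?thesis using xe fp sub i by (auto simp: iterates_props)
    next
      assume xe: "x = (b - i, iterates pv v (i + 2))"
      have sx: "set (snd x) = (\<lambda>d. (pv ^^ d) v) ` {..<i + 2}" using xe by (simp add: iterates_props)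
      have sub: "set (snd x) \<subseteq> interval v" unfolding sx using i(1) v(2) nxI by auto
      have "distinct (snd x)"
        unfolding xe snd_conv
        by (rule distinct_iterates, rule good_pv_inj[OF g]) (use i(1) v(2) in simp_all)
      moreover have "set (path_edges (snd x)) \<subseteq> H"
        unfolding xe snd_conv by (rule path_edges_iterates) (use pv_edge pv_pow_V True in simp)
      moreover have "set (snd x) \<subseteq> V" unfolding sx using pv_pow_V True by auto
      moreover have "set (snd x) \<subseteq> {1..n}" using sub inT v(3) by blast
      moreover have "fst x \<le> L" "snd x \<noteq> []" "2 \<le> length (snd x)"
        using xe i(1) v(2) by (simp_all add: iterates_props)
      ultimately have "link x" unfolding link_def by blast
      moreover have "e \<subseteq> interval v" if "e \<in> H" "e \<inter> set (snd x) \<noteq> {}" for e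
        using that nb_pv i(1) v(2) unfolding sx by fastforce
      ultimately show ?thesis using xe fp sub i by (auto simp: iterates_props)
    qed
  qed
  thus "link x" "set (snd x) \<subseteq> footprint v" "hd (snd x) = v" "fst x + length (snd x) = b + 2"
    "\<And>e. e \<in> H \<Longrightarrow> e \<inter> set (snd x) \<noteq> {} \<Longrightarrow> e \<subseteq> footprint v" by blast+
qed

lemma children_exit_distinct:
  assumes v: "v \<in> targets b T" "b \<le> L"
  shows "distinct (map exit_vertex (children b v))"
proof (cases "v \<in> V")
  case True
  hence g: "v \<in> good" using v(1) by (simp add: targets_def)
  have 1: "map exit_vertex (children b v) =
     map (\<lambda>i. (nx ^^ Suc i) v) [0..<Suc b] @ map (\<lambda>i. (pv ^^ Suc i) v) [0..<Suc b]"
  proof -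
    have "last (iterates f v (i + 2)) = (f ^^ Suc i) v" for f i
      using iterates_props(5)[of f v "Suc i"] by simp
    thus ?thesis using True unfolding children_def by (simp del: upt_Suc add_2_eq_Suc' funpow.simps)
  qed
  have "inj_on (\<lambda>i. (nx ^^ Suc i) v) {0..<Suc b}" "inj_on (\<lambda>i. (pv ^^ Suc i) v) {0..<Suc b}"
    using good_nx_inj[OF g, of "Suc _" "Suc _"] good_pv_inj[OF g, of "Suc _" "Suc _"] v(2)
    by (auto intro!: linorder_inj_onI simp del: funpow.simps)
  moreover have "(nx ^^ Suc i) v \<noteq> (pv ^^ Suc j) v" if "i < Suc b" "j < Suc b" for i j
  proof -
    have "1 \<le> Suc j + Suc i" "Suc j + Suc i \<le> 2 * (L + 2)" using that v(2) by simp_all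
    thus ?thesis using good_pv_nx[OF g] by metis
  qed
  ultimately show ?thesis unfolding 1
    by (auto simp: distinct_map simp del: upt_Suc funpow.simps)
qed (simp add: children_def)

lemma children_length: "length (children b v) \<le> 2 * (b + 1)" "children b v \<noteq> []"
  by (auto simp: children_def)

end

section \<open>The exponential supermartingale of the search\<close>

lemma sum_list_const_le:
  fixes f :: "'a \<Rightarrow> real"
  assumes "\<And>x. x \<in> set xs \<Longrightarrow> f x \<le> c"
  shows "sum_list (map f xs) \<le> real (length xs) * c"
  using assms by (induction xs) (auto simp: algebra_simps add_mono)

text \<open>\<open>r\<close> is the number of used vertices at which the search stops,
  \<open>l\<close> the depth aimed at. Until then, by \<open>rich\<close>, the expected gain of a
  node exceeds its weight even after the discount \<open>\<alpha>\<close>. \<open>drift\<close> is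
  the supermartingale inequality for one answer. \<open>c0\<close> spreads the least weight over the
  vertices of one footprint, and \<open>final\<close> forces a low potential on a stopped search of
  small depth.\<close>

locale exploration = successor_structure +
  fixes p \<alpha> \<eta> c0 \<tau> \<zeta> r M :: real and l :: nat
  assumes p: "0 \<le> p" "p \<le> 1" and eta: "\<eta> > 0" and alpha: "0 < \<alpha>" and tau: "\<tau> > 0"
    and c0: "0 \<le> c0" "b \<le> L \<Longrightarrow> c0 * (2 * (real L + 3)) \<le> \<phi> b"
    and M: "b \<le> L \<Longrightarrow> \<phi> b \<le> M"
    and rich: "T \<subseteq> {1..n} \<Longrightarrow> real n - real (card T) < r \<Longrightarrow> b \<le> L \<Longrightarrow>
       (1 + \<eta>) * \<phi> b \<le> \<alpha> * p * (\<Sum>v\<in>targets b T. gain b v)"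
    and drift: "b \<le> L \<Longrightarrow> v \<in> targets b T \<Longrightarrow>
       p * exp (- \<tau> * gain b v) + (1 - p) * exp (\<tau> * (\<alpha> * p * gain b v)) \<le> 1"
    and final: "(1 + \<eta>) * (M * (2 * (real L + 1) * real l)) - \<eta> * c0 * r \<le> - \<zeta>"
begin

definition load :: "edge_set \<Rightarrow> nat set \<Rightarrow> node \<Rightarrow> real" where
  "load A T x = (\<Sum>v | v \<in> targets (fst x) T \<and> {exit_vertex x, v} \<notin> A. gain (fst x) v)"

text \<open>A positive answer raises the potential by at least the gain of the target, a negative answer
  lowers it by \<open>\<alpha> * p\<close> times that gain, and by the assumption \<open>rich\<close> discarding an exhausted
  node does not lower it.\<close>

definition potential :: "nat set \<Rightarrow> edge_set \<Rightarrow> node list list \<Rightarrow> real" where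
  "potential T A gs = (1 + \<eta>) * weight (concat gs) - \<eta> * c0 * (real n - real (card T))
     - \<alpha> * p * sum_list (map (load A T) (concat gs))"

lemma weight_append: "weight (xs @ ys) = weight xs + weight ys"
  by (simp add: weight_def)

lemma targets_subset: "targets b T \<subseteq> T" by (auto simp: targets_def)

lemma children_link: "v \<in> targets b T \<Longrightarrow> b \<le> L \<Longrightarrow> x \<in> set (children b v) \<Longrightarrow> fst x \<le> L"
  by (auto simp: children_def targets_def split: if_splits)

lemma gain_ge:
  assumes "v \<in> targets b T" "b \<le> L"
  shows "c0 * (2 * (real L + 3)) \<le> gain b v"
proof -
  obtain x xs where x: "children b v = x # xs" using children_length(2) by (cases "children b v") auto
  have pos: "\<phi> (fst y) > 0" if "y \<in> set (children b v)" for y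
    using weight_pos children_link[OF assms that] by blast
  have "c0 * (2 * (real L + 3)) \<le> \<phi> (fst x)" using c0(2) children_link[OF assms, of x] x by simp
  also have "0 \<le> sum_list (map (\<lambda>y. \<phi> (fst y)) xs)"
    using pos x by (intro sum_list_nonneg) (force intro: less_imp_le)
  hence "\<phi> (fst x) \<le> weight (x # xs)" by (simp add: weight_def)
  finally show ?thesis by (simp add: gain_def x)
qed

lemma gain_nonneg: "v \<in> targets b T \<Longrightarrow> b \<le> L \<Longrightarrow> gain b v \<ge> 0"
  using gain_ge[of v b T] c0(1) by (meson order.trans mult_nonneg_nonneg of_nat_0_le_iff add_nonneg_nonneg zero_le_numeral)

lemma targets_diff: "targets b (T - F) \<subseteq> targets b T"
  by (auto simp: targets_def split: if_splits)

lemma stack_link: "stack E gs \<Longrightarrow> x \<in> set (concat gs) \<Longrightarrow> link x"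
  by (induction gs) auto

lemma exit_mem: "link x \<Longrightarrow> exit_vertex x \<in> set (snd x)"
  by (auto simp: link_def)

text \<open>Covers two situations: a new root, where no pair is asked and \<open>A' = A\<close>, and
  a positive answer, where the pair asked is removed. That pair contains the target, hence misses
  the remaining \<open>T\<close>.\<close>

lemma state_push:
  assumes st: "state T A E gs" and v: "v \<in> targets b T" "b \<le> L"
    and A': "A' \<subseteq> A" "\<And>e. e \<in> A - A' \<Longrightarrow> e \<inter> (T - footprint v) = {}"
    and E': "E \<subseteq> E'" "\<And>x. gs \<noteq> [] \<Longrightarrow> x \<in> set (children b v) \<Longrightarrow> joined E' (hd (hd gs)) x"
  shows "state (T - footprint v) A' E' (children b v # gs)"
  unfolding state_def
proof (intro conjI)
  have T: "T \<subseteq> {1..n}" "finite A" and pairs: "\<And>u w. u \<in> T \<Longrightarrow> w \<in> T \<Longrightarrow> u \<noteq> w \<Longrightarrow> {u, w} \<in> A"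
    and stk: "stack E gs" and sep: "\<And>x. x \<in> set (concat gs) \<Longrightarrow> separated H (set (snd x)) T"
    and dist: "distinct (map exit_vertex (concat gs))"
    using st by (auto simp: state_def)
  note ch = children_props[OF v T(1)]
  have fT: "footprint v \<subseteq> T" using footprint_targets[OF v(1)] .
  show "T - footprint v \<subseteq> {1..n}" using T by blast
  show "finite A'" using T(2) A'(1) finite_subset by blast
  show "\<forall>u\<in>T - footprint v. \<forall>w\<in>T - footprint v. u \<noteq> w \<longrightarrow> {u, w} \<in> A'"
    using pairs A'(2) by blast
  have sepc: "separated H (set (snd y)) (set (snd x))" if "y \<in> set (concat gs)" "x \<in> set (children b v)" for x y
    using separated_mono[OF sep[OF that(1)]] ch(2)[OF that(2)] fT by blast
  show "stack E' (children b v # gs)"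
    using children_length[of b v] v(2) stack_mono[OF stk E'(1)] E'(2) ch(1) sepc by auto
  have sepch: "separated H (set (snd x)) (T - footprint v)" if "x \<in> set (children b v)" for x
    using ch(2)[OF that] ch(5)[OF that] unfolding separated_def by blast
  show "\<forall>x\<in>set (concat (children b v # gs)). separated H (set (snd x)) (T - footprint v)"
  proof
    fix x assume "x \<in> set (concat (children b v # gs))"
    hence "x \<in> set (children b v) \<or> x \<in> set (concat gs)" by simp
    thus "separated H (set (snd x)) (T - footprint v)"
      using sepch separated_mono[OF sep] by blast
  qed
  have "exit_vertex x \<noteq> exit_vertex y" if "x \<in> set (children b v)" "y \<in> set (concat gs)" for x y
    using sepc[OF that(2,1)] exit_mem[OF ch(1)[OF that(1)]] exit_mem[OF stack_link[OF stk that(2)]]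
    unfolding separated_def by auto
  hence "exit_vertex ` set (children b v) \<inter> exit_vertex ` set (concat gs) = {}" by blast
  thus "distinct (map exit_vertex (concat (children b v # gs)))"
    using children_exit_distinct[OF v] dist
    by (simp only: concat.simps map_append distinct_append set_map)
qed

text \<open>The children bring \<open>(1 + \<eta>)\<close> times the gain; the share
  \<open>\<eta>\<close> pays for the at most \<open>2 * (L + 3)\<close> vertices used. The children
  start with load 0, since their exit vertices were in \<open>T\<close> and no pair within
  \<open>T\<close> has been asked.\<close>

lemma potential_push:
  assumes st: "state T A E gs" and v: "v \<in> targets b T" "b \<le> L"
    and A': "A' \<subseteq> A" "\<And>e. e \<in> A - A' \<Longrightarrow> e \<inter> (T - footprint v) = {}"
  shows "potential T A gs + gain b v \<le> potential (T - footprint v) A' (children b v # gs)"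
proof -
  let ?T = "T - footprint v"
  have T: "T \<subseteq> {1..n}" "finite T" and pairs: "\<And>u w. u \<in> T \<Longrightarrow> w \<in> T \<Longrightarrow> u \<noteq> w \<Longrightarrow> {u, w} \<in> A"
    and stk: "stack E gs"
    using st finite_subset[of T "{1..n}"] by (auto simp: state_def)
  note ch = children_props[OF v T(1)]
  have fT: "footprint v \<subseteq> T" using footprint_targets[OF v(1)] .
  have new: "load A' ?T x = 0" if x: "x \<in> set (children b v)" for x
  proof -
    have ex: "exit_vertex x \<in> footprint v" using ch(2)[OF x] exit_mem[OF ch(1)[OF x]] by blast
    have "{exit_vertex x, w} \<in> A'" if "w \<in> targets (fst x) ?T" for w
    proof -
      have w: "w \<in> ?T" using that targets_subset by blast
      hence "{exit_vertex x, w} \<in> A" using pairs ex fT by blast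
      thus ?thesis using A'(2) w by blast
    qed
    thus ?thesis unfolding load_def by (intro sum.neutral) blast
  qed
  have old: "load A' ?T x \<le> load A T x" if x: "x \<in> set (concat gs)" for x
    unfolding load_def
  proof (rule sum_mono2)
    have lv: "fst x \<le> L" using stack_link[OF stk x] by (simp add: link_def)
    show "finite {v \<in> targets (fst x) T. {exit_vertex x, v} \<notin> A}"
      using T(2) targets_subset by (auto intro: finite_subset)
    show "{v \<in> targets (fst x) ?T. {exit_vertex x, v} \<notin> A'} \<subseteq> {v \<in> targets (fst x) T. {exit_vertex x, v} \<notin> A}"
      using targets_diff[of "fst x" T "footprint v"] targets_subset[of "fst x" ?T] A'(2) by blast
    show "0 \<le> gain (fst x) w" if "w \<in> {v \<in> targets (fst x) T. {exit_vertex x, v} \<notin> A} -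
        {v \<in> targets (fst x) ?T. {exit_vertex x, v} \<notin> A'}" for w
      using that gain_nonneg[OF _ lv] by blast
  qed
  have "sum_list (map (load A' ?T) (children b v)) = 0"
    using new by (intro sum_list_nonneg_eq_0_iff[THEN iffD2]) auto
  moreover have "sum_list (map (load A' ?T) (concat gs)) \<le> sum_list (map (load A T) (concat gs))"
    using old by (intro sum_list_mono)
  ultimately have "sum_list (map (load A' ?T) (concat (children b v # gs))) \<le> sum_list (map (load A T) (concat gs))"
    by simp
  hence l: "\<alpha> * p * sum_list (map (load A' ?T) (concat (children b v # gs))) \<le>
       \<alpha> * p * sum_list (map (load A T) (concat gs))"
    using alpha p by (intro mult_left_mono) auto
  have "card T \<le> card ?T + card (footprint v)"
    using T(2) fT by (simp add: card_Diff_subset finite_footprint)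
  also have "\<dots> \<le> card ?T + 2 * (L + 3)" using card_footprint[of v] by simp
  finally have "real (card T) \<le> real (card ?T + 2 * (L + 3))" by (rule of_nat_mono)
  hence "real (card T) - real (card ?T) \<le> 2 * (real L + 3)" by simp
  hence "\<eta> * (c0 * (real (card T) - real (card ?T))) \<le> \<eta> * (c0 * (2 * (real L + 3)))"
    using eta c0(1) by (intro mult_left_mono) auto
  also have "\<dots> \<le> \<eta> * gain b v" using gain_ge[OF v] eta by (intro mult_left_mono) auto
  finally have "\<eta> * c0 * (real n - real (card ?T)) \<le> \<eta> * c0 * (real n - real (card T)) + \<eta> * gain b v"
    by (simp add: algebra_simps)
  thus ?thesis using l unfolding potential_def
    by (simp add: weight_append gain_def algebra_simps)
qed

lemma state_finite: "state T A E gs \<Longrightarrow> finite T \<and> finite A"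
  using finite_subset[of T "{1..n}"] by (auto simp: state_def)

text \<open>The bound is at least 1 at a stopped search that is not deep enough, and along every
  step its mean does not exceed its present value. As the induction runs over the remaining states,
  the search is carried out by the case distinctions of the proof and never has to be defined as a
  process.\<close>

lemma exploration_bound:
  assumes "state T A E gs"
  shows "measure_pmf.prob (random_subset A p) {X. \<not> (\<exists>gs'. stack (E \<union> X) gs' \<and> l \<le> length gs')}
    \<le> exp (- \<tau> * (potential T A gs + \<zeta>))"
  using assms
\<comment> \<open>A new target takes at least one vertex from \<open>T\<close> and adds at most
  \<open>2 * (L + 1)\<close> nodes; a negative answer takes a pair from \<open>A\<close>; discarding
  shortens the stack.\<close>
proof (induction "card T * (2 * (L + 1) + 1) + card A + length (concat gs)" arbitrary: T A E gs
    rule: less_induct)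
  case less
  let ?long = "\<lambda>E. \<exists>gs'. stack E gs' \<and> l \<le> length gs'"
  note st = less.prems
  have T: "T \<subseteq> {1..n}" and stk: "stack E gs" and dist: "distinct (map exit_vertex (concat gs))"
    and sep: "\<And>x. x \<in> set (concat gs) \<Longrightarrow> separated H (set (snd x)) T"
    and pairs: "\<And>u w. u \<in> T \<Longrightarrow> w \<in> T \<Longrightarrow> u \<noteq> w \<Longrightarrow> {u, w} \<in> A"
    using st by (auto simp: state_def)
  have fin: "finite T" "finite A" using state_finite[OF st] by auto
  have push_measure: "card (T - footprint v) * (2 * (L + 1) + 1) + card A' + length (concat (children b v # gs))
      < card T * (2 * (L + 1) + 1) + card A + length (concat gs)"
    if v: "v \<in> targets b T" "b \<le> L" and A': "A' \<subseteq> A" for v b A'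
  proof -
    have "card (T - footprint v) < card T"
      using v(1) targets_subset mem_footprint fin(1) by (intro psubset_card_mono) blast+
    hence "Suc (card (T - footprint v)) * (2 * (L + 1) + 1) \<le> card T * (2 * (L + 1) + 1)"
      by (intro mult_right_mono) auto
    moreover have "card A' \<le> card A" using A' fin by (intro card_mono)
    moreover have "length (children b v) \<le> 2 * (L + 1)" using children_length(1)[of b v] v(2)
      by (simp add: algebra_simps)
    ultimately show ?thesis by simp
  qed
  consider (full) "r \<le> real n - real (card T)"
    | (root) "real n - real (card T) < r" "gs = []"
    | (active) x g gs1 where "real n - real (card T) < r" "gs = (x # g) # gs1"
  proof (cases gs)
    case Nil
    thus ?thesis using root full by force
  next
    case (Cons g' gs1)
    then obtain y ys where "g' = y # ys" using stk by (cases g') auto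
    thus ?thesis using active Cons full by force
  qed
  thus ?case
  proof cases
    \<comment> \<open>Enough vertices are used. Either the stack is deep and the event is
      impossible, or its weight is too small to offset the charge for used vertices, and the bound
      exceeds 1.\<close>
    case full
    show ?thesis
    proof (cases "l \<le> length gs")
      case True
      hence "?long (E \<union> X)" for X using stack_mono[OF stk, of "E \<union> X"] by blast
      thus ?thesis by simp
    next
      case False
      have lv: "fst x \<le> L" if "x \<in> set (concat gs)" for x
        using stack_link[OF stk that] by (simp add: link_def)
      have Mpos: "M > 0" using M[of 0] weight_pos[of 0] by simp
      have "weight (concat gs) \<le> real (length (concat gs)) * M"
        unfolding weight_def using lv M by (intro sum_list_const_le) blast
      also have "\<dots> \<le> (2 * (real L + 1) * real l) * M"
      proof (intro mult_right_mono)
        have "length (concat gs) \<le> 2 * (L + 1) * length gs" by (rule stack_length[OF stk])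
        also have "\<dots> \<le> 2 * (L + 1) * l" using False by (intro mult_left_mono) auto
        finally have "real (length (concat gs)) \<le> real (2 * (L + 1) * l)" by (rule of_nat_mono)
        thus "real (length (concat gs)) \<le> 2 * (real L + 1) * real l" by (simp add: algebra_simps)
      qed (use Mpos in simp)
      finally have w: "(1 + \<eta>) * weight (concat gs) \<le> (1 + \<eta>) * (M * (2 * (real L + 1) * real l))"
        using eta by (intro mult_left_mono) (auto simp: mult_ac)
      have "\<eta> * c0 * r \<le> \<eta> * c0 * (real n - real (card T))"
        using full eta c0(1) by (intro mult_left_mono) auto
      moreover have "0 \<le> load A T x" if "x \<in> set (concat gs)" for x
        unfolding load_def using gain_nonneg[OF _ lv[OF that]] by (intro sum_nonneg) blast
      hence "0 \<le> sum_list (map (load A T) (concat gs))"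
        by (intro sum_list_nonneg) (auto simp del: set_concat)
      hence "0 \<le> \<alpha> * p * sum_list (map (load A T) (concat gs))" using alpha p by simp
      ultimately have "potential T A gs \<le> - \<zeta>"
        using w final unfolding potential_def by linarith
      hence "1 \<le> exp (- \<tau> * (potential T A gs + \<zeta>))"
        using tau by (simp add: mult_nonneg_nonpos)
      thus ?thesis by (rule order.trans[OF measure_pmf.prob_le_1])
    qed
  next
    \<comment> \<open>With an empty stack any target of level 0 starts afresh, at no cost in
      revealed pairs; \<open>rich\<close> shows that one exists.\<close>
    case root
    have "0 < (1 + \<eta>) * \<phi> 0" using weight_pos[of 0] eta by simp
    also have "\<dots> \<le> \<alpha> * p * (\<Sum>v\<in>targets 0 T. gain 0 v)" by (rule rich[OF T root(1)]) simp
    finally have "targets 0 T \<noteq> {}" by auto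
    then obtain v where v: "v \<in> targets 0 T" by blast
    have st': "state (T - footprint v) A E (children 0 v # gs)"
      by (rule state_push[OF st v]) (use root in auto)
    have "measure_pmf.prob (random_subset A p) {X. \<not> ?long (E \<union> X)} \<le>
        exp (- \<tau> * (potential (T - footprint v) A (children 0 v # gs) + \<zeta>))"
      by (rule less.hyps[OF push_measure st']) (use v in auto)
    also have "potential T A gs + gain 0 v \<le> potential (T - footprint v) A (children 0 v # gs)"
      by (rule potential_push[OF st v]) auto
    hence "exp (- \<tau> * (potential (T - footprint v) A (children 0 v # gs) + \<zeta>)) \<le> exp (- \<tau> * (potential T A gs + \<zeta>))"
      using tau gain_nonneg[OF v] by simp
    finally show ?thesis .
  next
    case (active x g gs1)
    have lk: "link x" using stk active by simp
    hence lv: "fst x \<le> L" by (simp add: link_def)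
    let ?b = "fst x" and ?u = "exit_vertex x"
    have uT: "?u \<notin> T" using sep[of x] exit_mem[OF lk] active by (auto simp: separated_def)
    show ?thesis
    proof (cases "\<exists>v\<in>targets ?b T. {?u, v} \<in> A")
      case True
      then obtain v where v: "v \<in> targets ?b T" and e: "{?u, v} \<in> A" by blast
      let ?e = "{?u, v}" and ?A = "A - {{?u, v}}" and ?G = "gain (fst x) v"
      have vT: "v \<in> T" using v targets_subset by blast
      have eT: "?e \<inter> (T - footprint v) = {}" using uT mem_footprint[of v] by blast
      have st1: "state (T - footprint v) ?A (insert ?e E) (children ?b v # gs)"
      proof (rule state_push[OF st v lv])
        fix y assume "y \<in> set (children ?b v)"
        hence "hd (snd y) = v" "fst y + length (snd y) = ?b + 2"
          using children_props[OF v lv T] by auto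
        thus "joined (insert ?e E) (hd (hd gs)) y" using active by (simp add: joined_def)
      qed (use eT in auto)
      have m1: "card (T - footprint v) * (2 * (L + 1) + 1) + card ?A + length (concat (children ?b v # gs))
         < card T * (2 * (L + 1) + 1) + card A + length (concat gs)"
        by (rule push_measure[OF v lv]) blast
      have ih1: "measure_pmf.prob (random_subset ?A p) {X. \<not> ?long (insert ?e E \<union> X)} \<le>
         exp (- \<tau> * (potential (T - footprint v) ?A (children ?b v # gs) + \<zeta>))"
        by (rule less.hyps[OF m1 st1])
      have "potential T A gs + ?G \<le> potential (T - footprint v) ?A (children ?b v # gs)"
        by (rule potential_push[OF st v lv]) (use eT in auto)
      hence "exp (- \<tau> * (potential (T - footprint v) ?A (children ?b v # gs) + \<zeta>)) \<le>
          exp (- \<tau> * (potential T A gs + ?G + \<zeta>))" using tau by simp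
      also have "\<dots> = exp (- \<tau> * (potential T A gs + \<zeta>)) * exp (- \<tau> * ?G)"
        by (simp add: exp_add[symmetric] algebra_simps)
      finally have p1: "measure_pmf.prob (random_subset ?A p) {X. \<not> ?long (insert ?e E \<union> X)} \<le>
          exp (- \<tau> * (potential T A gs + \<zeta>)) * exp (- \<tau> * ?G)"
        by (rule order.trans[OF ih1])
      have st2: "state T ?A E gs" unfolding state_def
        using T fin stk sep dist pairs uT by (auto simp: doubleton_eq_iff)
      have m2: "card T * (2 * (L + 1) + 1) + card ?A + length (concat gs)
         < card T * (2 * (L + 1) + 1) + card A + length (concat gs)"
        using card_Diff1_less[OF fin(2) e] by simp
      have ih2: "measure_pmf.prob (random_subset ?A p) {X. \<not> ?long (E \<union> X)} \<le>
         exp (- \<tau> * (potential T ?A gs + \<zeta>))"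
        by (rule less.hyps[OF m2 st2])
      \<comment> \<open>The pair asked joins the exit vertex of \<open>x\<close> to a vertex of
        \<open>T\<close>. The other exit vertices differ from it and lie outside \<open>T\<close>,
        so only the load of \<open>x\<close> changes.\<close>
      have other: "load ?A T y = load A T y" if y: "y \<in> set (g @ concat gs1)" for y
      proof -
        have "?u \<noteq> exit_vertex y" using dist y active by auto
        moreover have "exit_vertex y \<notin> T"
          using sep[of y] exit_mem[OF stack_link[OF stk, of y]] y active by (auto simp: separated_def)
        ultimately have "{exit_vertex y, w} \<noteq> ?e" if "w \<in> T" for w
          using vT that by (auto simp: doubleton_eq_iff)
        hence "{v \<in> targets (fst y) T. {exit_vertex y, v} \<notin> ?A} = {v \<in> targets (fst y) T. {exit_vertex y, v} \<notin> A}"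
          using targets_subset by blast
        thus ?thesis by (simp add: load_def)
      qed
      have "{w \<in> targets ?b T. {?u, w} \<notin> ?A} = insert v {w \<in> targets ?b T. {?u, w} \<notin> A}"
        using v e uT by (auto simp: doubleton_eq_iff)
      moreover have "finite {w \<in> targets ?b T. {?u, w} \<notin> A}"
        using fin(1) targets_subset by (auto intro: finite_subset)
      ultimately have lx: "load ?A T x = ?G + load A T x" using e by (simp add: load_def)
      have "map (load ?A T) (g @ concat gs1) = map (load A T) (g @ concat gs1)"
        using other by (intro map_cong refl)
      hence "sum_list (map (load ?A T) (g @ concat gs1)) = sum_list (map (load A T) (g @ concat gs1))"
        by (rule arg_cong)
      moreover have "concat gs = x # (g @ concat gs1)" using active by simp
      ultimately have "sum_list (map (load ?A T) (concat gs)) = ?G + sum_list (map (load A T) (concat gs))"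
        using lx by (simp only: list.map sum_list.Cons add.assoc)
      hence pot: "potential T ?A gs = potential T A gs - \<alpha> * p * ?G"
        by (simp add: potential_def algebra_simps)
      have "exp (- \<tau> * (potential T ?A gs + \<zeta>)) =
          exp (- \<tau> * (potential T A gs + \<zeta>)) * exp (\<tau> * (\<alpha> * p * ?G))"
        unfolding pot exp_add[symmetric] by (simp add: algebra_simps)
      hence p2: "measure_pmf.prob (random_subset ?A p) {X. \<not> ?long (E \<union> X)} \<le>
          exp (- \<tau> * (potential T A gs + \<zeta>)) * exp (\<tau> * (\<alpha> * p * ?G))"
        using ih2 by simp
      have "measure_pmf.prob (random_subset A p) {X. \<not> ?long (E \<union> X)} =
          p * measure_pmf.prob (random_subset ?A p) {X. \<not> ?long (insert ?e E \<union> X)} +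
          (1 - p) * measure_pmf.prob (random_subset ?A p) {X. \<not> ?long (E \<union> X)}"
        by (subst prob_random_subset_split[OF fin(2) e p]) simp
      also have "\<dots> \<le> p * (exp (- \<tau> * (potential T A gs + \<zeta>)) * exp (- \<tau> * ?G)) +
          (1 - p) * (exp (- \<tau> * (potential T A gs + \<zeta>)) * exp (\<tau> * (\<alpha> * p * ?G)))"
        using p1 p2 p by (intro add_mono mult_left_mono) auto
      also have "\<dots> = exp (- \<tau> * (potential T A gs + \<zeta>)) *
          (p * exp (- \<tau> * ?G) + (1 - p) * exp (\<tau> * (\<alpha> * p * ?G)))"
        by (simp add: algebra_simps)
      also have "\<dots> \<le> exp (- \<tau> * (potential T A gs + \<zeta>)) * 1"
        using drift[OF lv v] by (intro mult_left_mono) auto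
      finally show ?thesis by simp
    next
      case False
      \<comment> \<open>When the group becomes empty it is removed, and the parent, still the head
        of the next group, resumes its own questions.\<close>
      define gs2 where "gs2 = (if g = [] then gs1 else g # gs1)"
      have c2: "concat gs2 = g @ concat gs1" by (simp add: gs2_def)
      have stk2: "stack E gs2" using stk active by (auto simp: gs2_def)
      have st2: "state T A E gs2" unfolding state_def c2
        using T fin stk2 sep dist pairs active by auto
      have m2: "card T * (2 * (L + 1) + 1) + card A + length (concat gs2)
         < card T * (2 * (L + 1) + 1) + card A + length (concat gs)"
        using active c2 by simp
      have ih: "measure_pmf.prob (random_subset A p) {X. \<not> ?long (E \<union> X)} \<le>
         exp (- \<tau> * (potential T A gs2 + \<zeta>))"
        by (rule less.hyps[OF m2 st2])
      have "{v \<in> targets ?b T. {?u, v} \<notin> A} = targets ?b T" using False by blast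
      hence "(1 + \<eta>) * \<phi> ?b \<le> \<alpha> * p * load A T x"
        using rich[OF T active(1) lv] by (simp add: load_def)
      hence "potential T A gs \<le> potential T A gs2"
        using active c2 by (simp add: potential_def weight_def algebra_simps)
      hence "exp (- \<tau> * (potential T A gs2 + \<zeta>)) \<le> exp (- \<tau> * (potential T A gs + \<zeta>))"
        using tau by simp
      thus ?thesis using ih by linarith
    qed
  qed
qed

lemma long_stack_prob:
  "measure_pmf.prob (random_subset (complete_edges n) p) {X. \<not> (\<exists>gs. stack X gs \<and> l \<le> length gs)}
    \<le> exp (- \<tau> * \<zeta>)"
proof -
  have "finite (complete_edges n)"
    by (rule finite_subset[of _ "Pow {1..n}"]) (auto simp: complete_edges_def)
  hence "state {1..n} (complete_edges n) {} []"
    by (auto simp: state_def complete_edges_def)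
  from exploration_bound[OF this] show ?thesis
    by (simp add: potential_def weight_def)
qed

end

section \<open>Alternating cycles\<close>

definition red_count :: "edge_set \<Rightarrow> nat list \<Rightarrow> nat" where
  "red_count H w = length (filter (\<lambda>e. e \<in> H) (path_edges w))"

text \<open>The planted edge at each planted vertex has to lie on the segment itself, so the
  condition survives every way of joining segments.\<close>

definition segment :: "nat set \<Rightarrow> edge_set \<Rightarrow> edge_set \<Rightarrow> nat list \<Rightarrow> bool" where
  "segment V H G w \<longleftrightarrow> w \<noteq> [] \<and> distinct w \<and> set (path_edges w) \<subseteq> G \<and>
     (\<forall>x\<in>set w \<inter> V. \<exists>e\<in>set (path_edges w) \<inter> H. x \<in> e)"

lemma separatedD:
  assumes "separated H P Q"
  shows "P \<inter> Q = {}" "e \<in> H \<Longrightarrow> e \<inter> P = {} \<or> e \<inter> Q = {}"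
  using assms by (simp_all add: separated_def)

lemma separated_join:
  assumes "separated H (set u) (set w)" "u \<noteq> []" "w \<noteq> []"
  shows "{last u, hd w} \<notin> H"
proof
  assume "{last u, hd w} \<in> H"
  hence "{last u, hd w} \<inter> set u = {} \<or> {last u, hd w} \<inter> set w = {}"
    by (rule separatedD(2)[OF assms(1)])
  moreover have "last u \<in> set u" "hd w \<in> set w" using assms(2,3) by simp_all
  ultimately show False by auto
qed

lemma segment_append:
  assumes "segment V H G u" "segment V H G w" "separated H (set u) (set w)" "{last u, hd w} \<in> G"
  shows "segment V H G (u @ w)" "red_count H (u @ w) = red_count H u + red_count H w"
proof -
  have ne: "u \<noteq> []" "w \<noteq> []" using assms by (auto simp: segment_def)
  show "red_count H (u @ w) = red_count H u + red_count H w"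
    using separated_join[OF assms(3) ne] ne by (simp add: red_count_def path_edges_append)
  have d: "distinct u" "distinct w" "set u \<inter> set w = {}"
    using assms(1-3) by (auto simp: segment_def separated_def)
  have sub: "set (path_edges u) \<subseteq> G" "set (path_edges w) \<subseteq> G"
    and t: "\<forall>x\<in>set u \<inter> V. \<exists>e\<in>set (path_edges u) \<inter> H. x \<in> e"
      "\<forall>x\<in>set w \<inter> V. \<exists>e\<in>set (path_edges w) \<inter> H. x \<in> e"
    using assms(1,2) by (simp_all add: segment_def)
  have pe: "set (path_edges (u @ w)) = insert {last u, hd w} (set (path_edges u) \<union> set (path_edges w))"
    using ne by (simp add: path_edges_append)
  show "segment V H G (u @ w)"
    unfolding segment_def
  proof (intro conjI ballI)
    show "u @ w \<noteq> []" "distinct (u @ w)" using ne d by simp_all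
    show "set (path_edges (u @ w)) \<subseteq> G" unfolding pe using sub assms(4) by simp
    fix x assume "x \<in> set (u @ w) \<inter> V"
    hence "x \<in> set u \<inter> V \<or> x \<in> set w \<inter> V" by simp
    then obtain e where "e \<in> set (path_edges u) \<inter> H \<or> e \<in> set (path_edges w) \<inter> H" "x \<in> e"
      using t by meson
    thus "\<exists>e\<in>set (path_edges (u @ w)) \<inter> H. x \<in> e"
      unfolding pe by (intro bexI[of _ e]) auto
  qed
qed

lemma separated_Union:
  "(\<And>w. w \<in> A \<Longrightarrow> separated H u w) \<Longrightarrow> separated H u (\<Union>A)"
  unfolding separated_def by (intro conjI ballI) auto

lemma segment_concat:
  assumes "ws \<noteq> []" "\<forall>w\<in>set ws. segment V H G w"
    "sorted_wrt (\<lambda>u w. separated H (set u) (set w)) ws" "successively (\<lambda>u w. {last u, hd w} \<in> G) ws"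
  shows "segment V H G (concat ws) \<and> red_count H (concat ws) = sum_list (map (red_count H) ws) \<and>
     hd (concat ws) = hd (hd ws) \<and> last (concat ws) = last (last ws)"
  using assms
proof (induction ws)
  case (Cons w ws)
  have w: "segment V H G w" "w \<noteq> []" using Cons.prems by (auto simp: segment_def)
  show ?case
  proof (cases "ws = []")
    case True
    thus ?thesis using w by simp
  next
    case False
    hence ih: "segment V H G (concat ws)" "red_count H (concat ws) = sum_list (map (red_count H) ws)"
       "hd (concat ws) = hd (hd ws)" "last (concat ws) = last (last ws)"
      using Cons by (auto simp: successively_Cons)
    have "separated H (set w) (\<Union>(set ` set ws))"
      using Cons.prems(3) by (intro separated_Union) auto
    hence sep: "separated H (set w) (set (concat ws))" by simp
    have "{last w, hd (concat ws)} \<in> G" using Cons.prems(4) False ih(3) by (simp add: successively_Cons)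
    from segment_append[OF w(1) ih(1) sep this] show ?thesis
      using ih w(2) False segment_def[of V H G "concat ws"] by simp
  qed
qed simp

text \<open>A planted vertex of the cycle has degree 2 in both edge sets and shares one or two
  edges: sharing one leaves degree 2, sharing two removes it from the vertex set. Outside vertices
  of the cycle are gained with degree 2. As half of the cycle is planted, the number of edges and
  hence of vertices is unchanged, although the vertex set may differ from \<open>V\<close>.\<close>

lemma flip_cycle:
  assumes H: "two_regular V H" and W: "distinct w" "3 \<le> length w"
    and touch: "\<forall>x\<in>set w \<inter> V. \<exists>e\<in>cycle_edges w \<inter> H. x \<in> e"
    and half: "2 * card (cycle_edges w \<inter> H) = length w"
  shows "\<exists>V' \<subseteq> V \<union> set w. card V' = card V \<and> two_regular V' (sym_diff H (cycle_edges w))"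
proof -
  let ?C = "cycle_edges w"
  let ?H' = "sym_diff H ?C"
  define V' where "V' = \<Union>?H'"
  have C: "two_regular (set w) ?C" by (rule two_regular_cycle[OF W])
  have fin: "finite H" "finite ?C" "finite V" using H C two_regular_finite by (auto simp: two_regular_def)
  have sub: "\<And>e. e \<in> H \<Longrightarrow> e \<subseteq> V \<and> card e = 2" "\<And>e. e \<in> ?C \<Longrightarrow> e \<subseteq> set w \<and> card e = 2"
    using H C by (auto simp: two_regular_def)
  have V'sub: "V' \<subseteq> V \<union> set w" unfolding V'_def using sub by blast
  have deg: "card (incident ?H' x) = 2" if x: "x \<in> V'" for x
  proof -
    have inc: "incident ?H' x = sym_diff (incident H x) (incident ?C x)" by (auto simp: incident_def)
    have fi: "finite (incident H x)" "finite (incident ?C x)" using fin by (auto simp: incident_def)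
    have ne: "incident ?H' x \<noteq> {}" using x by (auto simp: V'_def incident_def)
    consider "x \<in> V" "x \<in> set w" | "x \<in> V" "x \<notin> set w" | "x \<notin> V" "x \<in> set w"
      using x V'sub by blast
    thus ?thesis
    proof cases
      case 1
      have c: "card (incident H x) = 2" "card (incident ?C x) = 2"
        using 1 H C by (auto simp: two_regular_def)
      let ?I = "incident H x \<inter> incident ?C x"
      have "?I \<noteq> {}" using touch 1 by (auto simp: incident_def)
      hence i1: "1 \<le> card ?I" using fi by (simp add: Suc_le_eq card_gt_0_iff)
      have d: "card (incident H x - incident ?C x) = 2 - card ?I" "card (incident ?C x - incident H x) = 2 - card ?I"
        using c card_Diff_subset_Int[of "incident H x" "incident ?C x"]
          card_Diff_subset_Int[of "incident ?C x" "incident H x"] fi by (auto simp: Int_commute)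
      have "card (incident ?H' x) = (2 - card ?I) + (2 - card ?I)"
        unfolding inc using fi d by (subst card_Un_disjoint) auto
      moreover have "card (incident ?H' x) \<noteq> 0" using ne fi unfolding inc by simp
      \<comment> \<open>With two shared edges the vertex would be isolated in the symmetric
        difference, contrary to \<open>x \<in> V'\<close>.\<close>
      ultimately have "card ?I = 1" using i1 by (cases "2 \<le> card ?I") auto
      thus ?thesis using \<open>card (incident ?H' x) = _\<close> by simp
    next
      case 2
      hence "incident ?C x = {}" using sub(2) by (auto simp: incident_def)
      thus ?thesis using 2 H unfolding inc by (simp add: two_regular_def)
    next
      case 3
      hence "incident H x = {}" using sub(1) by (auto simp: incident_def)
      thus ?thesis using 3 C unfolding inc by (simp add: two_regular_def)
    qed
  qed
  have finV': "finite V'" using V'sub fin(3) finite_subset by auto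
  have reg: "two_regular V' ?H'" unfolding two_regular_def
    using finV' sub deg by (auto simp: V'_def)
  have "card ?H' = card (H - ?C) + card (?C - H)"
    using fin by (subst card_Un_disjoint) auto
  also have "card (H - ?C) = card H - card (?C \<inter> H)"
    using fin by (subst card_Diff_subset_Int) (auto simp: Int_commute)
  also have "card (?C - H) = card ?C - card (?C \<inter> H)"
    using fin by (subst card_Diff_subset_Int) auto
  also have "card ?C = 2 * card (?C \<inter> H)" using half card_cycle_edges[OF W] by simp
  also have "card H - card (?C \<inter> H) + (2 * card (?C \<inter> H) - card (?C \<inter> H)) = card H"
    using card_mono[of H "?C \<inter> H"] fin by simp
  finally have "card V' = card V"
    using two_regular_card[OF reg] two_regular_card[OF H] by simp
  thus ?thesis using reg V'sub by blast
qed

definition planted_in :: "nat \<Rightarrow> nat \<Rightarrow> edge_set \<Rightarrow> edge_set set" where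
  "planted_in n m G = {H. H \<subseteq> G \<and> (\<exists>V \<subseteq> {1..n}. card V = m \<and> two_regular V H)}"

lemma finite_planted_in: "finite (planted_in n m G)"
  by (rule finite_subset[of _ "Pow (Pow {1..n})"]) (auto simp: planted_in_def two_regular_def)

text \<open>The segments are closed up into a cycle and flipped. The difference of old and new
  two-factor is the cycle itself, so the new one remembers which segments were used; this
  distinguishes the candidates later.\<close>

lemma segment_cycle:
  assumes H: "two_regular V H" "V \<subseteq> {1..n}" "H \<subseteq> G"
    and ws: "2 \<le> length ws" "\<forall>w\<in>set ws. segment V H G w \<and> 2 * red_count H w = length w \<and> set w \<subseteq> {1..n}"
    "sorted_wrt (\<lambda>u w. separated H (set u) (set w)) ws" "successively (\<lambda>u w. {last u, hd w} \<in> G) ws"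
    "{last (last ws), hd (hd ws)} \<in> G"
  shows "\<exists>H' \<in> planted_in n (card V) G. \<Union>(sym_diff H H') = set (concat ws)"
proof -
  define w where "w = concat ws"
  have ne: "ws \<noteq> []" using ws(1) by auto
  note sc = segment_concat[OF ne _ ws(3,4), of V]
  have seg: "segment V H G w" and red: "red_count H w = sum_list (map (red_count H) ws)"
    and ends: "hd w = hd (hd ws)" "last w = last (last ws)"
    using sc ws(2) by (auto simp: w_def)
  have w0: "w \<noteq> []" "distinct w" using seg by (auto simp: segment_def)
  have "sum_list (map (\<lambda>w. 2 * red_count H w) ws) = sum_list (map length ws)"
    using ws(2) by (intro arg_cong[where f = sum_list] map_cong) auto
  hence len: "length w = 2 * red_count H w" unfolding w_def length_concat
    using red by (simp add: sum_list_const_mult w_def)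
  have each: "2 \<le> length v" if "v \<in> set ws" for v
  proof -
    have "length v = 2 * red_count H v" "v \<noteq> []" using ws(2) that by (auto simp: segment_def)
    thus ?thesis by (cases "red_count H v") auto
  qed
  obtain u v r where uvr: "ws = u # v # r" using ws(1) by (cases ws; cases "tl ws") auto
  have len3: "3 \<le> length w" using each[of u] each[of v] by (simp add: w_def uvr)
  \<comment> \<open>First and last segment are different and so separated. The closing edge is
    therefore not planted, and all planted edges of the cycle are counted by
    \<open>red_count\<close>.\<close>
  have closing: "{last w, hd w} \<notin> H"
  proof -
    have "last ws \<in> set (v # r)" by (simp add: uvr)
    hence "separated H (set u) (set (last ws))" using ws(3) uvr by auto
    moreover have "u \<noteq> []" "last ws \<noteq> []" using each[of u] each[of "last ws"] last_in_set[OF ne] uvr by force+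
    hence "hd u \<in> set u" "last (last ws) \<in> set (last ws)" by auto
    ultimately show ?thesis unfolding ends by (auto simp: uvr separated_def)
  qed
  let ?C = "cycle_edges w"
  have Ceq: "?C = insert {last w, hd w} (set (path_edges w))" by (rule cycle_edges_conv[OF w0(1)])
  have "?C \<inter> H = set (filter (\<lambda>e. e \<in> H) (path_edges w))" using closing by (auto simp: Ceq)
  moreover have "card (set (filter (\<lambda>e. e \<in> H) (path_edges w))) = red_count H w"
    unfolding red_count_def by (rule distinct_card) (simp add: path_edges_distinct[OF w0(2)])
  ultimately have cardCH: "card (?C \<inter> H) = red_count H w" by argo
  have touch: "\<forall>x\<in>set w \<inter> V. \<exists>e\<in>?C \<inter> H. x \<in> e"
    using seg unfolding segment_def Ceq by blast
  obtain V' where V': "V' \<subseteq> V \<union> set w" "card V' = card V" "two_regular V' (sym_diff H ?C)"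
    using flip_cycle[OF H(1) w0(2) len3 touch] cardCH len by auto
  have "?C \<subseteq> G" using seg ws(5) by (auto simp: Ceq segment_def ends)
  moreover have "set w \<subseteq> {1..n}" using ws(2) by (auto simp: w_def)
  ultimately have "sym_diff H ?C \<in> planted_in n (card V) G"
    using V' H by (auto simp: planted_in_def intro!: exI[of _ V'])
  moreover have sd: "sym_diff H (sym_diff H ?C) = ?C" by blast
  have "\<Union>(sym_diff H (sym_diff H ?C)) = set w"
    unfolding sd by (rule two_regular_Union[OF two_regular_cycle[OF w0(2) len3]])
  ultimately show ?thesis unfolding w_def[symmetric] by (rule rev_bexI)
qed

text \<open>Depth-first search after \<open>j\<close> moves: \<open>S\<close> is finished,
  \<open>T\<close> unvisited, \<open>xs\<close> the path with its end at the head. A move either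
  extends the path from \<open>T\<close> or retires its end to \<open>S\<close>; both raise
  \<open>2 * card S + length xs\<close> by one.\<close>

lemma dfs_partition:
  fixes R :: "nat \<Rightarrow> nat \<Rightarrow> bool"
  assumes "finite U" "j \<le> card U"
  shows "\<exists>S T xs. S \<union> T \<union> set xs = U \<and> S \<inter> T = {} \<and> (S \<union> T) \<inter> set xs = {} \<and> distinct xs \<and>
     successively R (rev xs) \<and> (\<forall>s\<in>S. \<forall>t\<in>T. \<not> R s t) \<and> 2 * card S + length xs = j"
  using assms(2)
proof (induction j)
  case 0
  show ?case by (intro exI[of _ "{}"] exI[of _ U] exI[of _ "[]"]) auto
next
  case (Suc j)
  then obtain S T xs where 1: "S \<union> T \<union> set xs = U" "S \<inter> T = {}" "(S \<union> T) \<inter> set xs = {}" "distinct xs"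
     "successively R (rev xs)" "\<forall>s\<in>S. \<forall>t\<in>T. \<not> R s t" "2 * card S + length xs = j"
    by (auto dest: Suc_leD)
  have fin: "finite S" "finite T" using assms(1) 1(1) by (auto dest: finite_subset[rotated])
  show ?case
  proof (cases xs)
    case Nil
    have "T \<noteq> {}"
    proof
      assume "T = {}"
      hence "S = U" using 1(1) Nil by simp
      thus False using 1(7) Nil Suc.prems by simp
    qed
    then obtain t where "t \<in> T" by blast
    thus ?thesis using 1 Nil
      by (intro exI[of _ S] exI[of _ "T - {t}"] exI[of _ "[t]"]) auto
  next
    case (Cons x r)
    show ?thesis
    proof (cases "\<exists>t\<in>T. R x t")
      case True
      then obtain t where t: "t \<in> T" "R x t" by blast
      have "successively R (rev (t # xs))" using 1(5) t(2) Cons by (simp add: successively_append_iff)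
      thus ?thesis using 1 t(1)
        by (intro exI[of _ S] exI[of _ "T - {t}"] exI[of _ "t # xs"]) auto
    next
      case False
      have "successively R (rev r)" using 1(5) Cons by (cases r) (auto simp: successively_append_iff)
      moreover have "card (insert x S) = Suc (card S)" using 1(3) Cons fin by auto
      ultimately show ?thesis using 1 Cons False
        by (intro exI[of _ "insert x S"] exI[of _ T] exI[of _ r]) auto
    qed
  qed
qed

text \<open>After \<open>card U\<close> moves \<open>S\<close> and \<open>T\<close> have equal size.
  Being unrelated, they have fewer than \<open>k\<close> elements, so the path misses fewer than
  \<open>2 * k\<close>. A relation from its last \<open>k\<close> to its first \<open>k\<close>
  elements closes a cycle that loses fewer than \<open>2 * k\<close> more.\<close>

lemma long_cycle:
  fixes R :: "nat \<Rightarrow> nat \<Rightarrow> bool"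
  assumes U: "finite U" "4 * k \<le> card U" "1 \<le> k"
    and R: "\<And>A B. A \<subseteq> U \<Longrightarrow> B \<subseteq> U \<Longrightarrow> A \<inter> B = {} \<Longrightarrow> card A = k \<Longrightarrow> card B = k \<Longrightarrow> \<exists>a\<in>A. \<exists>b\<in>B. R a b"
  shows "\<exists>cs. distinct cs \<and> set cs \<subseteq> U \<and> 2 \<le> length cs \<and> card U \<le> length cs + 4 * k \<and>
     successively R cs \<and> R (last cs) (hd cs)"
proof -
  obtain S T ys where 1: "S \<union> T \<union> set ys = U" "S \<inter> T = {}" "(S \<union> T) \<inter> set ys = {}" "distinct ys"
     "successively R (rev ys)" "\<forall>s\<in>S. \<forall>t\<in>T. \<not> R s t" "2 * card S + length ys = card U"
    using dfs_partition[OF U(1) order.refl, of R] by auto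
  have fin: "finite S" "finite T" using U(1) 1(1) by (auto dest: finite_subset[rotated])
  have "card U = card S + card T + length ys"
    unfolding 1(1)[symmetric] using fin 1(2,3,4) by (simp add: card_Un_disjoint distinct_card)
  hence ST: "card S = card T" using 1(7) by simp
  have S: "card S < k"
  proof (rule ccontr)
    assume "\<not> card S < k"
    then obtain A B where "A \<subseteq> S" "card A = k" "B \<subseteq> T" "card B = k"
      using ST obtain_subset_with_card_n[of k S] obtain_subset_with_card_n[of k T] by (metis not_less)
    thus False using R[of A B] 1(1,2,6) by blast
  qed
  define xs where "xs = rev ys"
  have xs: "distinct xs" "set xs \<subseteq> U" "successively R xs" "card U \<le> length xs + 2 * (k - 1)"
    using 1 S by (auto simp: xs_def)
  let ?l = "length xs"
  have l: "2 * k + 2 \<le> ?l" using xs(4) U(2,3) by linarith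
  have "set (drop (?l - k) xs) \<inter> set (take k xs) = {}"
  proof -
    have "k \<le> ?l - k" using l by simp
    thus ?thesis using set_take_disj_set_drop_if_distinct[OF xs(1)] by blast
  qed
  moreover have "set (drop (?l - k) xs) \<subseteq> U" "set (take k xs) \<subseteq> U"
    using set_drop_subset[of "?l - k" xs] set_take_subset[of k xs] xs(2) by blast+
  moreover have "card (set (drop (?l - k) xs)) = k" "card (set (take k xs)) = k"
    using xs(1) l by (simp_all add: distinct_card)
  ultimately obtain a b where ab: "a \<in> set (drop (?l - k) xs)" "b \<in> set (take k xs)" "R a b"
    using R by blast
  obtain i where i: "i < k" "a = xs ! (?l - k + i)" using ab(1) l by (auto simp: in_set_conv_nth)
  obtain j where j: "j < k" "b = xs ! j" using ab(2) l by (auto simp: in_set_conv_nth)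
  define cs where "cs = drop j (take (Suc (?l - k + i)) xs)"
  have len: "length cs = Suc (?l - k + i) - j" using i l by (simp add: cs_def)
  have "xs = take j xs @ (cs @ drop (Suc (?l - k + i)) xs)"
  proof -
    have "take j (take (Suc (?l - k + i)) xs) = take j xs" using j i l by (simp add: min_def)
    hence "take (Suc (?l - k + i)) xs = take j xs @ cs"
      unfolding cs_def by (metis append_take_drop_id)
    thus ?thesis by (metis append.assoc append_take_drop_id)
  qed
  hence sub: "successively R cs" "distinct cs" "set cs \<subseteq> U"
    using xs(1,2,3) by (metis successively_append_iff, metis distinct_append, metis set_append le_sup_iff)
  have "hd cs = b" using len l j i by (simp add: cs_def hd_drop_conv_nth)
  moreover have "last cs = a" using len l j i by (simp add: cs_def last_conv_nth)
  ultimately have "R (last cs) (hd cs)" using ab(3) by simp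
  moreover have "2 \<le> length cs" "card U \<le> length cs + 4 * k" using len l j(1) xs(4) by linarith+
  ultimately show ?thesis using sub by blast
qed

text \<open>In the expansion of \<open>(1 + y) ^ card A\<close> over subsets, each small set has
  weight at least \<open>y ^ t\<close>.\<close>

lemma card_small_subsets:
  fixes y :: real
  assumes "finite A" "0 < y" "y \<le> 1"
  shows "real (card {D. D \<subseteq> A \<and> card D \<le> t}) * y ^ t \<le> (1 + y) ^ card A"
proof -
  have "real (card {D. D \<subseteq> A \<and> card D \<le> t}) * y ^ t = (\<Sum>D | D \<subseteq> A \<and> card D \<le> t. y ^ t)" by simp
  also have "\<dots> \<le> (\<Sum>D | D \<subseteq> A \<and> card D \<le> t. y ^ card D)"
    using assms by (intro sum_mono power_decreasing) auto
  also have "\<dots> \<le> (\<Sum>D\<in>Pow A. y ^ card D)" using assms by (intro sum_mono2) auto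
  also have "\<dots> = (\<Prod>x\<in>A. y + 1)"
    by (subst prod_add[OF assms(1)]) simp
  finally show ?thesis by (simp add: add.commute)
qed

section \<open>Many two-factors from a long path\<close>

text \<open>\<open>S c x y\<close> runs through block \<open>c\<close> from its entry
  \<open>x\<close> to its exit \<open>y\<close>. For every set \<open>U\<close> of blocks, a cycle
  through all but at most \<open>4 * k\<close> of them gives a candidate. The candidate and the set
  of missed blocks determine \<open>U\<close>, so the number of candidates is at least
  \<open>2 ^ N\<close> divided by the number of small sets.\<close>

lemma many_planted:
  fixes S :: "nat \<Rightarrow> nat \<Rightarrow> nat \<Rightarrow> nat list"
  assumes H: "two_regular V H" "V \<subseteq> {1..n}" "H \<subseteq> G" and FG: "F \<subseteq> G"
    and seg: "\<And>c x y. c < N \<Longrightarrow> x < K \<Longrightarrow> y < K \<Longrightarrow>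
      segment V H G (S c x y) \<and> 2 * red_count H (S c x y) = length (S c x y) \<and>
      set (S c x y) \<subseteq> {1..n} \<and> set (S c x y) \<subseteq> B c \<and> hd (S c x y) = en c x \<and>
      last (S c x y) = ex c y \<and> mark c \<in> set (S c x y)"
    and sep: "\<And>c d. c < N \<Longrightarrow> d < N \<Longrightarrow> c \<noteq> d \<Longrightarrow> separated H (B c) (B d)"
    and dense: "\<And>A D. A \<subseteq> {..<N} \<Longrightarrow> D \<subseteq> {..<N} \<Longrightarrow> A \<inter> D = {} \<Longrightarrow> card A = k \<Longrightarrow> card D = k \<Longrightarrow>
      \<exists>c\<in>A. \<exists>d\<in>D. \<exists>x<K. \<exists>y<K. {ex c y, en d x} \<in> F"
    and k: "1 \<le> k" and K: "1 \<le> K"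
  shows "2 ^ N \<le> card (planted_in n (card V) G) * card {D. D \<subseteq> {..<N} \<and> card D \<le> 4 * k}"
proof -
  \<comment> \<open>The marks read off from a candidate which blocks its cycle passed: the mark of a
    block lies on all of its segments and in no other block.\<close>
  define used where "used = (\<lambda>H'. {c. c < N \<and> mark c \<in> \<Union>(sym_diff H H')})"
  define R where "R = (\<lambda>c d. \<exists>x<K. \<exists>y<K. {ex c y, en d x} \<in> F)"
  have "\<exists>q. R c d \<longrightarrow> fst q < K \<and> snd q < K \<and> {ex c (snd q), en d (fst q)} \<in> F" for c d
  proof (cases "R c d")
    case True
    then obtain x y where "x < K" "y < K" "{ex c y, en d x} \<in> F" unfolding R_def by blast
    thus ?thesis by (intro exI[of _ "(x, y)"]) simp
  qed simp
  hence "\<exists>f. \<forall>c d. R c d \<longrightarrow> fst (f c d) < K \<and> snd (f c d) < K \<and> {ex c (snd (f c d)), en d (fst (f c d))} \<in> F"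
    by (intro choice allI)
  then obtain f where f: "\<And>c d. R c d \<Longrightarrow> fst (f c d) < K \<and> snd (f c d) < K \<and> {ex c (snd (f c d)), en d (fst (f c d))} \<in> F"
    by blast
  have ex: "\<exists>H'. H' \<in> planted_in n (card V) G \<and> used H' \<subseteq> U \<and> card (U - used H') \<le> 4 * k"
    if U: "U \<subseteq> {..<N}" for U
  proof (cases "4 * k \<le> card U")
    case False
    have "H \<in> planted_in n (card V) G" using H by (auto simp: planted_in_def)
    moreover have "used H = {}" by (simp add: used_def)
    ultimately show ?thesis using False by (intro exI[of _ H]) auto
  next
    case True
    have finU: "finite U" using U finite_subset by blast
    have "\<exists>a\<in>A. \<exists>b\<in>D. R a b" if "A \<subseteq> U" "D \<subseteq> U" "A \<inter> D = {}" "card A = k" "card D = k" for A D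
      using dense[of A D] that U unfolding R_def by blast
    from long_cycle[OF finU True k this] obtain cs where cs: "distinct cs" "set cs \<subseteq> U" "2 \<le> length cs"
        "card U \<le> length cs + 4 * k" "successively R cs" "R (last cs) (hd cs)" by blast
    let ?l = "length cs"
    define nxt where "nxt = (\<lambda>i. Suc i mod ?l)"
    define prv where "prv = (\<lambda>i. if i = 0 then ?l - 1 else i - 1)"
    have l0: "0 < ?l" "cs \<noteq> []" using cs(3) by auto
    have Rn: "R (cs ! i) (cs ! nxt i)" if "i < ?l" for i
    proof (cases "Suc i < ?l")
      case True
      thus ?thesis using cs(5) by (simp add: nxt_def successively_conv_nth)
    next
      case False
      hence "i = ?l - 1" using that by simp
      thus ?thesis using cs(6) l0 by (simp add: nxt_def last_conv_nth hd_conv_nth)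
    qed
    have prv: "prv i < ?l" "nxt (prv i) = i" if "i < ?l" for i
      using that by (auto simp: prv_def nxt_def)
    have nxt: "nxt i < ?l" for i using l0 by (simp add: nxt_def)
    \<comment> \<open>The edge from the preceding block dictates the entry and the edge to the
      following block the exit, independently of each other; hence segments for all pairs of entry
      and exit.\<close>
    define X where "X = (\<lambda>i. fst (f (cs ! prv i) (cs ! i)))"
    define Y where "Y = (\<lambda>i. snd (f (cs ! i) (cs ! nxt i)))"
    have XY: "X i < K" "Y i < K" "{ex (cs ! i) (Y i), en (cs ! nxt i) (X (nxt i))} \<in> F" if i: "i < ?l" for i
    proof -
      show "X i < K" using f[OF Rn[OF prv(1)[OF i]]] prv(2)[OF i] by (simp add: X_def)
      have pn: "prv (nxt i) = i" using i by (cases "Suc i = ?l") (auto simp: prv_def nxt_def)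
      show "Y i < K" "{ex (cs ! i) (Y i), en (cs ! nxt i) (X (nxt i))} \<in> F"
        using f[OF Rn[OF i]] pn by (simp_all add: X_def Y_def)
    qed
    have csN: "cs ! i < N" if "i < ?l" for i using nth_mem[OF that] cs(2) U by blast
    define w where "w = (\<lambda>i. S (cs ! i) (X i) (Y i))"
    have w: "segment V H G (w i) \<and> 2 * red_count H (w i) = length (w i) \<and>
      set (w i) \<subseteq> {1..n} \<and> set (w i) \<subseteq> B (cs ! i) \<and> hd (w i) = en (cs ! i) (X i) \<and>
      last (w i) = ex (cs ! i) (Y i) \<and> mark (cs ! i) \<in> set (w i)" if "i < ?l" for i
      unfolding w_def by (rule seg[OF csN[OF that] XY(1,2)[OF that]])
    define ws where "ws = map w [0..<?l]"
    have lws: "length ws = ?l" by (simp add: ws_def)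
    have join: "{last (w i), hd (w (nxt i))} \<in> G" if "i < ?l" for i
      using w[OF that] w[OF nxt[of i]] XY(3)[OF that] FG by auto
    have sepB: "separated H (B (cs ! i)) (B (cs ! j))" if "i < j" "j < ?l" for i j
    proof -
      have "cs ! i \<noteq> cs ! j" using that cs(1) by (simp add: nth_eq_iff_index_eq)
      thus ?thesis using sep csN that by simp
    qed
    have "\<exists>H' \<in> planted_in n (card V) G. \<Union>(sym_diff H H') = set (concat ws)"
    proof (rule segment_cycle[OF H])
      show "2 \<le> length ws" using cs(3) lws by simp
      show "\<forall>v\<in>set ws. segment V H G v \<and> 2 * red_count H v = length v \<and> set v \<subseteq> {1..n}"
        using w by (auto simp: ws_def)
      show "sorted_wrt (\<lambda>u w. separated H (set u) (set w)) ws"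
        unfolding sorted_wrt_iff_nth_less
      proof (intro allI impI)
        fix i j assume ij: "i < j" "j < length ws"
        hence i: "i < ?l" and j: "j < ?l" using lws by simp_all
        have "set (w i) \<subseteq> B (cs ! i)" "set (w j) \<subseteq> B (cs ! j)" using w[OF i] w[OF j] by simp_all
        from separated_mono[OF sepB[OF ij(1) j] this]
        show "separated H (set (ws ! i)) (set (ws ! j))" using i j by (simp add: ws_def)
      qed
      show "successively (\<lambda>u w. {last u, hd w} \<in> G) ws"
        unfolding successively_conv_nth
      proof (intro allI impI)
        fix i assume "Suc i < length ws"
        hence i: "i < ?l" "Suc i < ?l" using lws by simp_all
        hence "nxt i = Suc i" by (simp add: nxt_def)
        thus "{last (ws ! i), hd (ws ! Suc i)} \<in> G" using join[OF i(1)] i by (simp add: ws_def)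
      qed
      have "last ws = w (?l - 1)" "hd ws = w 0" "nxt (?l - 1) = 0"
        using l0 by (simp_all add: ws_def last_map hd_map nxt_def)
      thus "{last (last ws), hd (hd ws)} \<in> G" using join[of "?l - 1"] l0 by simp
    qed
    then obtain H' where H': "H' \<in> planted_in n (card V) G" "\<Union>(sym_diff H H') = set (concat ws)" by blast
    have cws: "set (concat ws) = (\<Union>i<?l. set (w i))" by (auto simp: ws_def)
    have "used H' = set cs"
    proof
      show "set cs \<subseteq> used H'"
      proof
        fix c assume c: "c \<in> set cs"
        then obtain i where i: "i < ?l" "c = cs ! i" by (auto simp: in_set_conv_nth)
        thus "c \<in> used H'" unfolding used_def H'(2) cws using w[OF i(1)] csN by auto
      qed
      show "used H' \<subseteq> set cs"
      proof
        fix c assume "c \<in> used H'"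
        hence c: "c < N" "mark c \<in> (\<Union>i<?l. set (w i))" unfolding used_def H'(2) cws by auto
        then obtain i where i: "i < ?l" "mark c \<in> B (cs ! i)" using w by blast
        have "mark c \<in> B c" using seg[OF c(1), of 0 0] K by auto
        hence "\<not> separated H (B c) (B (cs ! i))" using i(2) by (auto simp: separated_def)
        hence "c = cs ! i" using sep[OF c(1) csN[OF i(1)]] by blast
        thus "c \<in> set cs" using i(1) by simp
      qed
    qed
    moreover have "card (U - set cs) \<le> 4 * k"
      using cs(1,2,4) by (simp add: card_Diff_subset distinct_card)
    ultimately show ?thesis using H'(1) cs(2) by (intro exI[of _ H']) simp
  qed
  then obtain h where h: "\<And>U. U \<subseteq> {..<N} \<Longrightarrow> h U \<in> planted_in n (card V) G \<and> used (h U) \<subseteq> U \<and> card (U - used (h U)) \<le> 4 * k"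
    by metis
  let ?P = "planted_in n (card V) G" and ?D = "{D. D \<subseteq> {..<N} \<and> card D \<le> 4 * k}"
  have "2 ^ N = card (Pow {..<N})" by (simp add: card_Pow)
  also have "\<dots> \<le> card (?P \<times> ?D)"
  proof (rule card_inj_on_le)
    show "inj_on (\<lambda>U. (h U, U - used (h U))) (Pow {..<N})"
    proof (rule inj_onI)
      fix U U' assume U: "U \<in> Pow {..<N}" "U' \<in> Pow {..<N}" "(h U, U - used (h U)) = (h U', U' - used (h U'))"
      have "U = used (h U) \<union> (U - used (h U))" using h[of U] U by blast
      also have "\<dots> = used (h U') \<union> (U' - used (h U'))"
        using U(3) unfolding prod.inject by (elim conjE) (rule arg_cong2[where f = "(\<union>)", OF arg_cong[where f = used]])
      also have "\<dots> = U'" using h[of U'] U by blast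
      finally show "U = U'" .
    qed
    show "(\<lambda>U. (h U, U - used (h U))) ` Pow {..<N} \<subseteq> ?P \<times> ?D" using h by blast
    show "finite (?P \<times> ?D)" using finite_planted_in by simp
  qed
  finally show ?thesis by (simp add: card_cartesian_product)
qed

section \<open>Random edges between the blocks\<close>

lemma prob_random_subset_avoid:
  assumes "finite A" "0 \<le> p" "p \<le> 1"
  shows "measure_pmf.prob (random_subset A p) {X. X \<inter> Q = {}} = (1 - p) ^ card (Q \<inter> A)"
  using assms(1)
proof (induction A)
  case empty
  show ?case by (simp add: random_subset_def)
next
  case (insert e A)
  have A: "insert e A - {e} = A" using insert(2) by auto
  have split: "measure_pmf.prob (random_subset (insert e A) p) {X. X \<inter> Q = {}} =
      p * measure_pmf.prob (random_subset A p) {X. insert e X \<inter> Q = {}} +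
      (1 - p) * measure_pmf.prob (random_subset A p) {X. X \<inter> Q = {}}"
    using prob_random_subset_split[of "insert e A" e p "{X. X \<inter> Q = {}}"] assms insert(1) A by simp
  show ?case
  proof (cases "e \<in> Q")
    case True
    hence "Q \<inter> insert e A = insert e (Q \<inter> A)" by auto
    moreover have "measure_pmf.prob (random_subset A p) {X. insert e X \<inter> Q = {}} = 0"
      using True by simp
    ultimately show ?thesis unfolding split insert(3) using insert(1,2) by simp
  next
    case False
    hence eq: "{X. insert e X \<inter> Q = {}} = {X. X \<inter> Q = {}}" "Q \<inter> insert e A = Q \<inter> A" by auto
    show ?thesis unfolding split eq insert(3) by (simp add: algebra_simps)
  qed
qed

text \<open>A union bound over at most \<open>4 ^ N\<close> pairs of sets. Each pair offers
  \<open>(k * K)^2\<close> different vertex pairs of an exit and an entry, and all of them have to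
  be missing.\<close>

lemma prob_dense:
  assumes p: "0 \<le> p" "p \<le> 1"
    and range: "\<And>c x. c < N \<Longrightarrow> x < K \<Longrightarrow> en c x \<in> {1..n} \<and> ex c x \<in> {1..n} \<and> en c x \<in> B c \<and> ex c x \<in> B c"
    and disj: "\<And>c d. c < N \<Longrightarrow> d < N \<Longrightarrow> c \<noteq> d \<Longrightarrow> B c \<inter> B d = {}"
    and inj: "\<And>c. c < N \<Longrightarrow> inj_on (en c) {..<K} \<and> inj_on (ex c) {..<K}"
  shows "measure_pmf.prob (random_subset (complete_edges n) p) {F. \<not> (\<forall>A D. A \<subseteq> {..<N} \<longrightarrow> D \<subseteq> {..<N} \<longrightarrow>
      A \<inter> D = {} \<longrightarrow> card A = k \<longrightarrow> card D = k \<longrightarrow> (\<exists>c\<in>A. \<exists>d\<in>D. \<exists>x<K. \<exists>y<K. {ex c y, en d x} \<in> F))}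
    \<le> 4 ^ N * exp (- p * (real k * real K)\<^sup>2)"
proof -
  define I where "I = {(A, D). A \<subseteq> {..<N} \<and> D \<subseteq> {..<N} \<and> A \<inter> D = {} \<and> card A = k \<and> card D = k}"
  define Q where "Q = (\<lambda>(A, D). (\<lambda>(u, v). {u, v}) ` (((\<lambda>(c, y). ex c y) ` (A \<times> {..<K})) \<times> ((\<lambda>(d, x). en d x) ` (D \<times> {..<K}))))"
  let ?M = "measure_pmf (random_subset (complete_edges n) p)"
  have I: "finite I" "card I \<le> 4 ^ N"
  proof -
    have sub: "I \<subseteq> Pow {..<N} \<times> Pow {..<N}" by (auto simp: I_def)
    thus "finite I" by (rule finite_subset) simp
    have "card I \<le> card (Pow {..<N} \<times> Pow {..<N})" using sub by (intro card_mono) auto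
    also have "\<dots> = 4 ^ N" by (simp add: card_cartesian_product card_Pow power_mult_distrib[symmetric])
    finally show "card I \<le> 4 ^ N" .
  qed
  have fin: "finite (complete_edges n)"
    by (rule finite_subset[of _ "Pow {1..n}"]) (auto simp: complete_edges_def)
  have each: "measure ?M {F. F \<inter> Q q = {}} \<le> exp (- p * (real k * real K)\<^sup>2)" if q: "q \<in> I" for q
  proof -
    obtain A D where AD: "q = (A, D)" "A \<subseteq> {..<N}" "D \<subseteq> {..<N}" "A \<inter> D = {}" "card A = k" "card D = k"
      using q by (auto simp: I_def)
    define X where "X = (\<lambda>(c, y). ex c y) ` (A \<times> {..<K})"
    define Y where "Y = (\<lambda>(d, x). en d x) ` (D \<times> {..<K})"
    have Qq: "Q q = (\<lambda>(u, v). {u, v}) ` (X \<times> Y)"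
      unfolding AD(1) Q_def prod.case X_def Y_def by (rule refl)
    have memX: "\<exists>c y. c \<in> A \<and> y < K \<and> z = ex c y" if "z \<in> X" for z using that by (auto simp: X_def)
    have memY: "\<exists>d x. d \<in> D \<and> x < K \<and> z = en d x" if "z \<in> Y" for z using that by (auto simp: Y_def)
    have same: "c = d" if "c < N" "d < N" "z \<in> B c" "z \<in> B d" for c d z using disj that by blast
    have "inj_on (\<lambda>(c, y). ex c y) (A \<times> {..<K})"
    proof (rule inj_onI, clarify)
      fix c y d z assume *: "c \<in> A" "y < K" "d \<in> A" "z < K" "ex c y = ex d z"
      hence "c = d" using same[of c d "ex c y"] range[of c y] range[of d z] AD(2) by auto
      thus "c = d \<and> y = z" using * inj[of c] AD(2) by (auto dest: inj_onD)
    qed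
    hence cX: "card X = k * K" unfolding X_def by (simp add: card_image AD(5) card_cartesian_product)
    have "inj_on (\<lambda>(d, x). en d x) (D \<times> {..<K})"
    proof (rule inj_onI, clarify)
      fix c y d z assume *: "c \<in> D" "y < K" "d \<in> D" "z < K" "en c y = en d z"
      hence "c = d" using same[of c d "en c y"] range[of c y] range[of d z] AD(3) by auto
      thus "c = d \<and> y = z" using * inj[of c] AD(3) by (auto dest: inj_onD)
    qed
    hence cY: "card Y = k * K" unfolding Y_def by (simp add: card_image AD(6) card_cartesian_product)
    have XY: "X \<inter> Y = {}"
    proof (rule ccontr)
      assume "X \<inter> Y \<noteq> {}"
      then obtain z where "z \<in> X" "z \<in> Y" by blast
      then obtain c y d x where *: "c \<in> A" "y < K" "d \<in> D" "x < K" "z = ex c y" "z = en d x" using memX memY by metis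
      have "c = d" using same[of c d z] range[of c y] range[of d x] AD(2,3) * by auto
      thus False using * AD(4) by blast
    qed
    have "inj_on (\<lambda>(u, v). {u, v}) (X \<times> Y)"
    proof (rule inj_onI)
      fix q q' assume q: "q \<in> X \<times> Y" "q' \<in> X \<times> Y" "(\<lambda>(u, v). {u, v}) q = (\<lambda>(u, v). {u, v}) q'"
      have m: "fst q \<in> X" "snd q' \<in> Y" using q(1,2) by (simp_all add: mem_Times_iff)
      have ne: "fst q \<noteq> snd q'"
      proof
        assume "fst q = snd q'"
        hence "fst q \<in> X \<inter> Y" using m by simp
        thus False unfolding XY by simp
      qed
      have "{fst q, snd q} = {fst q', snd q'}" using q(3) by (simp only: case_prod_unfold)
      hence "fst q = fst q' \<and> snd q = snd q'" using ne unfolding doubleton_eq_iff by simp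
      thus "q = q'" by (simp only: prod_eq_iff)
    qed
    hence "card (Q q) = (k * K) * (k * K)"
      unfolding Qq by (simp only: card_image card_cartesian_product cX cY)
    moreover have "Q q \<subseteq> complete_edges n"
    proof
      fix e assume "e \<in> Q q"
      then obtain q' where q': "q' \<in> X \<times> Y" "e = (\<lambda>(u, v). {u, v}) q'"
        unfolding Qq by (elim imageE)
      have uv: "fst q' \<in> X" "snd q' \<in> Y" using q'(1) by (simp_all add: mem_Times_iff)
      have "fst q' \<noteq> snd q'"
      proof
        assume "fst q' = snd q'"
        hence "fst q' \<in> X \<inter> Y" using uv by simp
        thus False unfolding XY by simp
      qed
      moreover obtain c y where "c \<in> A" "y < K" "fst q' = ex c y" using memX[OF uv(1)] by meson
      hence "fst q' \<in> {1..n}" using range[of c y] AD(2) by auto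
      moreover obtain d x where "d \<in> D" "x < K" "snd q' = en d x" using memY[OF uv(2)] by meson
      hence "snd q' \<in> {1..n}" using range[of d x] AD(3) by auto
      ultimately show "e \<in> complete_edges n"
        using q'(2) by (simp add: complete_edges_def case_prod_unfold)
    qed
    hence "Q q \<inter> complete_edges n = Q q" by (rule Int_absorb2)
    ultimately have "measure ?M {F. F \<inter> Q q = {}} = (1 - p) ^ ((k * K) * (k * K))"
      using prob_random_subset_avoid[OF fin p, of "Q q"] by simp
    also have "\<dots> \<le> exp (- p) ^ ((k * K) * (k * K))"
      using p exp_ge_add_one_self[of "- p"] by (intro power_mono) auto
    also have "\<dots> = exp (- p * (real k * real K)\<^sup>2)"
      by (simp add: exp_of_nat_mult[symmetric] power2_eq_square mult_ac)
    finally show ?thesis .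
  qed
  have "{F. \<not> (\<forall>A D. A \<subseteq> {..<N} \<longrightarrow> D \<subseteq> {..<N} \<longrightarrow>
      A \<inter> D = {} \<longrightarrow> card A = k \<longrightarrow> card D = k \<longrightarrow> (\<exists>c\<in>A. \<exists>d\<in>D. \<exists>x<K. \<exists>y<K. {ex c y, en d x} \<in> F))}
      \<subseteq> (\<Union>q\<in>I. {F. F \<inter> Q q = {}})"
  proof
    fix F assume "F \<in> {F. \<not> (\<forall>A D. A \<subseteq> {..<N} \<longrightarrow> D \<subseteq> {..<N} \<longrightarrow>
      A \<inter> D = {} \<longrightarrow> card A = k \<longrightarrow> card D = k \<longrightarrow> (\<exists>c\<in>A. \<exists>d\<in>D. \<exists>x<K. \<exists>y<K. {ex c y, en d x} \<in> F))}"
    then obtain A D where AD: "A \<subseteq> {..<N}" "D \<subseteq> {..<N}" "A \<inter> D = {}" "card A = k" "card D = k"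
      "\<not> (\<exists>c\<in>A. \<exists>d\<in>D. \<exists>x<K. \<exists>y<K. {ex c y, en d x} \<in> F)" by auto
    have "F \<inter> Q (A, D) = {}"
    proof (rule ccontr)
      assume "F \<inter> Q (A, D) \<noteq> {}"
      then obtain e where e: "e \<in> F" "e \<in> Q (A, D)" by blast
      from e(2) obtain c y d x where "c \<in> A" "y < K" "d \<in> D" "x < K" "e = {ex c y, en d x}"
        unfolding Q_def prod.case by auto
      thus False using AD(6) e(1) by metis
    qed
    moreover have "(A, D) \<in> I" using AD by (simp add: I_def)
    ultimately show "F \<in> (\<Union>q\<in>I. {F. F \<inter> Q q = {}})" by (intro UN_I CollectI)
  qed
  hence "measure ?M {F. \<not> (\<forall>A D. A \<subseteq> {..<N} \<longrightarrow> D \<subseteq> {..<N} \<longrightarrow>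
      A \<inter> D = {} \<longrightarrow> card A = k \<longrightarrow> card D = k \<longrightarrow> (\<exists>c\<in>A. \<exists>d\<in>D. \<exists>x<K. \<exists>y<K. {ex c y, en d x} \<in> F))}
      \<le> measure ?M (\<Union>q\<in>I. {F. F \<inter> Q q = {}})"
    by (intro measure_pmf.finite_measure_mono) auto
  also have "\<dots> \<le> (\<Sum>q\<in>I. measure ?M {F. F \<inter> Q q = {}})"
    using I(1) by (intro measure_pmf.finite_measure_subadditive_finite) auto
  also have "\<dots> \<le> (\<Sum>q\<in>I. exp (- p * (real k * real K)\<^sup>2))" using each by (intro sum_mono)
  also have "\<dots> = real (card I) * exp (- p * (real k * real K)\<^sup>2)" by simp
  also have "\<dots> \<le> real (4 ^ N) * exp (- p * (real k * real K)\<^sup>2)"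
    using of_nat_mono[OF I(2), where 'a = real] by (intro mult_right_mono) simp_all
  also have "real (4 ^ N) = 4 ^ N" by simp
  finally show ?thesis .
qed

section \<open>Cutting the path into balanced blocks\<close>

lemma path_edges_cover: "2 \<le> length w \<Longrightarrow> x \<in> set w \<Longrightarrow> \<exists>e\<in>set (path_edges w). x \<in> e"
proof (induction w rule: path_edges.induct)
  case (3 a b r)
  show ?case
  proof (cases "x \<in> {a, b}")
    case True
    thus ?thesis by auto
  next
    case False
    hence "x \<in> set (b # r)" "2 \<le> length (b # r)" using 3(3) by (auto simp: Suc_le_eq)
    thus ?thesis using 3(1) by auto
  qed
qed auto

lemma card_level_class:
  assumes "\<And>i. i < q \<Longrightarrow> f i \<le> (L::nat)" "Suc L * s \<le> q"
  shows "\<exists>b. s \<le> card {i. i < q \<and> f i = b}"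
proof (rule ccontr)
  assume "\<not> ?thesis"
  hence less: "card {i. i < q \<and> f i = b} < s" for b by (auto simp: not_le)
  have "{..<q} = (\<Union>b\<le>L. {i. i < q \<and> f i = b})" using assms(1) by auto
  hence "q = card (\<Union>b\<le>L. {i. i < q \<and> f i = b})" by (metis card_lessThan)
  also have "\<dots> \<le> (\<Sum>b\<le>L. card {i. i < q \<and> f i = b})" by (rule card_UN_le) simp
  also have "\<dots> < (\<Sum>b\<le>L. s)" using less by (intro sum_strict_mono) auto
  also have "\<dots> = Suc L * s" by simp
  finally show False using assms(2) by simp
qed

text \<open>Here \<open>h\<close> is the level along the path and \<open>g\<close> the number of
  vertices of a node: at equal levels, the nodes in between have twice as many vertices as their
  number.\<close>

lemma sum_list_map_upt_telescope:
  fixes g h :: "nat \<Rightarrow> nat"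
  assumes "\<And>i. Suc i < q \<Longrightarrow> h (Suc i) + g (Suc i) = h i + 2" "a \<le> b" "b < q"
  shows "sum_list (map g [Suc a..<Suc b]) + h b = 2 * (b - a) + h a"
  using assms(2,3)
proof (induction b rule: dec_induct)
  case (step b)
  have "[Suc a..<Suc (Suc b)] = [Suc a..<Suc b] @ [Suc b]" using step(1) by simp
  hence "sum_list (map g [Suc a..<Suc (Suc b)]) + h (Suc b) = sum_list (map g [Suc a..<Suc b]) + (h (Suc b) + g (Suc b))"
    by simp
  thus ?case using step assms(1)[of b] by simp
qed simp

context successor_structure
begin

lemma link_segment:
  assumes "link x" "H \<subseteq> G"
  shows "segment V H G (snd x)" "red_count H (snd x) + 1 = length (snd x)"
proof -
  have x: "snd x \<noteq> []" "distinct (snd x)" using assms(1) by (auto simp: link_def)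
  consider (out) v where "snd x = [v]" "v \<notin> V"
    | (inside) "2 \<le> length (snd x)" "set (path_edges (snd x)) \<subseteq> H"
    using assms(1) by (auto simp: link_def length_Suc_conv)
  hence "segment V H G (snd x) \<and> red_count H (snd x) + 1 = length (snd x)"
  proof cases
    case out
    thus ?thesis by (simp add: segment_def red_count_def)
  next
    case inside
    have "filter (\<lambda>e. e \<in> H) (path_edges (snd x)) = path_edges (snd x)"
      using inside(2) by (intro filter_True) auto
    hence "red_count H (snd x) + 1 = length (snd x)"
      using inside(1) by (simp add: red_count_def length_path_edges)
    moreover have "set (path_edges (snd x)) \<inter> H = set (path_edges (snd x))" using inside(2) by (rule Int_absorb2)
    ultimately show ?thesis
      using x inside assms(2) path_edges_cover[OF inside(1)] by (auto simp: segment_def)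
  qed
  thus "segment V H G (snd x)" "red_count H (snd x) + 1 = length (snd x)" by auto
qed

text \<open>The heads of the groups, from the bottom up, form the path; the remaining alternatives
  are dropped.\<close>

lemma stack_chain:
  assumes "stack E gs"
  defines "ns \<equiv> rev (map hd gs)"
  shows "(\<forall>x\<in>set ns. link x) \<and> sorted_wrt (\<lambda>x y. separated H (set (snd x)) (set (snd y))) ns \<and>
    successively (joined E) ns"
  using assms(1) unfolding ns_def
proof (induction gs)
  case (Cons g gs)
  have g: "hd g \<in> set g" "link (hd g)" using Cons.prems by auto
  have ih: "\<forall>x\<in>set (rev (map hd gs)). link x"
     "sorted_wrt (\<lambda>x y. separated H (set (snd x)) (set (snd y))) (rev (map hd gs))"
     "successively (joined E) (rev (map hd gs))" using Cons by auto
  have hdc: "hd g' \<in> set (concat gs)" if "g' \<in> set gs" for g'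
  proof -
    have "stack E gs" using Cons.prems by simp
    hence "g' \<noteq> []" using that by (induction gs) auto
    hence "hd g' \<in> set g'" by simp
    thus ?thesis using that by auto
  qed
  have sep: "separated H (set (snd y)) (set (snd (hd g)))" if "y \<in> set (rev (map hd gs))" for y
    using Cons.prems g(1) hdc that by (auto simp del: set_concat)
  have jn: "joined E (last (rev (map hd gs))) (hd g)" if "gs \<noteq> []"
    using Cons.prems g(1) that by (auto simp: last_rev hd_map)
  show ?case
    using g(2) ih sep jn by (auto simp: sorted_wrt_append successively_append_iff simp del: successively_rev)
qed simp

text \<open>By pigeonhole some level occurs at \<open>2 * K * N\<close> nodes. Each run of
  \<open>2 * K\<close> consecutive ones cuts out a block: the first \<open>K\<close> cuts serve as
  entries, the last \<open>K\<close> as exits. Every entry thus precedes every exit, and the part in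
  between is balanced.\<close>

lemma many_planted_from_stack:
  assumes st: "stack E gs" and len: "Suc L * (2 * K * N) \<le> length gs"
    and p: "0 \<le> p" "p \<le> 1" and reg: "two_regular V H" and K: "1 \<le> K" and k: "1 \<le> k"
  shows "measure_pmf.prob (random_subset (complete_edges n) p)
      {F. \<not> 2 ^ N \<le> card (planted_in n (card V) (H \<union> E \<union> F)) * card {D. D \<subseteq> {..<N} \<and> card D \<le> 4 * k}}
    \<le> 4 ^ N * exp (- p * (real k * real K)\<^sup>2)"
proof -
  define ns where "ns = rev (map hd gs)"
  define P where "P = (\<lambda>i. snd (ns ! i))"
  define h where "h = (\<lambda>i. fst (ns ! i))"
  define q where "q = length gs"
  have chain: "\<forall>x\<in>set ns. link x" "sorted_wrt (\<lambda>x y. separated H (set (snd x)) (set (snd y))) ns"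
     "successively (joined E) ns" using stack_chain[OF st] by (auto simp: ns_def)
  have lns: "length ns = q" by (simp add: ns_def q_def)
  have lk: "link (ns ! i)" if "i < q" for i using chain(1) lns that by auto
  have P: "P i \<noteq> []" "set (P i) \<subseteq> {1..n}" if "i < q" for i using lk[OF that] by (auto simp: link_def P_def)
  have sepP: "separated H (set (P i)) (set (P j))" if "i < j" "j < q" for i j
    using chain(2) that lns by (auto simp: sorted_wrt_iff_nth_less P_def)
  have sepP': "separated H (set (P i)) (set (P j))" if "i \<noteq> j" "i < q" "j < q" for i j
    using that sepP[of i j] separated_sym[OF sepP[of j i]] by (cases "i < j") auto
  have disjP: "set (P i) \<inter> set (P j) = {}" if "i \<noteq> j" "i < q" "j < q" for i j
    using separatedD(1)[OF sepP'[OF that]] .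
  have jn: "{last (P i), hd (P (Suc i))} \<in> E" "h (Suc i) + length (P (Suc i)) = h i + 2" if "Suc i < q" for i
    using successively_nth[OF chain(3), of i] that lns by (auto simp: joined_def P_def h_def)
  have "h i \<le> L" if "i < q" for i using lk[OF that] by (simp add: link_def h_def)
  from card_level_class[of q h L, OF this] len obtain b where b: "2 * K * N \<le> card {i. i < q \<and> h i = b}"
    by (auto simp: q_def)
  define I where "I = {i. i < q \<and> h i = b}"
  define \<iota> where "\<iota> = (\<lambda>j. sorted_list_of_set I ! j)"
  have finI: "finite I" by (simp add: I_def)
  have lI: "length (sorted_list_of_set I) = card I" by simp
  have inc: "\<iota> i < \<iota> j" if "i < j" "j < 2 * K * N" for i j
    using strict_sorted_list_of_set[of I] that b lI
    by (auto simp: sorted_wrt_iff_nth_less \<iota>_def I_def)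
  have mem: "\<iota> j < q" "h (\<iota> j) = b" if "j < 2 * K * N" for j
  proof -
    have "\<iota> j \<in> I" using nth_mem[of j "sorted_list_of_set I"] that b lI finI by (auto simp: \<iota>_def I_def)
    thus "\<iota> j < q" "h (\<iota> j) = b" by (auto simp: I_def)
  qed
  define a where "a = (\<lambda>c x. \<iota> (2 * K * c + x))"
  have idx: "2 * K * c + x < 2 * K * N" if "c < N" "x < 2 * K" for c x
  proof -
    have "2 * K * c + x < 2 * K * Suc c" using that(2) by simp
    also have "\<dots> \<le> 2 * K * N" using that(1) by (intro mult_le_mono2) simp
    finally show ?thesis .
  qed
  have a_q: "a c x < q" "h (a c x) = b" if "c < N" "x < 2 * K" for c x
    using mem[OF idx[OF that]] by (simp_all add: a_def)
  have a_less: "a c x < a c y" if "c < N" "x < y" "y < 2 * K" for c x y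
    unfolding a_def using that by (intro inc idx) auto
  have a_chunk: "a c x < a d y" if "c < d" "d < N" "x < 2 * K" "y < 2 * K" for c d x y
  proof -
    have "2 * K * c + x < 2 * K * Suc c" using that(3) by simp
    also have "\<dots> \<le> 2 * K * d" using that(1) by (intro mult_le_mono2) simp
    finally show ?thesis unfolding a_def using that by (intro inc idx) auto
  qed
  \<comment> \<open>The segment begins with the node after the entry cut and ends with the node at
    the exit cut. So the number of its nodes is the difference of the two positions, as the
    telescoping sum requires.\<close>
  define S where "S = (\<lambda>c x y. concat (map P [Suc (a c x)..<Suc (a c (K + y))]))"
  define B where "B = (\<lambda>c. \<Union>i\<in>{a c 0<..a c (2 * K - 1)}. set (P i))"
  define en where "en = (\<lambda>c x. hd (P (Suc (a c x))))"
  define ex where "ex = (\<lambda>c y. last (P (a c (K + y))))"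
  \<comment> \<open>The node at the first exit cut lies behind all entries and not behind any exit,
    so every segment of the block contains it.\<close>
  define mark where "mark = (\<lambda>c. hd (P (a c K)))"
  have inB: "set (P i) \<subseteq> B c" if "c < N" "a c x < i" "i \<le> a c z" "x < 2 * K" "z < 2 * K" for c x z i
  proof -
    have "a c 0 \<le> a c x" using a_less[OF that(1), of 0 x] that(4) by (cases "x = 0") auto
    moreover have "a c z \<le> a c (2 * K - 1)"
    proof (cases "z = 2 * K - 1")
      case False
      hence "z < 2 * K - 1" "2 * K - 1 < 2 * K" using that(5) by linarith+
      from a_less[OF that(1) this] show ?thesis by simp
    qed simp
    ultimately have "i \<in> {a c 0<..a c (2 * K - 1)}" using that(2,3) by simp
    thus ?thesis unfolding B_def by (rule UN_upper)
  qed
  have sepB0: "separated H (B c) (B d)" if cd: "c < d" "d < N" for c d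
  proof -
    have s: "separated H (set (P i)) (set (P j))"
      if "i \<in> {a c 0<..a c (2 * K - 1)}" "j \<in> {a d 0<..a d (2 * K - 1)}" for i j
    proof (rule sepP)
      have "a c (2 * K - 1) < a d 0" using a_chunk[OF cd, of "2 * K - 1" 0] K by simp
      thus "i < j" using that by simp
      have "a d (2 * K - 1) < q" using a_q(1)[OF cd(2), of "2 * K - 1"] K by simp
      thus "j < q" using that by simp
    qed
    have "separated H (set (P i)) (B d)" if "i \<in> {a c 0<..a c (2 * K - 1)}" for i
      unfolding B_def by (rule separated_Union) (use s that in auto)
    hence "separated H (B d) (set (P i))" if "i \<in> {a c 0<..a c (2 * K - 1)}" for i
      using that separated_sym by simp
    hence "separated H (B d) (\<Union>i\<in>{a c 0<..a c (2 * K - 1)}. set (P i))" by (intro separated_Union) auto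
    hence "separated H (B d) (B c)" by (simp only: B_def)
    thus ?thesis by (rule separated_sym)
  qed
  have sepB: "separated H (B c) (B d)" if "c < N" "d < N" "c \<noteq> d" for c d
    using that sepB0[of c d] separated_sym[OF sepB0[of d c]] by (cases "c < d") auto
  have seg: "segment V H G (S c x y) \<and> 2 * red_count H (S c x y) = length (S c x y) \<and>
      set (S c x y) \<subseteq> {1..n} \<and> set (S c x y) \<subseteq> B c \<and> hd (S c x y) = en c x \<and>
      last (S c x y) = ex c y \<and> mark c \<in> set (S c x y)"
    if c: "c < N" "x < K" "y < K" and G: "H \<subseteq> G" "E \<subseteq> G" for c x y G
  proof -
    let ?i = "a c x" and ?j = "a c (K + y)"
    have ij: "?i < ?j" "?j < q" using a_less[OF c(1), of x "K + y"] a_q(1)[OF c(1), of "K + y"] c by auto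
    define ws where "ws = map P [Suc ?i..<Suc ?j]"
    have ne: "ws \<noteq> []" using ij by (simp add: ws_def)
    have "\<forall>w\<in>set ws. segment V H G w"
      using link_segment(1)[OF lk G(1)] ij(2) by (auto simp: ws_def P_def)
    moreover have "sorted_wrt (\<lambda>u w. separated H (set u) (set w)) ws"
      unfolding ws_def sorted_wrt_map
      by (rule sorted_wrt_mono_rel[OF _ sorted_wrt_upt]) (use sepP ij(2) in auto)
    moreover have "successively (\<lambda>u w. {last u, hd w} \<in> G) ws"
      unfolding ws_def successively_map successively_conv_nth
      using jn(1) G(2) ij(2) by (auto simp del: upt_Suc)
    ultimately have sc: "segment V H G (S c x y)" "red_count H (S c x y) = sum_list (map (red_count H) ws)"
       "hd (S c x y) = hd (hd ws)" "last (S c x y) = last (last ws)"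
      using segment_concat[OF ne, of V H G] by (auto simp: S_def ws_def)
    have "hd ws = P (Suc ?i)" "last ws = P ?j" using ij(1) by (simp_all add: ws_def hd_map last_map del: upt_Suc)
    hence ends: "hd (S c x y) = en c x" "last (S c x y) = ex c y" using sc by (simp_all add: en_def ex_def)
    have tel: "sum_list (map (\<lambda>i. length (P i)) [Suc ?i..<Suc ?j]) + h ?j = 2 * (?j - ?i) + h ?i"
      using jn(2) ij by (intro sum_list_map_upt_telescope[where q = q]) auto
    have lS: "length (S c x y) = 2 * (?j - ?i)"
      using tel a_q(2)[OF c(1), of x] a_q(2)[OF c(1), of "K + y"] c
      by (simp add: S_def length_concat o_def del: upt_Suc)
    have "sum_list (map (\<lambda>i. red_count H (P i) + 1) [Suc ?i..<Suc ?j]) = sum_list (map (\<lambda>i. length (P i)) [Suc ?i..<Suc ?j])"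
      using link_segment(2)[OF lk G(1)] ij(2) by (intro arg_cong[where f = sum_list] map_cong) (auto simp: P_def)
    hence "red_count H (S c x y) + (?j - ?i) = length (S c x y)"
      unfolding sc(2) by (simp add: ws_def S_def length_concat o_def sum_list_Suc del: upt_Suc)
    hence red: "2 * red_count H (S c x y) = length (S c x y)" using lS by simp
    have "{Suc ?i..<Suc ?j} = {?i<..?j}" by auto
    hence setS: "set (S c x y) = (\<Union>i\<in>{?i<..?j}. set (P i))" by (simp add: S_def del: upt_Suc)
    have "set (S c x y) \<subseteq> {1..n}"
      unfolding setS by (rule UN_least, rule P(2)) (use ij(2) in auto)
    moreover have "set (S c x y) \<subseteq> B c"
      unfolding setS using inB[OF c(1), of x _ "K + y"] c by (intro UN_least) auto
    moreover have "mark c \<in> set (S c x y)"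
    proof -
      have 1: "?i < a c K" using a_less[OF c(1), of x K] c by simp
      moreover have 2: "a c K \<le> ?j" using a_less[OF c(1), of K "K + y"] c by (cases "y = 0") auto
      ultimately have "P (a c K) \<noteq> []" using P(1) ij(2) by simp
      hence "mark c \<in> set (P (a c K))" by (simp add: mark_def)
      thus ?thesis unfolding setS using 1 2 by auto
    qed
    ultimately show ?thesis using sc(1) red ends by simp
  qed
  let ?dense = "\<lambda>F. \<forall>A D. A \<subseteq> {..<N} \<longrightarrow> D \<subseteq> {..<N} \<longrightarrow>
      A \<inter> D = {} \<longrightarrow> card A = k \<longrightarrow> card D = k \<longrightarrow> (\<exists>c\<in>A. \<exists>d\<in>D. \<exists>x<K. \<exists>y<K. {ex c y, en d x} \<in> F)"
  have "{F. \<not> 2 ^ N \<le> card (planted_in n (card V) (H \<union> E \<union> F)) * card {D. D \<subseteq> {..<N} \<and> card D \<le> 4 * k}}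
      \<subseteq> {F. \<not> ?dense F}"
  proof (rule Collect_mono, rule impI, erule contrapos_nn)
    fix F assume d: "?dense F"
    show "2 ^ N \<le> card (planted_in n (card V) (H \<union> E \<union> F)) * card {D. D \<subseteq> {..<N} \<and> card D \<le> 4 * k}"
    proof (rule many_planted[OF reg V_sub _ _ seg sepB _ k K])
      show "\<exists>c\<in>A. \<exists>d\<in>D. \<exists>x<K. \<exists>y<K. {ex c y, en d x} \<in> F"
        if "A \<subseteq> {..<N}" "D \<subseteq> {..<N}" "A \<inter> D = {}" "card A = k" "card D = k" for A D
        using d that by simp
    qed auto
  qed
  hence "measure_pmf.prob (random_subset (complete_edges n) p)
      {F. \<not> 2 ^ N \<le> card (planted_in n (card V) (H \<union> E \<union> F)) * card {D. D \<subseteq> {..<N} \<and> card D \<le> 4 * k}}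
    \<le> measure_pmf.prob (random_subset (complete_edges n) p) {F. \<not> ?dense F}"
    by (intro measure_pmf.finite_measure_mono) auto
  also have "\<dots> \<le> 4 ^ N * exp (- p * (real k * real K)\<^sup>2)"
  proof (rule prob_dense[OF p])
    fix c x assume c: "c < N" "x < K"
    have s: "Suc (a c x) \<le> a c (K + x)" using a_less[OF c(1), of x "K + x"] c by simp
    have q1: "Suc (a c x) < q" "a c (K + x) < q"
      using s a_less[OF c(1), of x "x + 1"] a_q(1)[OF c(1), of "x + 1"] a_q(1)[OF c(1), of "K + x"] c by auto
    have "en c x \<in> set (P (Suc (a c x)))" "ex c x \<in> set (P (a c (K + x)))"
      using P(1)[OF q1(1)] P(1)[OF q1(2)] by (simp_all add: en_def ex_def)
    moreover have "set (P (Suc (a c x))) \<subseteq> B c" "set (P (a c (K + x))) \<subseteq> B c"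
      using inB[OF c(1), of x _ "K + x"] c s by simp_all
    ultimately show "en c x \<in> {1..n} \<and> ex c x \<in> {1..n} \<and> en c x \<in> B c \<and> ex c x \<in> B c"
      using P(2)[OF q1(1)] P(2)[OF q1(2)] by blast
  next
    fix c d assume "c < N" "d < N" "c \<noteq> d"
    thus "B c \<inter> B d = {}" using separatedD(1)[OF sepB] by simp
  next
    fix c assume c: "c < N"
    have "en c x \<noteq> en c y" if "x < y" "y < K" for x y
    proof -
      have l: "a c x < a c y" "Suc (a c y) \<le> a c (K + y)" using a_less[OF c, of x y] a_less[OF c, of y "K + y"] that by auto
      hence q1: "Suc (a c y) < q" "Suc (a c x) < q"
        using a_less[OF c, of y "Suc y"] a_q(1)[OF c, of "Suc y"] that by auto
      have "set (P (Suc (a c x))) \<inter> set (P (Suc (a c y))) = {}" by (rule disjP) (use l q1 in auto)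
      moreover have "en c x \<in> set (P (Suc (a c x)))" "en c y \<in> set (P (Suc (a c y)))"
        using P(1)[OF q1(1)] P(1)[OF q1(2)] by (simp_all add: en_def)
      ultimately show ?thesis by auto
    qed
    hence "inj_on (en c) {..<K}" by (intro linorder_inj_onI) auto
    moreover have "ex c x \<noteq> ex c y" if "x < y" "y < K" for x y
    proof -
      have l: "a c (K + x) < a c (K + y)" "a c (K + y) < q"
        using a_less[OF c, of "K + x" "K + y"] a_q(1)[OF c, of "K + y"] that by auto
      have "set (P (a c (K + x))) \<inter> set (P (a c (K + y))) = {}" by (rule disjP) (use l in auto)
      moreover have "ex c x \<in> set (P (a c (K + x)))" "ex c y \<in> set (P (a c (K + y)))"
        using P(1)[of "a c (K + x)"] P(1)[of "a c (K + y)"] l by (simp_all add: ex_def)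
      ultimately show ?thesis by auto
    qed
    hence "inj_on (ex c) {..<K}" by (intro linorder_inj_onI) auto
    ultimately show "inj_on (en c) {..<K} \<and> inj_on (ex c) {..<K}" by simp
  qed
  finally show ?thesis .
qed

end

section \<open>Parameters of the exploration\<close>

text \<open>Let \<open>x = \<tau> * g\<close>. The first-order terms add up to at most
  \<open>- (1 - \<alpha>) * p * x\<close>, the second-order terms to at most
  \<open>3 / 2 * p * x^2\<close>, and the bound on \<open>\<tau>\<close> lets the former
  win.\<close>

lemma exp_drift:
  fixes p g \<tau> \<alpha> :: real
  assumes "0 \<le> p" "p \<le> 1" "0 \<le> g" "0 < \<tau>" "0 < \<alpha>" "\<alpha> < 1" "3 * \<tau> * g \<le> 2 * (1 - \<alpha>)"
  shows "p * exp (- \<tau> * g) + (1 - p) * exp (\<tau> * (\<alpha> * p * g)) \<le> 1"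
proof -
  define x where "x = \<tau> * g"
  have x: "0 \<le> x" "3 * x \<le> 2 * (1 - \<alpha>)" using assms by (auto simp: x_def)
  have "\<alpha> * p * x \<le> 1 * 1 * (2 / 3)" using assms x by (intro mult_mono) auto
  hence u: "0 \<le> \<alpha> * p * x" "\<alpha> * p * x \<le> 1" using assms x by auto
  have 1: "exp (- x) \<le> 1 - x + x\<^sup>2 / 2"
  proof -
    have "1 + x + x\<^sup>2 / 2 \<le> exp x" using exp_lower_Taylor_quadratic[OF x(1)] .
    hence "exp (- x) * (1 + x + x\<^sup>2 / 2) \<le> exp (- x) * exp x" by (intro mult_left_mono) auto
    also have "\<dots> = 1" by (simp flip: exp_add)
    also have "1 \<le> (1 - x + x\<^sup>2 / 2) * (1 + x + x\<^sup>2 / 2)"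
    proof -
      have "(1 - x + x\<^sup>2 / 2) * (1 + x + x\<^sup>2 / 2) = 1 + (x\<^sup>2)\<^sup>2 / 4" by (simp add: algebra_simps power2_eq_square)
      thus ?thesis by simp
    qed
    finally have "exp (- x) * (1 + x + x\<^sup>2 / 2) \<le> (1 - x + x\<^sup>2 / 2) * (1 + x + x\<^sup>2 / 2)" .
    moreover have "1 + x + x\<^sup>2 / 2 > 0" using x(1) by (simp add: add_pos_nonneg)
    ultimately show ?thesis by (rule mult_right_le_imp_le)
  qed
  have 2: "exp (\<alpha> * p * x) \<le> 1 + \<alpha> * p * x + (\<alpha> * p * x)\<^sup>2" by (rule exp_bound[OF u])
  have "p * exp (- x) + (1 - p) * exp (\<alpha> * p * x) \<le>
      p * (1 - x + x\<^sup>2 / 2) + (1 - p) * (1 + \<alpha> * p * x + (\<alpha> * p * x)\<^sup>2)"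
    using 1 2 assms by (intro add_mono mult_left_mono) auto
  also have "\<dots> \<le> p * (1 - x + x\<^sup>2 / 2) + ((1 - p) + \<alpha> * p * x + (\<alpha> * p * x)\<^sup>2)"
  proof -
    have "(1 - p) * (\<alpha> * p * x + (\<alpha> * p * x)\<^sup>2) \<le> 1 * (\<alpha> * p * x + (\<alpha> * p * x)\<^sup>2)"
      using assms u by (intro mult_right_mono) auto
    thus ?thesis by (simp add: algebra_simps)
  qed
  also have "(\<alpha> * p * x)\<^sup>2 \<le> p * x\<^sup>2"
  proof -
    have "\<alpha>\<^sup>2 * p \<le> 1 * 1" using assms by (intro mult_mono power_le_one) auto
    hence "(\<alpha>\<^sup>2 * p) * (p * x\<^sup>2) \<le> 1 * (p * x\<^sup>2)" using assms by (intro mult_right_mono) auto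
    thus ?thesis by (simp add: power2_eq_square mult_ac)
  qed
  also have "p * (1 - x + x\<^sup>2 / 2) + ((1 - p) + \<alpha> * p * x + p * x\<^sup>2) =
      1 - p * x * ((1 - \<alpha>) - 3 * x / 2)"
    by (simp add: algebra_simps power2_eq_square)
  also have "\<dots> \<le> 1" using assms x by simp
  finally show ?thesis by (simp add: x_def mult_ac)
qed

section \<open>Total gain of the targets\<close>

context successor_structure
begin

lemma gain_inside: "v \<in> V \<Longrightarrow> gain b v = 2 * (\<Sum>c\<le>b. \<phi> c)"
proof -
  assume v: "v \<in> V"
  have rev: "sum_list (map (\<lambda>i. \<phi> (b - i)) [0..<Suc b]) = (\<Sum>c\<le>b. \<phi> c)"
  proof -
    have "sum_list (map (\<lambda>i. \<phi> (b - i)) [0..<Suc b]) = (\<Sum>i\<in>{0..<Suc b}. \<phi> (b - i))"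
      by (subst sum_list_distinct_conv_sum_set) (simp_all del: upt_Suc)
    also have "\<dots> = (\<Sum>i\<le>b. \<phi> (b - i))" by (simp only: atLeast0LessThan lessThan_Suc_atMost)
    also have "\<dots> = (\<Sum>c\<le>b. \<phi> c)"
      by (rule sum.reindex_bij_witness[where i = "\<lambda>i. b - i" and j = "\<lambda>i. b - i"]) auto
    finally show ?thesis .
  qed
  show ?thesis using v rev
    by (simp add: gain_def weight_def children_def o_def del: upt_Suc)
qed

lemma gain_outside: "v \<notin> V \<Longrightarrow> gain b v = \<phi> (Suc b)"
  by (simp add: gain_def weight_def children_def)

lemma inj_nx_pow: "inj_on (nx ^^ d) V" and inj_pv_pow: "inj_on (pv ^^ d) V"
  by (rule inj_on_inverseI[of _ "pv ^^ d"], rule pv_nx_pow, assumption)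
    (rule inj_on_inverseI[of _ "nx ^^ d"], rule nx_pv_pow, assumption)

text \<open>A planted vertex is lost only if it is not good, or if it or one of the
  \<open>L + 3\<close> forward or \<open>L + 3\<close> backward iterates (step 0 included) has been
  used. As the iterates are injective, one used vertex spoils at most \<open>2 * L + 7\<close>
  others.\<close>

lemma card_inside_targets:
  assumes "T \<subseteq> {1..n}"
  shows "real (card V) - real (card (V - good)) - (2 * real L + 7) * (real n - real (card T))
    \<le> real (card (targets b T \<inter> V))"
proof -
  have finV: "finite V" and finT: "finite T" using V_sub assms finite_subset[OF _ finite_atLeastAtMost[of 1 n]] by auto
  let ?C = "{1..n} - T"
  have cC: "card ?C = n - card T" using assms finT by (simp add: card_Diff_subset)
  have cT: "card T \<le> n" using card_mono[OF _ assms] by simp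
  define W where "W = (V \<inter> ?C) \<union> (\<Union>d\<le>L + 2. {v \<in> V. (nx ^^ d) v \<in> ?C}) \<union> (\<Union>d\<le>L + 2. {v \<in> V. (pv ^^ d) v \<in> ?C})"
  have sub: "V \<subseteq> (targets b T \<inter> V) \<union> (V - good) \<union> W"
  proof
    fix v assume v: "v \<in> V"
    show "v \<in> (targets b T \<inter> V) \<union> (V - good) \<union> W"
    proof (rule ccontr)
      assume "\<not> ?thesis"
      hence n: "v \<notin> targets b T" "v \<in> good" "v \<notin> W" using v by auto
      have "v \<in> T" using n(3) v V_sub unfolding W_def by blast
      have "(nx ^^ d) v \<in> T" "(pv ^^ d) v \<in> T" if "d \<le> L + 2" for d
      proof -
        have "(nx ^^ d) v \<in> {1..n}" "(pv ^^ d) v \<in> {1..n}" using nx_pow_V pv_pow_V v V_sub by blast+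
        thus "(nx ^^ d) v \<in> T" "(pv ^^ d) v \<in> T" using n(3) v that unfolding W_def by auto
      qed
      hence "interval v \<subseteq> T" unfolding interval_def by auto
      thus False using n(1,2) v \<open>v \<in> T\<close> by (simp add: targets_def)
    qed
  qed
  have c1: "card {v \<in> V. (f ^^ d) v \<in> ?C} \<le> card ?C" if "inj_on (f ^^ d) V" for f :: "nat \<Rightarrow> nat" and d
    by (rule card_inj_on_le[of "f ^^ d"]) (auto intro: inj_on_subset[OF that])
  have cW: "card W \<le> (2 * L + 7) * card ?C"
  proof -
    have sumC: "(\<Sum>d\<le>L + 2. card ?C) = (L + 3) * card ?C" by (simp add: algebra_simps)
    have "card (\<Union>d\<le>L + 2. {v \<in> V. (nx ^^ d) v \<in> ?C}) \<le> (L + 3) * card ?C"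
      unfolding sumC[symmetric]
      by (rule order.trans[OF card_UN_le sum_mono]) (rule finite_atMost, rule c1[OF inj_nx_pow])
    moreover have "card (\<Union>d\<le>L + 2. {v \<in> V. (pv ^^ d) v \<in> ?C}) \<le> (L + 3) * card ?C"
      unfolding sumC[symmetric]
      by (rule order.trans[OF card_UN_le sum_mono]) (rule finite_atMost, rule c1[OF inj_pv_pow])
    moreover have "card (V \<inter> ?C) \<le> card ?C" by (intro card_mono) auto
    moreover have "card W \<le> card (V \<inter> ?C) + card (\<Union>d\<le>L + 2. {v \<in> V. (nx ^^ d) v \<in> ?C}) + card (\<Union>d\<le>L + 2. {v \<in> V. (pv ^^ d) v \<in> ?C})"
      unfolding W_def by (intro order.trans[OF card_Un_le] add_mono order.refl)
    ultimately have "card W \<le> card ?C + (L + 3) * card ?C + (L + 3) * card ?C" by linarith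
    thus ?thesis by (simp add: algebra_simps)
  qed
  have finW: "finite W" using finV by (auto simp: W_def)
  have "card V \<le> card ((targets b T \<inter> V) \<union> (V - good) \<union> W)"
    using sub finV finW by (intro card_mono) auto
  also have "\<dots> \<le> card (targets b T \<inter> V) + card (V - good) + card W"
    by (intro order.trans[OF card_Un_le] add_mono order.refl)
  also have "\<dots> \<le> card (targets b T \<inter> V) + card (V - good) + (2 * L + 7) * (n - card T)" using cW cC by simp
  finally have "real (card V) \<le> real (card (targets b T \<inter> V) + card (V - good) + (2 * L + 7) * (n - card T))"
    by (rule of_nat_mono)
  hence "real (card V) \<le> real (card (targets b T \<inter> V)) + real (card (V - good)) +
      real (2 * L + 7) * (real n - real (card T))"
    by (simp only: of_nat_add[of "_ + _"] of_nat_add[of "card _"] of_nat_mult[of "2 * L + 7"] of_nat_diff[OF cT])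
  thus ?thesis by simp
qed

text \<open>At the top level outside vertices are not targets, but \<open>\<phi> (Suc L) = 0\<close>
  lets the same formula hold there.\<close>

lemma sum_gain_ge:
  assumes T: "T \<subseteq> {1..n}" and b: "b \<le> L" and last: "\<phi> (Suc L) = 0"
    and inside: "x \<le> real (card V) - real (card (V - good)) - (2 * real L + 7) * (real n - real (card T))"
    and outside: "y \<le> real (card T) - real (card V)"
  shows "x * (2 * (\<Sum>c\<le>b. \<phi> c)) + y * \<phi> (Suc b) \<le> (\<Sum>v\<in>targets b T. gain b v)"
proof -
  have fin: "finite T" "finite V" using T V_sub finite_subset[OF _ finite_atLeastAtMost[of 1 n]] by auto
  hence fint: "finite (targets b T)" by (auto simp: targets_def)
  have "(\<Sum>v\<in>targets b T. gain b v) = (\<Sum>v\<in>targets b T \<inter> V. gain b v) + (\<Sum>v\<in>targets b T - V. gain b v)"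
    using fint by (subst sum.union_disjoint[symmetric]) (auto simp: Int_Diff_Un)
  also have "(\<Sum>v\<in>targets b T \<inter> V. gain b v) = real (card (targets b T \<inter> V)) * (2 * (\<Sum>c\<le>b. \<phi> c))"
    by (simp add: gain_inside)
  also have "(\<Sum>v\<in>targets b T - V. gain b v) = real (card (targets b T - V)) * \<phi> (Suc b)"
    by (simp add: gain_outside)
  finally have eq: "(\<Sum>v\<in>targets b T. gain b v) = real (card (targets b T \<inter> V)) * (2 * (\<Sum>c\<le>b. \<phi> c)) +
      real (card (targets b T - V)) * \<phi> (Suc b)" .
  have pos: "0 \<le> (\<Sum>c\<le>b. \<phi> c)" using weight_pos b by (intro sum_nonneg) (auto intro: less_imp_le)
  have 1: "x * (2 * (\<Sum>c\<le>b. \<phi> c)) \<le> real (card (targets b T \<inter> V)) * (2 * (\<Sum>c\<le>b. \<phi> c))"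
    using card_inside_targets[OF T, of b] inside pos by (intro mult_right_mono) auto
  have 2: "y * \<phi> (Suc b) \<le> real (card (targets b T - V)) * \<phi> (Suc b)"
  proof (cases "b = L")
    case True
    thus ?thesis using last by simp
  next
    case False
    hence "targets b T - V = T - V" using b by (auto simp: targets_def)
    moreover have "card T - card V \<le> card (T - V)" using diff_card_le_card_Diff fin by blast
    ultimately have "card T \<le> card (targets b T - V) + card V" by simp
    hence "real (card T) \<le> real (card (targets b T - V) + card V)" by (rule of_nat_mono)
    hence "y \<le> real (card (targets b T - V))" using outside by simp
    thus ?thesis using weight_pos[of "Suc b"] False b by (intro mult_right_mono) auto
  qed
  show ?thesis using 1 2 eq by linarith
qed

end

lemma successor_structure_exists:
  assumes "two_regular V H" "V \<subseteq> {1..n}" "\<And>b. b \<le> L \<Longrightarrow> \<phi> b > 0"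
    and few: "\<And>j. 1 \<le> j \<Longrightarrow> j \<le> 2 * (L + 2) \<Longrightarrow> H \<notin> many_components j k V"
  obtains nx pv where "successor_structure n V H nx pv L \<phi>"
    "card (V - successor_structure.good V nx L) \<le> (2 * (L + 2)) * (2 * (L + 2)) * k"
proof -
  obtain nx where nx: "bij_betw nx V V" "H = (\<lambda>v. {v, nx v}) ` V" using two_regular_successor[OF assms(1)] by metis
  define pv where "pv = inv_into V nx"
  have inv: "pv v \<in> V" "nx (pv v) = v" "pv (nx v) = v" "nx v \<in> V" if "v \<in> V" for v
    using that nx(1) bij_betw_inv_into_left[OF nx(1)] bij_betw_inv_into_right[OF nx(1)]
      bij_betw_apply[OF bij_betw_inv_into[OF nx(1)]] bij_betw_apply[OF nx(1)] by (auto simp: pv_def)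
  have ss: "successor_structure n V H nx pv L \<phi>"
    by unfold_locales (use assms(2,3) nx(2) inv in auto)
  have "V - successor_structure.good V nx L = {v \<in> V. \<exists>d\<in>{1..2 * (L + 2)}. (nx ^^ d) v = v}"
    unfolding successor_structure.good_def[OF ss] by blast
  moreover have "card {v \<in> V. \<exists>d\<in>{1..2 * (L + 2)}. (nx ^^ d) v = v} \<le> (2 * (L + 2)) * (2 * (L + 2)) * k"
    by (rule few_short_cycle_vertices[OF assms(1) nx]) (use few in blast)
  ultimately show ?thesis using that ss by metis
qed

lemma prob_bind_le_except:
  assumes "\<And>x. x \<in> set_pmf M \<Longrightarrow> x \<notin> B \<Longrightarrow> measure_pmf.prob (f x) S \<le> c" "0 \<le> c"
  shows "measure_pmf.prob (bind_pmf M f) S \<le> measure_pmf.prob M B + c"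
proof -
  have "measure_pmf.prob (bind_pmf M f) S = (\<integral>x. measure_pmf.prob (f x) S \<partial>measure_pmf M)"
    by (rule prob_bind_pmf)
  also have "\<dots> \<le> (\<integral>x. indicat_real B x + c \<partial>measure_pmf M)"
  proof (rule integral_mono_AE)
    show "integrable (measure_pmf M) (\<lambda>x. measure_pmf.prob (f x) S)"
      by (rule measure_pmf.integrable_const_bound[where B = 1]) auto
    show "AE x in measure_pmf M. measure_pmf.prob (f x) S \<le> indicat_real B x + c"
      using assms by (auto simp: AE_measure_pmf_iff indicator_def intro: order.trans[OF measure_pmf.prob_le_1])
    show "integrable (measure_pmf M) (\<lambda>x. indicat_real B x + c)"
      by (rule measure_pmf.integrable_const_bound[where B = "1 + c"]) (auto simp: indicator_def assms(2))
  qed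
  also have "\<dots> = (\<integral>x. indicat_real B x \<partial>measure_pmf M) + (\<integral>x. c \<partial>measure_pmf M)"
  proof (rule Bochner_Integration.integral_add)
    show "integrable (measure_pmf M) (indicat_real B)"
      by (rule measure_pmf.integrable_const_bound[where B = 1]) (auto simp: indicator_def)
  qed simp
  also have "\<dots> = measure_pmf.prob M B + c" by simp
  finally show ?thesis .
qed

lemma prob_bind_le:
  assumes "\<And>x. x \<in> set_pmf M \<Longrightarrow> measure_pmf.prob (f x) S \<le> c" "0 \<le> c"
  shows "measure_pmf.prob (bind_pmf M f) S \<le> c"
  using prob_bind_le_except[of M "{}" f S c] assms by simp

text \<open>\<open>card_small_subsets\<close> with \<open>y = 1 / 4\<close> bounds the choices of
  missed blocks by \<open>(5 / 4) ^ (100 * k) * 4 ^ (4 * k)\<close>. With 100 blocks per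
  \<open>k\<close> this stays below \<open>2 ^ (100 * k)\<close> by far more than the factor
  \<open>3 ^ k\<close>.\<close>

lemma planted_count_exp:
  fixes Mc :: nat
  assumes "2 ^ (100 * k) \<le> Mc * card {D. D \<subseteq> {..<100 * k} \<and> card D \<le> 4 * k}"
  shows "exp (real k) \<le> real Mc"
proof -
  define d where "d = real (card {D. D \<subseteq> {..<100 * k} \<and> card D \<le> 4 * k})"
  have d: "d * (1 / 4) ^ (4 * k) \<le> (1 + 1 / 4) ^ (100 * k)"
    using card_small_subsets[of "{..<100 * k}" "1 / 4" "4 * k"] by (simp add: d_def)
  hence "d \<le> (5 / 4) ^ (100 * k) * 4 ^ (4 * k)" by (simp add: field_simps power_divide)
  hence "real Mc * d \<le> real Mc * ((5 / 4) ^ (100 * k) * 4 ^ (4 * k))" by (rule mult_left_mono) simp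
  moreover have "2 ^ (100 * k) \<le> real Mc * d"
    using of_nat_mono[OF assms, where 'a = real] by (simp add: d_def)
  ultimately have 1: "(2::real) ^ (100 * k) \<le> real Mc * ((5 / 4) ^ (100 * k) * 4 ^ (4 * k))" by linarith
  have "exp (real k) = exp 1 ^ k" by (simp flip: exp_of_nat_mult)
  also have "\<dots> \<le> 3 ^ k" using exp_le by (intro power_mono) auto
  finally have "exp (real k) * ((5 / 4) ^ (100 * k) * 4 ^ (4 * k)) \<le> 3 ^ k * ((5 / 4) ^ (100 * k) * 4 ^ (4 * k))"
    by (rule mult_right_mono) simp
  also have "\<dots> = (3 * ((5 / 4) ^ 100 * 4 ^ 4)) ^ k" by (simp only: power_mult power_mult_distrib)
  also have "\<dots> \<le> (2 ^ 100) ^ k" by (rule power_mono) (simp_all add: power_divide)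
  also have "\<dots> = 2 ^ (100 * k)" by (simp only: power_mult)
  also note 1
  finally show ?thesis by (rule mult_right_le_imp_le) simp
qed

text \<open>The entropy in the union bound over pairs of block sets; the constant 140 in the choice
  of \<open>K\<close> exceeds 139 by one, which leaves \<open>exp (- k)\<close>.\<close>

lemma four_power_exp: "(4::real) ^ (100 * k) \<le> exp (139 * real k)"
proof -
  have "ln (4::real) = 2 * ln 2" using ln_realpow[of "2::real" 2] by simp
  also have "\<dots> \<le> 139 / 100" using ln2_le_25_over_36 by simp
  finally have "real k * (100 * ln (4::real)) \<le> real k * 139" by (intro mult_left_mono) auto
  moreover have "(4::real) ^ (100 * k) = exp (real (100 * k) * ln 4)" by (simp only: exp_of_nat_mult) simp
  ultimately show ?thesis by (simp add: mult_ac)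
qed

text \<open>Here all constants of the search are fixed. The first round of edges yields a deep stack
  with high probability, and given any such stack the second round yields exponentially many
  candidates.\<close>

lemma many_factors:
  fixes del lam :: real
  assumes "0 < del" "del \<le> 1" "0 < lam" "lam * (sqrt (2 * del) + sqrt (1 - del))\<^sup>2 > 1"
  shows "\<exists>c>0. \<exists>\<eta>1>0. \<exists>D. \<forall>\<^sub>F n in sequentially. \<forall>V H. V \<subseteq> {1..n} \<longrightarrow> card V = nat \<lfloor>del * real n\<rfloor> \<longrightarrow>
    two_regular V H \<longrightarrow> (\<forall>j\<in>{1..D}. H \<notin> many_components j (nat \<lfloor>\<eta>1 * real n\<rfloor>) V) \<longrightarrow>
    measure_pmf.prob (random_subset (complete_edges n) (lam / real n))
      {X. \<not> exp (c * real n) \<le> real (card (planted_in n (card V) (H \<union> X)))} \<le> 2 * exp (- c * real n)"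
proof -
  define f where "f = (sqrt (2 * del) + sqrt (1 - del))\<^sup>2"
  have f: "f > 0" using assms by (auto simp: f_def intro!: zero_less_power add_pos_nonneg)
  have "1 / f < lam" using f assms(4) by (simp add: f_def[symmetric] pos_divide_less_eq)
  note f = f this
  \<comment> \<open>The midpoint between the threshold and \<open>lam\<close>: the search stays
    supercritical, and a positive \<open>lam2\<close> remains for joining.\<close>
  define lam1 where "lam1 = (lam + 1 / f) / 2"
  define lam2 where "lam2 = lam - lam1"
  have lam1: "0 < lam1" "lam1 < lam" "0 < lam2" "1 / f < lam1"
    using f assms by (auto simp: lam1_def lam2_def intro: add_pos_pos)
  have "lam1 * f > 1" using lam1(4) f(1) by (simp add: field_simps)
  from level_weights[OF assms(1,2) lam1(1) this[unfolded f_def]]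
  obtain L and \<phi> :: "nat \<Rightarrow> real" and \<eta> where eta: "\<eta> > 0" and phi: "\<And>b. b \<le> L \<Longrightarrow> \<phi> b > 0" and phiL: "\<phi> (Suc L) = 0"
    and growth: "\<And>b. b \<le> L \<Longrightarrow> lam1 * ((1 - del) * \<phi> (Suc b) + 2 * del * (\<Sum>c\<le>b. \<phi> c)) \<ge> (1 + 3 * \<eta>) * \<phi> b"
    by auto
  define M where "M = (\<Sum>b\<le>L. \<phi> b)"
  define mn where "mn = Min (\<phi> ` {..L})"
  have mn: "mn > 0" "\<And>b. b \<le> L \<Longrightarrow> mn \<le> \<phi> b" using phi by (auto simp: mn_def Min_gr_iff)
  have M: "\<phi> b \<le> M" if "b \<le> L" for b
    unfolding M_def using that phi by (intro member_le_sum) (auto intro: less_imp_le)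
  have Mpos: "M > 0" using M[of 0] phi[of 0] by simp
  have sM: "0 \<le> (\<Sum>c\<le>b. \<phi> c)" "(\<Sum>c\<le>b. \<phi> c) \<le> M" if "b \<le> L" for b
  proof -
    show "0 \<le> (\<Sum>c\<le>b. \<phi> c)" using that phi by (intro sum_nonneg) (auto intro: less_imp_le)
    show "(\<Sum>c\<le>b. \<phi> c) \<le> M" unfolding M_def using that phi by (intro sum_mono2) (auto intro: less_imp_le)
  qed
  have pS: "0 \<le> \<phi> (Suc b)" "\<phi> (Suc b) \<le> M" if "b \<le> L" for b
    using that phi[of "Suc b"] M[of "Suc b"] phiL Mpos by (cases "b = L"; simp)+
  define D where "D = 2 * (L + 2)"
  \<comment> \<open>The relative loss of targets that costs one \<open>\<eta>\<close> of growth. For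
    planted targets, a third each goes to used vertices (\<open>\<rho>\<close>), to vertices on
    short cycles (\<open>\<eta>1\<close>) and to the rounding of \<open>del * n\<close>.\<close>
  define \<rho>1 where "\<rho>1 = \<eta> * mn / (3 * M * lam1)"
  define \<rho> where "\<rho> = \<rho>1 / (3 * (2 * real L + 7))"
  define \<eta>1 where "\<eta>1 = \<rho>1 / (3 * real D * real D)"
  \<comment> \<open>The factor takes the growth from \<open>1 + 2 * \<eta>\<close> down to
    \<open>1 + \<eta>\<close> and leaves room for second-order terms; \<open>\<tau>\<close> is then
    small enough for \<open>exp_drift\<close>, as gains are at most \<open>2 * M\<close>.\<close>
  define \<alpha> where "\<alpha> = (1 + \<eta>) / (1 + 2 * \<eta>)"
  define \<tau> where "\<tau> = (1 - \<alpha>) / (3 * M)"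
  define c0 where "c0 = mn / (2 * (real L + 3))"
  \<comment> \<open>The weight of a stack of depth below \<open>c1 * n\<close> offsets at most half
    of the charge \<open>\<eta> * c0 * \<rho> * n\<close> for the used vertices. The other half is
    \<open>\<zeta>\<close>.\<close>
  define c1 where "c1 = \<eta> * c0 * \<rho> / (4 * (1 + \<eta>) * M * (real L + 1))"
  define c2 where "c2 = c1 / (400 * real (Suc L))"
  \<comment> \<open>The exponent of \<open>prob_dense\<close> is about
    \<open>(lam2 / n) * k^2 * K^2\<close>. With \<open>k \<ge> c2 * n / K\<close> it is at least
    \<open>lam2 * c2 * K * k\<close>, hence at least \<open>140 * k\<close>.\<close>
  define K where "K = nat \<lceil>140 / (lam2 * c2)\<rceil>"
  have Dpos: "real D > 0" by (simp add: D_def)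
  have r1: "\<rho>1 > 0" using eta mn(1) Mpos lam1(1) by (simp add: \<rho>1_def)
  have r: "\<rho> > 0" "\<rho> \<le> \<rho>1" "(2 * real L + 7) * \<rho> = \<rho>1 / 3" using r1 by (auto simp: \<rho>_def field_simps)
  have e1: "\<eta>1 > 0" "real D * real D * \<eta>1 = \<rho>1 / 3" using r1 Dpos by (auto simp: \<eta>1_def)
  have al: "0 < \<alpha>" "\<alpha> < 1" "\<alpha> * (1 + 2 * \<eta>) = 1 + \<eta>" using eta by (auto simp: \<alpha>_def field_simps)
  have tau: "\<tau> > 0" "3 * \<tau> * (2 * M) = 2 * (1 - \<alpha>)" using al Mpos by (auto simp: \<tau>_def)
  have c0: "c0 > 0" "c0 * (2 * (real L + 3)) = mn"
    using mn(1) by (auto simp: c0_def add_nonneg_pos)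
  have c1: "c1 > 0" "(1 + \<eta>) * (M * (2 * (real L + 1) * c1)) = \<eta> * c0 * \<rho> / 2"
  proof -
    define X where "X = 4 * (1 + \<eta>) * M * (real L + 1)"
    have X: "X > 0" using eta Mpos by (simp add: X_def)
    have c1X: "c1 = \<eta> * c0 * \<rho> / X" by (simp add: c1_def X_def)
    show "c1 > 0" using eta c0 r X by (simp add: c1X)
    have "c1 * X = \<eta> * c0 * \<rho>" using X by (simp add: c1X)
    hence "c1 * (4 * (1 + \<eta>) * M * (real L + 1)) = \<eta> * c0 * \<rho>" by (simp only: X_def)
    thus "(1 + \<eta>) * (M * (2 * (real L + 1) * c1)) = \<eta> * c0 * \<rho> / 2" by (simp add: algebra_simps)
  qed
  have c2: "c2 > 0" using c1 by (simp add: c2_def)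
  have K: "140 \<le> lam2 * c2 * real K" "1 \<le> K"
  proof -
    have "140 / (lam2 * c2) \<le> real K" unfolding K_def by linarith
    thus "140 \<le> lam2 * c2 * real K" using lam1(3) c2 by (simp add: field_simps)
    thus "1 \<le> K" by (cases K) auto
  qed
  define c where "c = min (\<tau> * (\<eta> * c0 * \<rho> / 2)) (c2 / real K)"
  have c: "c > 0" using tau eta c0 r c2 K(2) by (auto simp: c_def)
  define n0 where "n0 = 1 + 3 / \<rho>1 + lam + 2 * real K / c2 + 800 * real (Suc L) * real K / c1"
  have "\<forall>\<^sub>F n in sequentially. n0 \<le> real n"
    by (rule eventually_sequentiallyI[of "nat \<lceil>n0\<rceil>"]) linarith
  hence "\<forall>\<^sub>F n in sequentially. \<forall>V H. V \<subseteq> {1..n} \<longrightarrow> card V = nat \<lfloor>del * real n\<rfloor> \<longrightarrow>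
    two_regular V H \<longrightarrow> (\<forall>j\<in>{1..D}. H \<notin> many_components j (nat \<lfloor>\<eta>1 * real n\<rfloor>) V) \<longrightarrow>
    measure_pmf.prob (random_subset (complete_edges n) (lam / real n))
      {X. \<not> exp (c * real n) \<le> real (card (planted_in n (card V) (H \<union> X)))} \<le> 2 * exp (- c * real n)"
  proof (eventually_elim, intro allI impI)
    fix n V H
    assume n0: "n0 \<le> real n" and V: "V \<subseteq> {1..n}" and cV: "card V = nat \<lfloor>del * real n\<rfloor>"
      and H: "two_regular V H" and few: "\<forall>j\<in>{1..D}. H \<notin> many_components j (nat \<lfloor>\<eta>1 * real n\<rfloor>) V"
    have parts: "0 \<le> 3 / \<rho>1" "0 \<le> 2 * real K / c2" "0 \<le> 800 * real (Suc L) * real K / c1"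
      using r1 c2 c1 by auto
    have n: "1 \<le> real n" "3 / \<rho>1 \<le> real n" "lam \<le> real n" "lam1 < real n" "800 * real (Suc L) * real K / c1 \<le> real n"
      using n0 parts lam1 assms(3) unfolding n0_def by linarith+
    have n1: "1 \<le> \<rho>1 / 3 * real n" using n(2) r1 by (simp add: field_simps)
    have mV: "real (card V) \<le> del * real n" "del * real n - 1 \<le> real (card V)"
      using assms(1) by (auto simp: cV)
    obtain nx pv where ss: "successor_structure n V H nx pv L \<phi>"
      and bad: "card (V - successor_structure.good V nx L) \<le> (2 * (L + 2)) * (2 * (L + 2)) * nat \<lfloor>\<eta>1 * real n\<rfloor>"
      by (rule successor_structure_exists[OF H V, of L \<phi> "nat \<lfloor>\<eta>1 * real n\<rfloor>"]) (use phi few in \<open>auto simp: D_def\<close>)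
    interpret successor_structure n V H nx pv L \<phi> by (rule ss)
    have bad': "real (card (V - good)) \<le> \<rho>1 / 3 * real n"
    proof -
      have "real (card (V - good)) \<le> real (D * D * nat \<lfloor>\<eta>1 * real n\<rfloor>)" using bad unfolding D_def by (rule of_nat_mono)
      also have "\<dots> = real D * real D * real (nat \<lfloor>\<eta>1 * real n\<rfloor>)" by simp
      also have "\<dots> \<le> real D * real D * (\<eta>1 * real n)"
        using e1(1) by (intro mult_left_mono) auto
      also have "\<dots> = \<rho>1 / 3 * real n" using e1(2) by (simp only: mult.assoc[symmetric])
      finally show ?thesis .
    qed
    define p1 where "p1 = lam1 / real n"
    \<comment> \<open>Solves \<open>p1 + p2 - p1 * p2 = lam / n\<close>, as
      \<open>random_subset_union\<close> demands; dividing by \<open>1 - p1\<close> only increases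
      it beyond \<open>lam2 / n\<close>.\<close>
    define p2 where "p2 = (lam / real n - p1) / (1 - p1)"
    have p1: "0 \<le> p1" "p1 < 1" using lam1(1) n by (auto simp: p1_def)
    have pn: "lam / real n \<le> 1" "lam / real n - p1 = lam2 / real n"
      using n by (auto simp: p1_def lam2_def diff_divide_distrib)
    have p2: "0 \<le> p2" "p2 \<le> 1" "lam2 / real n \<le> p2" "lam / real n = p1 + p2 - p1 * p2"
    proof -
      have q: "0 < 1 - p1" "1 - p1 \<le> 1" "0 \<le> lam2 / real n" using p1 lam1(3) n(1) by auto
      have e: "p2 * (1 - p1) = lam2 / real n" unfolding p2_def pn(2) using q by simp
      show "0 \<le> p2" unfolding p2_def pn(2) by (rule divide_nonneg_pos[OF q(3,1)])
      show "p2 \<le> 1" unfolding p2_def pos_divide_le_eq[OF q(1)] using pn(1) by simp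
      show "lam2 / real n \<le> p2" using mult_left_mono[OF q(2) \<open>0 \<le> p2\<close>] e by simp
      show "lam / real n = p1 + p2 - p1 * p2" using e pn(2) by (simp add: algebra_simps)
    qed
    define l where "l = nat \<lfloor>c1 * real n\<rfloor>"
    define \<zeta> where "\<zeta> = \<eta> * c0 * \<rho> / 2 * real n"
    interpret exploration n V H nx pv L \<phi> p1 \<alpha> \<eta> c0 \<tau> \<zeta> "\<rho> * real n" M l
    proof unfold_locales
      show "0 \<le> p1" "p1 \<le> 1" "0 < \<eta>" "0 < \<alpha>" "0 < \<tau>" "0 \<le> c0" using p1 eta al tau c0 by auto
      show "c0 * (2 * (real L + 3)) \<le> \<phi> b" if "b \<le> L" for b using c0(2) mn(2)[OF that] by simp
      show "\<phi> b \<le> M" if "b \<le> L" for b using M[OF that] .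
      show "(1 + \<eta>) * \<phi> b \<le> \<alpha> * p1 * sum (gain b) (targets b T)"
        if T: "T \<subseteq> {1..n}" "real n - real (card T) < \<rho> * real n" "b \<le> L" for T b
      proof -
        let ?S = "\<Sum>c\<le>b. \<phi> c"
        have vis: "(2 * real L + 7) * (real n - real (card T)) \<le> \<rho>1 / 3 * real n"
        proof -
          have "(2 * real L + 7) * (real n - real (card T)) \<le> (2 * real L + 7) * (\<rho> * real n)"
            using T(2) by (intro mult_left_mono) auto
          thus ?thesis using r(3) by (simp only: mult.assoc[symmetric])
        qed
        have x: "(del - \<rho>1) * real n \<le> real (card V) - real (card (V - good)) - (2 * real L + 7) * (real n - real (card T))"
          using vis bad' mV(2) n1 by (simp add: algebra_simps)
        have "\<rho> * real n \<le> \<rho>1 * real n" using r(2) by (intro mult_right_mono) auto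
        hence y: "(1 - del - \<rho>1) * real n \<le> real (card T) - real (card V)"
          using T(2) mV(1) by (simp add: algebra_simps)
        have err: "lam1 * (\<rho>1 * (2 * ?S + \<phi> (Suc b))) \<le> \<eta> * \<phi> b"
        proof -
          have "lam1 * (\<rho>1 * (2 * ?S + \<phi> (Suc b))) \<le> lam1 * (\<rho>1 * (3 * M))"
            using sM(2)[OF T(3)] pS(2)[OF T(3)] lam1(1) r1 by (intro mult_left_mono) auto
          also have "\<dots> = \<eta> * mn" using Mpos lam1(1) by (simp add: \<rho>1_def)
          also have "\<dots> \<le> \<eta> * \<phi> b" using mn(2)[OF T(3)] eta by (intro mult_left_mono) auto
          finally show ?thesis .
        qed
        have "(1 + 2 * \<eta>) * \<phi> b \<le> lam1 * ((del - \<rho>1) * (2 * ?S) + (1 - del - \<rho>1) * \<phi> (Suc b))"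
          using growth[OF T(3)] err by (simp add: algebra_simps)
        hence "\<alpha> * ((1 + 2 * \<eta>) * \<phi> b) \<le> \<alpha> * (lam1 * ((del - \<rho>1) * (2 * ?S) + (1 - del - \<rho>1) * \<phi> (Suc b)))"
          using al(1) by (intro mult_left_mono) auto
        also have "\<alpha> * ((1 + 2 * \<eta>) * \<phi> b) = (1 + \<eta>) * \<phi> b" using al(3) by (simp only: mult.assoc[symmetric])
        also have "\<alpha> * (lam1 * ((del - \<rho>1) * (2 * ?S) + (1 - del - \<rho>1) * \<phi> (Suc b))) =
            \<alpha> * p1 * ((del - \<rho>1) * real n * (2 * ?S) + (1 - del - \<rho>1) * real n * \<phi> (Suc b))"
          using n(1) by (simp add: p1_def field_simps)
        also have "\<dots> \<le> \<alpha> * p1 * (\<Sum>v\<in>targets b T. gain b v)"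
          using sum_gain_ge[OF T(1) T(3) phiL x y] al(1) p1(1) by (intro mult_left_mono) auto
        finally show ?thesis .
      qed
      show "p1 * exp (- \<tau> * gain b v) + (1 - p1) * exp (\<tau> * (\<alpha> * p1 * gain b v)) \<le> 1"
        if b: "b \<le> L" and v: "v \<in> targets b T" for b v T
      proof (rule exp_drift)
        have g: "0 \<le> gain b v \<and> gain b v \<le> 2 * M"
          using sM[OF b] pS[OF b] Mpos by (cases "v \<in> V") (auto simp: gain_inside gain_outside)
        thus "0 \<le> gain b v" by simp
        have "3 * \<tau> * gain b v \<le> 3 * \<tau> * (2 * M)" using g tau(1) by (intro mult_left_mono) auto
        thus "3 * \<tau> * gain b v \<le> 2 * (1 - \<alpha>)" using tau(2) by simp
      qed (use p1 tau al in auto)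
      show "(1 + \<eta>) * (M * (2 * (real L + 1) * real l)) - \<eta> * c0 * (\<rho> * real n) \<le> - \<zeta>"
      proof -
        have "real l \<le> c1 * real n" using c1(1) by (simp add: l_def)
        hence "(1 + \<eta>) * (M * (2 * (real L + 1) * real l)) \<le> (1 + \<eta>) * (M * (2 * (real L + 1) * (c1 * real n)))"
          using eta Mpos by (intro mult_left_mono) auto
        also have "\<dots> = (1 + \<eta>) * (M * (2 * (real L + 1) * c1)) * real n" by (simp only: mult.assoc)
        finally show ?thesis unfolding c1(2) \<zeta>_def by (simp add: algebra_simps)
      qed
    qed
    \<comment> \<open>There are \<open>100 * k\<close> blocks with \<open>2 * K\<close> cuts each,
      and \<open>Suc L\<close> levels for the pigeonhole. The 400 in \<open>c2\<close> is twice the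
      resulting 200 to cover both roundings.\<close>
    define k where "k = l div (Suc L * (2 * K * 100))"
    have kl: "Suc L * (2 * K * (100 * k)) \<le> l"
      unfolding k_def using times_div_less_eq_dividend[of "Suc L * (2 * K * 100)" l] by (simp only: mult_ac)
    have kreal: "c2 / real K * real n \<le> real k"
    proof -
      define d where "d = Suc L * (2 * K * 100)"
      have d: "0 < d" "real d = 200 * real (Suc L) * real K" using K(2) by (simp_all add: d_def algebra_simps)
      have "l < d + d * k" unfolding k_def d_def[symmetric] by (rule dividend_less_times_div[OF d(1)])
      hence "real l < real (d + d * k)" by (rule of_nat_less_iff[THEN iffD2])
      moreover have "c1 * real n - 1 \<le> real l" unfolding l_def by linarith
      moreover have "800 * real (Suc L) * real K \<le> c1 * real n" using n(5) c1(1) by (simp add: field_simps)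
      hence "4 * real d \<le> c1 * real n" unfolding d(2) by (simp add: algebra_simps)
      moreover have "1 \<le> real d" using d(1) by (simp add: Suc_le_eq)
      ultimately have "c1 * real n / 2 \<le> real d * real k" by simp
      moreover have "real d * (c2 / real K * real n) = c1 * real n / 2"
      proof -
        define S where "S = real (Suc L)"
        have "S > 0" by (simp add: S_def)
        moreover have "real d = 200 * S * real K" "c2 = c1 / (400 * S)" by (simp_all only: d(2) c2_def S_def)
        ultimately show ?thesis using K(2) by (simp add: field_simps)
      qed
      ultimately have "real d * (c2 / real K * real n) \<le> real d * real k" by linarith
      thus ?thesis by (rule mult_left_le_imp_le) (use d(1) in simp)
    qed
    have kpos: "1 \<le> k"
    proof -
      have "0 < c2 / real K * real n" using c2 K(2) n(1) by simp
      thus ?thesis using kreal by (cases k) auto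
    qed
    have stage2: "measure_pmf.prob (random_subset (complete_edges n) p2)
       {Y. \<not> exp (c * real n) \<le> real (card (planted_in n (card V) (H \<union> (X \<union> Y))))} \<le> exp (- c * real n)"
      if X: "\<exists>gs. stack X gs \<and> l \<le> length gs" for X
    proof -
      obtain gs where gs: "stack X gs" "l \<le> length gs" using X by blast
      have ck: "c * real n \<le> real k"
      proof -
        have "c * real n \<le> c2 / real K * real n" by (intro mult_right_mono) (auto simp: c_def)
        thus ?thesis using kreal by linarith
      qed
      let ?bad = "{F. \<not> 2 ^ (100 * k) \<le> card (planted_in n (card V) (H \<union> X \<union> F)) * card {D. D \<subseteq> {..<100 * k} \<and> card D \<le> 4 * k}}"
      have "exp (c * real n) \<le> real (card (planted_in n (card V) (H \<union> (X \<union> Y))))" if "Y \<notin> ?bad" for Y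
      proof -
        have "exp (c * real n) \<le> exp (real k)" using ck by simp
        also have "\<dots> \<le> real (card (planted_in n (card V) (H \<union> X \<union> Y)))"
          using that by (intro planted_count_exp) simp
        finally show ?thesis by (simp only: Un_assoc)
      qed
      hence "measure_pmf.prob (random_subset (complete_edges n) p2)
       {Y. \<not> exp (c * real n) \<le> real (card (planted_in n (card V) (H \<union> (X \<union> Y))))} \<le>
         measure_pmf.prob (random_subset (complete_edges n) p2) ?bad"
        by (intro measure_pmf.finite_measure_mono) auto
      also have "\<dots> \<le> 4 ^ (100 * k) * exp (- p2 * (real k * real K)\<^sup>2)"
        by (rule many_planted_from_stack[OF gs(1) _ p2(1,2) H K(2) kpos]) (use kl gs(2) in linarith)
      also have "\<dots> \<le> exp (139 * real k) * exp (- (140 * real k))"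
      proof (intro mult_mono four_power_exp)
        have "lam2 * c2 * real K \<le> p2 * real k * (real K)\<^sup>2"
        proof -
          have "(lam2 / real n) * (c2 / real K * real n) \<le> p2 * real k"
            using p2 kreal lam1(3) n(1) c2 by (intro mult_mono) auto
          hence "(lam2 / real n) * (c2 / real K * real n) * (real K)\<^sup>2 \<le> p2 * real k * (real K)\<^sup>2"
            by (intro mult_right_mono) auto
          thus ?thesis using n(1) K(2) by (simp add: power2_eq_square)
        qed
        hence "140 * real k \<le> p2 * real k * (real K)\<^sup>2 * real k" using K(1) by (intro mult_right_mono) auto
        thus "exp (- p2 * (real k * real K)\<^sup>2) \<le> exp (- (140 * real k))"
          by (simp add: power2_eq_square mult_ac)
      qed auto
      also have "\<dots> = exp (- real k)" by (simp flip: exp_add)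
      also have "\<dots> \<le> exp (- c * real n)" using ck by simp
      finally show ?thesis .
    qed
    have finE: "finite (complete_edges n)"
      by (rule finite_subset[of _ "Pow {1..n}"]) (auto simp: complete_edges_def)
    have "measure_pmf.prob (random_subset (complete_edges n) (lam / real n))
      {X. \<not> exp (c * real n) \<le> real (card (planted_in n (card V) (H \<union> X)))} \<le>
      measure_pmf.prob (random_subset (complete_edges n) p1) {X. \<not> (\<exists>gs. stack X gs \<and> l \<le> length gs)} + exp (- c * real n)"
      unfolding random_subset_union[OF finE p1(1) less_imp_le[OF p1(2)] p2(1,2,4)]
    proof (rule prob_bind_le_except)
      fix X assume "X \<notin> {X. \<not> (\<exists>gs. stack X gs \<and> l \<le> length gs)}"
      hence "\<exists>gs. stack X gs \<and> l \<le> length gs" by simp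
      from stage2[OF this]
      show "measure_pmf.prob (map_pmf (\<lambda>Y. X \<union> Y) (random_subset (complete_edges n) p2))
         {X. \<not> exp (c * real n) \<le> real (card (planted_in n (card V) (H \<union> X)))} \<le> exp (- c * real n)"
        by (simp add: vimage_def)
    qed simp
    also have "\<dots> \<le> exp (- \<tau> * \<zeta>) + exp (- c * real n)" using long_stack_prob by simp
    also have "exp (- \<tau> * \<zeta>) \<le> exp (- c * real n)"
    proof -
      have "c \<le> \<tau> * (\<eta> * c0 * \<rho> / 2)" unfolding c_def by (rule min.cobounded1)
      hence "c * real n \<le> \<tau> * (\<eta> * c0 * \<rho> / 2) * real n" by (rule mult_right_mono) simp
      also have "\<dots> = \<tau> * \<zeta>" by (simp only: \<zeta>_def mult.assoc)
      finally show ?thesis by simp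
    qed
    finally show "measure_pmf.prob (random_subset (complete_edges n) (lam / real n))
      {X. \<not> exp (c * real n) \<le> real (card (planted_in n (card V) (H \<union> X)))} \<le> 2 * exp (- c * real n)" by simp
  qed
  thus ?thesis using c e1(1) by blast
qed

section \<open>The posterior distribution\<close>

text \<open>Markov's inequality for \<open>(1 + y) ^ card X\<close>, whose mean is
  \<open>(1 + y * p) ^ card A\<close>; the induction reveals one element at a time.\<close>

lemma random_subset_tail:
  fixes y t p :: real and A :: "'a set"
  assumes "finite A" "0 \<le> p" "p \<le> 1" "0 \<le> y" "0 < t"
  shows "measure_pmf.prob (random_subset A p) {X. t \<le> (1 + y) ^ card X} \<le> (1 + y * p) ^ card A / t"
  using assms(1,5)
proof (induction A arbitrary: t)
  case empty
  have "measure_pmf.prob (random_subset ({} :: 'a set) p) {X. t \<le> (1 + y) ^ card X} = indicator {X. t \<le> (1 + y) ^ card X} ({} :: 'a set)"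
    by (simp add: random_subset_def)
  thus ?case using empty by (simp add: indicator_def)
next
  case (insert e A)
  have A: "insert e A - {e} = A" using insert(2) by auto
  have y: "1 + y > 0" using assms(4) by simp
  have "card (insert e X) \<le> Suc (card X)" for X :: "'a set" by (rule card_insert_le_m1[THEN order.trans]) auto
  hence "(1 + y) ^ card (insert e X) \<le> (1 + y) ^ Suc (card X)" for X
    using assms(4) by (intro power_increasing) auto
  hence "{X. insert e X \<in> {X. t \<le> (1 + y) ^ card X}} \<subseteq> {X. t / (1 + y) \<le> (1 + y) ^ card X}"
    using y by (auto simp: field_simps intro: order.trans)
  hence "measure_pmf.prob (random_subset A p) {X. insert e X \<in> {X. t \<le> (1 + y) ^ card X}} \<le>
      measure_pmf.prob (random_subset A p) {X. t / (1 + y) \<le> (1 + y) ^ card X}"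
    by (intro measure_pmf.finite_measure_mono) auto
  also have "\<dots> \<le> (1 + y * p) ^ card A / (t / (1 + y))" using insert(4) y by (intro insert(3)) simp
  finally have 1: "measure_pmf.prob (random_subset A p) {X. insert e X \<in> {X. t \<le> (1 + y) ^ card X}} \<le>
      (1 + y * p) ^ card A / (t / (1 + y))" .
  have "measure_pmf.prob (random_subset (insert e A) p) {X. t \<le> (1 + y) ^ card X} =
      p * measure_pmf.prob (random_subset A p) {X. insert e X \<in> {X. t \<le> (1 + y) ^ card X}} +
      (1 - p) * measure_pmf.prob (random_subset A p) {X. t \<le> (1 + y) ^ card X}"
    using prob_random_subset_split[of "insert e A" e p] assms(2,3) insert(1) A by simp
  also have "\<dots> \<le> p * ((1 + y * p) ^ card A / (t / (1 + y))) + (1 - p) * ((1 + y * p) ^ card A / t)"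
    using 1 insert(3)[OF insert(4)] assms(2,3) by (intro add_mono mult_left_mono) auto
  also have "\<dots> = (1 + y * p) ^ card (insert e A) / t"
    using insert(1,2,4) y by (simp add: field_simps)
  finally show ?case .
qed

lemma prob_union_eq:
  assumes "finite E" "H \<subseteq> G" "G \<subseteq> E" "0 \<le> p" "p \<le> 1"
  shows "measure_pmf.prob (random_subset E p) {X. X \<union> H = G} = p ^ card (G - H) * (1 - p) ^ card (E - G)"
proof -
  define B where "B = (\<lambda>e. if e \<in> H then UNIV else if e \<in> G then {True} else {False})"
  have "(\<lambda>b. {e \<in> E. b e}) -` {X. X \<union> H = G} = Pi E B"
    using assms(2,3) by (auto simp: B_def Pi_def split: if_splits)
  hence "measure_pmf.prob (random_subset E p) {X. X \<union> H = G} =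
      measure_pmf.prob (Pi_pmf E False (\<lambda>_. bernoulli_pmf p)) (Pi E B)"
    by (simp add: random_subset_def)
  also have "\<dots> = (\<Prod>e\<in>E. measure_pmf.prob (bernoulli_pmf p) (B e))"
    by (rule measure_Pi_pmf_Pi[OF assms(1)])
  also have "\<dots> = (\<Prod>e\<in>E. if e \<in> H then 1 else if e \<in> G then p else 1 - p)"
    using assms(4,5) by (intro prod.cong) (auto simp: B_def measure_pmf_single)
  also have "\<dots> = (\<Prod>e\<in>H. 1) * ((\<Prod>e\<in>G - H. p) * (\<Prod>e\<in>E - G. 1 - p))"
  proof -
    have fin: "finite H" "finite (G - H)" "finite (E - G)" using assms(1-3) by (auto dest: finite_subset)
    let ?q = "\<lambda>e. if e \<in> H then 1 else if e \<in> G then p else 1 - p"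
    have "E = H \<union> ((G - H) \<union> (E - G))" using assms(2,3) by blast
    hence "prod ?q E = prod ?q (H \<union> ((G - H) \<union> (E - G)))" by (rule arg_cong)
    also have "\<dots> = prod ?q H * prod ?q ((G - H) \<union> (E - G))"
      using fin assms(2) by (intro prod.union_disjoint) auto
    also have "prod ?q ((G - H) \<union> (E - G)) = prod ?q (G - H) * prod ?q (E - G)"
      using fin by (intro prod.union_disjoint) auto
    also have "prod ?q H = (\<Prod>e\<in>H. 1)" by (rule prod.cong) auto
    also have "prod ?q (G - H) = (\<Prod>e\<in>G - H. p)" by (rule prod.cong) auto
    also have "prod ?q (E - G) = (\<Prod>e\<in>E - G. 1 - p)" by (rule prod.cong) (use assms(2) in auto)
    finally show ?thesis .
  qed
  finally show ?thesis by simp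
qed

section \<open>Joint law of the planted two-factor and the graph\<close>

definition planted_two_factor :: "nat \<Rightarrow> nat \<Rightarrow> edge_set pmf" where
  "planted_two_factor n m = bind_pmf (pmf_of_set {V. V \<subseteq> {1..n} \<and> card V = m}) (\<lambda>V. pmf_of_set (two_regulars V))"

lemma finite_complete_edges: "finite (complete_edges n)"
  by (rule finite_subset[of _ "Pow {1..n}"]) (auto simp: complete_edges_def)

lemma card_complete_edges_le: "card (complete_edges n) \<le> n * n"
proof -
  have "complete_edges n \<subseteq> (\<lambda>(u, v). {u, v}) ` ({1..n} \<times> {1..n})"
    by (auto simp: complete_edges_def card_2_iff)
  hence "card (complete_edges n) \<le> card ({1..n} \<times> {1..n})" by (rule surj_card_le[rotated]) simp
  thus ?thesis by (simp add: card_cartesian_product)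
qed

lemma vertex_sets:
  assumes "m \<le> n"
  shows "finite {V. V \<subseteq> {1..n} \<and> card V = m}" "{V. V \<subseteq> {1..n} \<and> card V = m} \<noteq> {}"
proof -
  show "finite {V. V \<subseteq> {1..n} \<and> card V = m}" by (rule finite_subset[of _ "Pow {1..n}"]) auto
  have "{1..m} \<in> {V. V \<subseteq> {1..n} \<and> card V = m}" using assms by auto
  thus "{V. V \<subseteq> {1..n} \<and> card V = m} \<noteq> {}" by blast
qed

lemma planted_cycles_alt:
  assumes "nat \<lfloor>del * real n\<rfloor> \<le> n"
  shows "planted_cycles n lam del = bind_pmf (planted_two_factor n (nat \<lfloor>del * real n\<rfloor>))
     (\<lambda>H. map_pmf (\<lambda>X. (H, X \<union> H)) (random_subset (complete_edges n) (lam / real n)))"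
proof -
  let ?m = "nat \<lfloor>del * real n\<rfloor>" and ?R = "random_subset (complete_edges n) (lam / real n)"
  let ?V = "pmf_of_set {V. V \<subseteq> {1..n} \<and> card V = nat \<lfloor>del * real n\<rfloor>}"
  have "planted_cycles n lam del = do {X \<leftarrow> ?R; V \<leftarrow> ?V; H \<leftarrow> pmf_of_set {H. two_factor V H}; return_pmf (H, X \<union> H)}"
    by (simp only: planted_cycles_def erdos_renyi_def random_subset_def)
  also have "\<dots> = do {X \<leftarrow> ?R; V \<leftarrow> ?V; H \<leftarrow> pmf_of_set (two_regulars V); return_pmf (H, X \<union> H)}"
  proof (intro bind_pmf_cong refl)
    fix V assume "V \<in> set_pmf ?V"
    hence "V \<subseteq> {1..n}" using set_pmf_of_set[OF vertex_sets(2,1)[OF assms]] by auto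
    hence "finite V" using finite_subset by blast
    thus "pmf_of_set {H. two_factor V H} = pmf_of_set (two_regulars V)"
      by (simp add: two_regulars_def two_factor_iff)
  qed
  also have "\<dots> = do {X \<leftarrow> ?R; H \<leftarrow> planted_two_factor n ?m; return_pmf (H, X \<union> H)}"
    by (simp only: planted_two_factor_def bind_assoc_pmf)
  also have "\<dots> = do {H \<leftarrow> planted_two_factor n ?m; X \<leftarrow> ?R; return_pmf (H, X \<union> H)}"
    by (rule bind_commute_pmf)
  finally show ?thesis by (simp only: map_pmf_def)
qed

lemma set_planted_two_factor:
  assumes "m \<le> n" "3 \<le> m" "H \<in> set_pmf (planted_two_factor n m)"
  shows "\<exists>V \<subseteq> {1..n}. card V = m \<and> two_regular V H"
proof -
  obtain V where V: "V \<in> set_pmf (pmf_of_set {V. V \<subseteq> {1..n} \<and> card V = m})" "H \<in> set_pmf (pmf_of_set (two_regulars V))"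
    using assms(3) by (auto simp: planted_two_factor_def)
  have V1: "V \<subseteq> {1..n}" "card V = m" using V(1) set_pmf_of_set[OF vertex_sets(2,1)[OF assms(1)]] by auto
  hence fV: "finite V" using finite_subset by blast
  have "H \<in> two_regulars V"
    using V(2) set_pmf_of_set[OF two_regulars_nonempty[OF fV] finite_two_regulars[OF fV]] V1 assms(2) by simp
  thus ?thesis using V1 by (auto simp: two_regulars_def)
qed

text \<open>The vertex set is \<open>\<Union>H\<close>, so only one choice of the vertex set
  contributes, and all vertex sets of size \<open>m\<close> carry equally many two-factors.\<close>

lemma pmf_planted_two_factor:
  assumes "m \<le> n" "3 \<le> m" "V \<subseteq> {1..n}" "card V = m" "two_regular V H"
  shows "pmf (planted_two_factor n m) H =
    1 / real (card (two_regulars {1..m})) / real (card {V. V \<subseteq> {1..n} \<and> card V = m})"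
proof -
  let ?\<V> = "{V. V \<subseteq> {1..n} \<and> card V = m}" and ?a = "real (card (two_regulars {1..m}))"
  have each: "pmf (pmf_of_set (two_regulars U)) H = (if U = V then 1 / ?a else 0)" if U: "U \<in> ?\<V>" for U
  proof -
    have fU: "finite U" "3 \<le> card U" using U assms(2) finite_subset by auto
    have "card (two_regulars U) = card (two_regulars {1..m})"
      using fU U by (intro card_two_regulars_cong) auto
    moreover have "H \<in> two_regulars U \<longleftrightarrow> U = V"
    proof
      assume "H \<in> two_regulars U"
      hence "\<Union>H = U" by (intro two_regular_Union) (simp add: two_regulars_def)
      thus "U = V" using two_regular_Union[OF assms(5)] by simp
    qed (use assms(5) in \<open>simp add: two_regulars_def\<close>)
    ultimately show ?thesis
      using pmf_of_set[OF two_regulars_nonempty[OF fU] finite_two_regulars[OF fU(1)], of H] by (simp add: indicator_def)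
  qed
  have "pmf (planted_two_factor n m) H = (\<Sum>U\<in>?\<V>. pmf (pmf_of_set (two_regulars U)) H) / real (card ?\<V>)"
    unfolding planted_two_factor_def pmf_bind
    by (rule integral_pmf_of_set[OF vertex_sets(2,1)[OF assms(1)]])
  also have "(\<Sum>U\<in>?\<V>. pmf (pmf_of_set (two_regulars U)) H) = (\<Sum>U\<in>?\<V>. if U = V then 1 / ?a else 0)"
    using each by (intro sum.cong) auto
  also have "\<dots> = 1 / ?a" using vertex_sets(1)[OF assms(1)] assms(3,4) by simp
  finally show ?thesis .
qed

definition planted_joint :: "nat \<Rightarrow> nat \<Rightarrow> real \<Rightarrow> (edge_set \<times> edge_set) pmf" where
  "planted_joint n m p = bind_pmf (planted_two_factor n m)
     (\<lambda>H. map_pmf (\<lambda>X. (H, X \<union> H)) (random_subset (complete_edges n) p))"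

lemma two_regular_complete_edges:
  "two_regular V H \<Longrightarrow> V \<subseteq> {1..n} \<Longrightarrow> H \<subseteq> complete_edges n"
  by (auto simp: two_regular_def complete_edges_def)

lemma set_planted_joint:
  assumes "m \<le> n" "3 \<le> m" "(H, G) \<in> set_pmf (planted_joint n m p)"
  shows "G \<subseteq> complete_edges n" "H \<in> planted_in n m G"
proof -
  obtain X where X: "H \<in> set_pmf (planted_two_factor n m)" "X \<in> set_pmf (random_subset (complete_edges n) p)" "G = X \<union> H"
    using assms(3) by (auto simp: planted_joint_def)
  obtain V where V: "V \<subseteq> {1..n}" "card V = m" "two_regular V H" using set_planted_two_factor[OF assms(1,2) X(1)] by blast
  show "G \<subseteq> complete_edges n"
    using set_random_subset[OF finite_complete_edges] X(2,3) two_regular_complete_edges[OF V(3,1)] by blast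
  show "H \<in> planted_in n m G" using V X(3) by (auto simp: planted_in_def)
qed

text \<open>The right-hand side depends on \<open>G\<close> but not on \<open>H\<close>, which is
  the uniformity of the posterior.\<close>

lemma pmf_planted_joint:
  assumes "m \<le> n" "3 \<le> m" "0 \<le> p" "p \<le> 1" "G \<subseteq> complete_edges n" "H \<in> planted_in n m G"
  shows "pmf (planted_joint n m p) (H, G) = p ^ (card G - m) * (1 - p) ^ card (complete_edges n - G) *
    (1 / real (card (two_regulars {1..m})) / real (card {V. V \<subseteq> {1..n} \<and> card V = m}))"
proof -
  let ?R = "random_subset (complete_edges n) p"
  obtain V where V: "V \<subseteq> {1..n}" "card V = m" "two_regular V H" "H \<subseteq> G" using assms(6) by (auto simp: planted_in_def)
  have inner: "pmf (map_pmf (\<lambda>X. (H', X \<union> H')) ?R) (H, G) = (if H' = H then measure_pmf.prob ?R {X. X \<union> H = G} else 0)" for H'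
    by (auto simp: pmf_map vimage_def)
  have cGH: "card (G - H) = card G - m"
    using V two_regular_card[OF V(3)] two_regular_finite[OF V(3)] by (simp add: card_Diff_subset)
  have "pmf (planted_joint n m p) (H, G) =
      (\<integral>H'. (if H' = H then measure_pmf.prob ?R {X. X \<union> H = G} else 0) \<partial>measure_pmf (planted_two_factor n m))"
    unfolding planted_joint_def pmf_bind inner ..
  also have "\<dots> = measure_pmf.prob ?R {X. X \<union> H = G} * pmf (planted_two_factor n m) H"
    by (subst integral_measure_pmf_real[of "{H}"]) (auto split: if_splits)
  finally show ?thesis
    unfolding prob_union_eq[OF finite_complete_edges V(4) assms(5,3,4)] cGH
      pmf_planted_two_factor[OF assms(1,2) V(1-3)] .
qed

text \<open>Given the observed graph, the planted two-factor is uniformly distributed over all the candidates.\<close>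

lemma posterior_average:
  fixes g :: "edge_set \<times> edge_set \<Rightarrow> real"
  assumes m: "m \<le> n" "3 \<le> m" and p: "0 \<le> p" "p \<le> 1"
    and g: "\<And>G. G \<subseteq> complete_edges n \<Longrightarrow> (\<Sum>H\<in>planted_in n m G. g (H, G)) \<le> r * real (card (planted_in n m G))"
  shows "measure_pmf.expectation (planted_joint n m p) g \<le> r"
proof -
  let ?J = "planted_joint n m p" and ?P = "planted_in n m"
  define w where "w = 1 / real (card (two_regulars {1..m})) / real (card {V. V \<subseteq> {1..n} \<and> card V = m})"
  define W where "W = (\<lambda>G. p ^ (card G - m) * (1 - p) ^ card (complete_edges n - G) * w)"
  have Wpos: "0 \<le> W G" for G using p by (simp add: W_def w_def)
  define A where "A = (SIGMA G:Pow (complete_edges n). ?P G)"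
  have finA: "finite A" unfolding A_def using finite_complete_edges finite_planted_in by (intro finite_SigmaI) auto
  have pJ: "pmf ?J (H, G) = W G" if "(G, H) \<in> A" for H G
    using that pmf_planted_joint[OF m p, of G H] by (simp add: A_def W_def w_def)
  have inA: "prod.swap a \<in> A" if "a \<in> set_pmf ?J" for a
    using that set_planted_joint[OF m, of "fst a" "snd a" p] by (simp add: A_def prod.swap_def)
  have inj: "inj_on prod.swap A" by simp
  \<comment> \<open>Used twice: for \<open>g\<close>, and for the constant 1, which turns the
    weighted numbers of candidates back into the total mass.\<close>
  have expand: "measure_pmf.expectation ?J h = (\<Sum>G\<in>Pow (complete_edges n). W G * (\<Sum>H\<in>?P G. h (H, G)))"
    for h :: "edge_set \<times> edge_set \<Rightarrow> real"
  proof -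
    have "measure_pmf.expectation ?J h = (\<Sum>a\<in>prod.swap ` A. h a * pmf ?J a)"
    proof (rule integral_measure_pmf_real)
      show "finite (prod.swap ` A)" using finA by simp
      fix a assume "a \<in> set_pmf ?J"
      hence "prod.swap (prod.swap a) \<in> prod.swap ` A" using inA by blast
      thus "a \<in> prod.swap ` A" by simp
    qed
    also have "\<dots> = (\<Sum>a\<in>A. h (prod.swap a) * pmf ?J (prod.swap a))"
      by (subst sum.reindex[OF inj]) simp
    also have "\<dots> = (\<Sum>(G, H)\<in>A. h (H, G) * W G)"
      using pJ by (intro sum.cong) auto
    also have "\<dots> = (\<Sum>G\<in>Pow (complete_edges n). \<Sum>H\<in>?P G. h (H, G) * W G)"
      unfolding A_def using finite_complete_edges finite_planted_in by (subst sum.Sigma) auto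
    finally show ?thesis by (simp add: sum_distrib_left mult.commute)
  qed
  have "measure_pmf.expectation ?J g \<le> (\<Sum>G\<in>Pow (complete_edges n). W G * (r * real (card (?P G))))"
    unfolding expand using g Wpos by (intro sum_mono mult_left_mono) auto
  also have "\<dots> = r * (\<Sum>G\<in>Pow (complete_edges n). W G * (\<Sum>H\<in>?P G. 1))"
    by (simp add: sum_distrib_left mult_ac)
  also have "(\<Sum>G\<in>Pow (complete_edges n). W G * (\<Sum>H\<in>?P G. 1)) = measure_pmf.expectation ?J (\<lambda>_. 1)"
    by (rule expand[symmetric])
  finally show ?thesis by simp
qed

section \<open>Candidates close to the truth\<close>

definition near :: "nat \<Rightarrow> real \<Rightarrow> edge_set \<Rightarrow> edge_set \<Rightarrow> edge_set set" where
  "near n \<epsilon> H G = {H' \<in> planted_in n (card H) G. real (card (sym_diff H H')) < \<epsilon> * real (card H)}"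

lemma finite_near: "finite (near n \<epsilon> H G)"
  by (rule finite_subset[OF _ finite_planted_in]) (auto simp: near_def)

lemma card_planted: "H \<in> planted_in n m G \<Longrightarrow> card H = m \<and> finite H"
  using two_regular_card two_regular_finite by (auto simp: planted_in_def)

lemma prob_mono_support:
  assumes "\<And>x. x \<in> set_pmf M \<Longrightarrow> x \<in> A \<Longrightarrow> x \<in> B"
  shows "measure_pmf.prob M A \<le> measure_pmf.prob M B"
  by (rule measure_pmf.finite_measure_mono_AE) (use assms in \<open>auto simp: AE_measure_pmf_iff\<close>)

text \<open>Candidates within \<open>\<epsilon> / 2\<close> of one output are within
  \<open>\<epsilon>\<close> of each other, so all that are hit lie in the ball around any one of
  them. Averaging over the output covers randomized estimators.\<close>

lemma estimate_hits:
  assumes "finite (set_pmf M)" "\<And>H'. H' \<in> set_pmf M \<Longrightarrow> finite H'" "0 \<le> K1"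
    and Q: "Q \<subseteq> planted_in n m G" "0 < m" "\<And>H. H \<in> Q \<Longrightarrow> real (card (near n \<epsilon> H G)) \<le> K1"
  shows "(\<Sum>H\<in>Q. measure_pmf.prob M {H'. reconstruction_error H H' < \<epsilon> / 2}) \<le> K1"
proof -
  have finQ: "finite Q" using Q(1) finite_planted_in finite_subset by blast
  have point: "(\<Sum>H\<in>Q. indicat_real {H'. reconstruction_error H H' < \<epsilon> / 2} H') \<le> K1"
    if H': "H' \<in> set_pmf M" for H'
  proof -
    define Z where "Z = {H \<in> Q. reconstruction_error H H' < \<epsilon> / 2}"
    have "(\<Sum>H\<in>Q. indicat_real {H'. reconstruction_error H H' < \<epsilon> / 2} H') = real (card Z)"
      using finQ by (simp add: Z_def indicator_def sum.If_cases Int_def conj_commute)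
    also have "\<dots> \<le> K1"
    proof (cases "Z = {}")
      case True
      thus ?thesis using assms(3) by simp
    next
      case False
      then obtain H0 where H0: "H0 \<in> Z" by blast
      have half: "real (card (sym_diff H H')) < \<epsilon> / 2 * real m" if "H \<in> Z" for H
      proof -
        have "card H = m" using that Q(1) card_planted by (auto simp: Z_def)
        thus ?thesis using that Q(2) by (simp add: Z_def reconstruction_error_def field_simps)
      qed
      have "Z \<subseteq> near n \<epsilon> H0 G"
      proof
        fix H assume H: "H \<in> Z"
        have HP: "H \<in> planted_in n m G" "H0 \<in> planted_in n m G" using H H0 Q(1) by (auto simp: Z_def)
        have fin: "finite H" "finite H0" "finite H'" using HP card_planted assms(2)[OF H'] by auto
        have "card (sym_diff H0 H) \<le> card (sym_diff H0 H' \<union> sym_diff H H')"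
          using fin by (intro card_mono) auto
        also have "\<dots> \<le> card (sym_diff H0 H') + card (sym_diff H H')" by (rule card_Un_le)
        finally have "real (card (sym_diff H0 H)) \<le> real (card (sym_diff H0 H') + card (sym_diff H H'))"
          by (rule of_nat_mono)
        also have "\<dots> < \<epsilon> * real m" using half[OF H] half[OF H0] by simp
        finally show "H \<in> near n \<epsilon> H0 G" using HP card_planted[OF HP(2)] by (simp add: near_def)
      qed
      hence "card Z \<le> card (near n \<epsilon> H0 G)" by (rule card_mono[OF finite_near])
      hence "real (card Z) \<le> real (card (near n \<epsilon> H0 G))" by (rule of_nat_mono)
      also have "\<dots> \<le> K1" using Q(3) H0 by (simp add: Z_def)
      finally show ?thesis .
    qed
    finally show ?thesis .
  qed
  have "(\<Sum>H\<in>Q. measure_pmf.prob M {H'. reconstruction_error H H' < \<epsilon> / 2}) =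
      (\<Sum>H\<in>Q. \<integral>H'. indicat_real {H'. reconstruction_error H H' < \<epsilon> / 2} H' \<partial>measure_pmf M)" by simp
  also have "\<dots> = (\<integral>H'. (\<Sum>H\<in>Q. indicat_real {H'. reconstruction_error H H' < \<epsilon> / 2} H') \<partial>measure_pmf M)"
    by (rule Bochner_Integration.integral_sum[symmetric]) (rule integrable_measure_pmf_finite[OF assms(1)])
  also have "\<dots> \<le> (\<integral>H'. K1 \<partial>measure_pmf M)"
    using point by (intro integral_mono_AE integrable_measure_pmf_finite[OF assms(1)]) (auto simp: AE_measure_pmf_iff)
  finally show ?thesis by simp
qed

text \<open>Off the two exceptional events, at least \<open>K2\<close> equally likely candidates
  share a total hit probability of at most \<open>K1\<close>.\<close>

lemma success_bound:
  assumes est: "est \<in> estimators n" and m: "m = nat \<lfloor>del * real n\<rfloor>" "m \<le> n" "3 \<le> m"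
    and p: "0 \<le> lam / real n" "lam / real n \<le> 1" and K: "0 \<le> K1" "0 < K2"
  shows "measure_pmf.prob (planted_and_estimate n lam del est) {(H, H'). reconstruction_error H H' < \<epsilon> / 2} \<le>
    K1 / K2 + measure_pmf.prob (planted_joint n m (lam / real n)) {(H, G). K1 < real (card (near n \<epsilon> H G))} +
    measure_pmf.prob (planted_joint n m (lam / real n)) {(H, G). \<not> K2 \<le> real (card (planted_in n m G))}"
proof -
  let ?J = "planted_joint n m (lam / real n)"
  define f where "f = (\<lambda>(H, G). measure_pmf.prob (est G) {H'. reconstruction_error H H' < \<epsilon> / 2})"
  define B1 where "B1 = {(H, G). K1 < real (card (near n \<epsilon> H G))}"
  define B2 where "B2 = {(H :: edge_set, G). \<not> K2 \<le> real (card (planted_in n m G))}"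
  define g where "g = (\<lambda>a. if a \<in> B1 \<union> B2 then 0 else f a)"
  have f01: "0 \<le> f a" "f a \<le> 1" for a by (auto simp: f_def split: prod.splits)
  have "finite (Pow (complete_edges n) \<times> Pow (complete_edges n))" using finite_complete_edges by simp
  moreover have "set_pmf ?J \<subseteq> Pow (complete_edges n) \<times> Pow (complete_edges n)"
    using set_planted_joint[OF m(2,3)] by (fastforce simp: planted_in_def)
  ultimately have finJ: "finite (set_pmf ?J)" by (rule finite_subset[rotated])
  note intJ = integrable_measure_pmf_finite[OF finJ]
  have "planted_and_estimate n lam del est = bind_pmf ?J (\<lambda>(H, G). map_pmf (\<lambda>H'. (H, H')) (est G))"
    using planted_cycles_alt[of del n lam] m
    by (simp add: planted_and_estimate_def planted_joint_def map_pmf_def)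
  hence "measure_pmf.prob (planted_and_estimate n lam del est) {(H, H'). reconstruction_error H H' < \<epsilon> / 2} =
      measure_pmf.expectation ?J f"
    by (simp add: prob_bind_pmf f_def case_prod_unfold vimage_def)
  also have "\<dots> \<le> (\<integral>a. g a + indicat_real B1 a + indicat_real B2 a \<partial>measure_pmf ?J)"
  proof (intro integral_mono intJ)
    show "f a \<le> g a + indicat_real B1 a + indicat_real B2 a" for a
      using f01(2)[of a] by (cases "a \<in> B1"; cases "a \<in> B2") (auto simp: g_def)
  qed
  also have "\<dots> = measure_pmf.expectation ?J g + measure_pmf.prob ?J B1 + measure_pmf.prob ?J B2"
    by (simp add: Bochner_Integration.integral_add[OF intJ intJ])
  also have "measure_pmf.expectation ?J g \<le> K1 / K2"
  proof (rule posterior_average[OF m(2,3) p])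
    fix G assume G: "G \<subseteq> complete_edges n"
    show "(\<Sum>H\<in>planted_in n m G. g (H, G)) \<le> K1 / K2 * real (card (planted_in n m G))"
    proof (cases "K2 \<le> real (card (planted_in n m G))")
      case False
      hence "g (H, G) = 0" for H by (simp add: g_def B2_def)
      thus ?thesis using K by simp
    next
      case True
      define Q where "Q = {H \<in> planted_in n m G. real (card (near n \<epsilon> H G)) \<le> K1}"
      have gv: "g (H, G) = (if real (card (near n \<epsilon> H G)) \<le> K1 then f (H, G) else 0)" for H
        using True by (auto simp: g_def B1_def B2_def)
      have sub: "set_pmf (est G) \<subseteq> Pow (complete_edges n)" using est G by (auto simp: estimators_def)
      have "(\<Sum>H\<in>planted_in n m G. g (H, G)) = (\<Sum>H\<in>Q. f (H, G))"
        unfolding gv Q_def by (rule sum.inter_filter[symmetric]) (rule finite_planted_in)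
      also have "\<dots> \<le> K1"
        unfolding f_def prod.case
      proof (rule estimate_hits[where n = n and m = m and G = G])
        show "finite (set_pmf (est G))" using sub finite_complete_edges by (meson finite_Pow_iff finite_subset)
        show "finite H'" if "H' \<in> set_pmf (est G)" for H'
          using that sub finite_complete_edges finite_subset by blast
      qed (use K m(3) in \<open>auto simp: Q_def\<close>)
      also have "\<dots> = K1 / K2 * K2" using K by simp
      also have "\<dots> \<le> K1 / K2 * real (card (planted_in n m G))" using True K by (intro mult_left_mono) auto
      finally show ?thesis .
    qed
  qed
  finally show ?thesis by (simp add: B1_def B2_def)
qed

text \<open>A close candidate is determined by \<open>H - H'\<close>, a small subset of
  \<open>H\<close>, and \<open>H' - H\<close>, a small subset of the random edges.
  \<open>card_small_subsets\<close> reduces a crowded ball to an unusually large \<open>X\<close>,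
  and \<open>random_subset_tail\<close> excludes that.\<close>

lemma near_prob:
  fixes y :: real
  assumes H: "two_regular V H" "V \<subseteq> {1..n}" and p: "0 \<le> p" "p \<le> 1" and y: "0 < y" "y \<le> 1" and K1: "0 < K1"
    and t: "\<epsilon> * real (card V) \<le> real t"
  shows "measure_pmf.prob (random_subset (complete_edges n) p) {X. K1 < real (card (near n \<epsilon> H (X \<union> H)))}
    \<le> (1 + y * p) ^ card (complete_edges n) * (1 + y) ^ card V / (K1 * y ^ (2 * t))"
proof -
  have cH: "card H = card V" "finite H" using two_regular_card[OF H(1)] two_regular_finite[OF H(1)] by auto
  define s where "s = K1 * y ^ (2 * t) / (1 + y) ^ card V"
  have s: "s > 0" using K1 y by (simp add: s_def)
  have "measure_pmf.prob (random_subset (complete_edges n) p) {X. K1 < real (card (near n \<epsilon> H (X \<union> H)))} \<le>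
      measure_pmf.prob (random_subset (complete_edges n) p) {X. s \<le> (1 + y) ^ card X}"
  proof (rule prob_mono_support)
    fix X assume X: "X \<in> set_pmf (random_subset (complete_edges n) p)"
      and "X \<in> {X. K1 < real (card (near n \<epsilon> H (X \<union> H)))}"
    hence big: "K1 < real (card (near n \<epsilon> H (X \<union> H)))" by simp
    have "X \<in> Pow (complete_edges n)" by (rule subsetD[OF set_random_subset[OF finite_complete_edges] X])
    hence fX: "finite X" by (intro finite_subset[OF _ finite_complete_edges]) simp
    let ?A = "{D. D \<subseteq> H \<and> card D \<le> t}" and ?B = "{D. D \<subseteq> X \<and> card D \<le> t}"
    have "card (near n \<epsilon> H (X \<union> H)) \<le> card (?A \<times> ?B)"
    proof (rule card_inj_on_le)
      show "inj_on (\<lambda>H'. (H - H', H' - H)) (near n \<epsilon> H (X \<union> H))"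
      proof (rule inj_onI)
        fix H1 H2 assume "(H - H1, H1 - H) = (H - H2, H2 - H)"
        hence eq: "H - H1 = H - H2" "H1 - H = H2 - H" unfolding prod.inject by (rule conjunct1, rule conjunct2)
        have split: "U = (H - (H - U)) \<union> (U - H)" for U :: edge_set by blast
        have "H1 = (H - (H - H1)) \<union> (H1 - H)" by (rule split)
        also have "\<dots> = (H - (H - H2)) \<union> (H2 - H)" by (simp only: eq)
        also have "\<dots> = H2" by (rule split[symmetric])
        finally show "H1 = H2" .
      qed
      show "finite (?A \<times> ?B)" using cH(2) fX by simp
      show "(\<lambda>H'. (H - H', H' - H)) ` near n \<epsilon> H (X \<union> H) \<subseteq> ?A \<times> ?B"
      proof (rule image_subsetI)
        fix H' assume H': "H' \<in> near n \<epsilon> H (X \<union> H)"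
        hence P: "H' \<in> planted_in n (card H) (X \<union> H)" "real (card (sym_diff H H')) < \<epsilon> * real (card H)"
          by (auto simp: near_def)
        have "finite H'" using card_planted[OF P(1)] by simp
        hence fs: "finite (sym_diff H H')" using cH(2) by simp
        have "real (card (sym_diff H H')) < real t" using P(2) t cH(1) by simp
        hence c: "card (sym_diff H H') \<le> t" by simp
        have "card (H - H') \<le> t" "card (H' - H) \<le> t"
          using card_mono[OF fs, of "H - H'"] card_mono[OF fs, of "H' - H"] c by auto
        moreover have "H' - H \<subseteq> X" using P(1) by (auto simp: planted_in_def)
        ultimately show "(H - H', H' - H) \<in> ?A \<times> ?B" by simp
      qed
    qed
    hence "real (card (near n \<epsilon> H (X \<union> H))) \<le> real (card ?A) * real (card ?B)"
      using of_nat_mono[of "card (near n \<epsilon> H (X \<union> H))" "card (?A \<times> ?B)", where 'a = real]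
      by (simp add: card_cartesian_product)
    hence "K1 \<le> real (card ?A) * real (card ?B)" using big by linarith
    hence "K1 * y ^ (2 * t) \<le> (real (card ?A) * real (card ?B)) * y ^ (2 * t)"
      using y by (intro mult_right_mono) auto
    also have "\<dots> = (real (card ?A) * y ^ t) * (real (card ?B) * y ^ t)"
    proof -
      have "y ^ (2 * t) = y ^ t * y ^ t" by (simp only: mult_2 power_add)
      thus ?thesis by (simp only: mult_ac)
    qed
    also have "\<dots> \<le> (1 + y) ^ card H * (1 + y) ^ card X"
      using card_small_subsets[OF cH(2) y, of t] card_small_subsets[OF fX y, of t] y by (intro mult_mono) auto
    finally show "X \<in> {X. s \<le> (1 + y) ^ card X}" using y by (simp add: s_def cH(1) field_simps)
  qed
  also have "\<dots> \<le> (1 + y * p) ^ card (complete_edges n) / s"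
    using random_subset_tail[OF finite_complete_edges p _ s] y by simp
  finally show ?thesis by (simp add: s_def)
qed

section \<open>Short planted cycles and the final estimates\<close>

lemma many_components_antimono:
  assumes "k' \<le> k" shows "many_components j k V \<subseteq> many_components j k' V"
proof
  fix H assume "H \<in> many_components j k V"
  then obtain F where F: "two_regular V H" "closed_family j V H F" "card F = k" by (auto simp: many_components_def)
  obtain F' where F': "F' \<subseteq> F" "card F' = k'" "finite F'" using obtain_subset_with_card_n[of k' F] F(3) assms by auto
  have "disjoint F'" using F(2) F'(1) pairwise_subset by (auto simp: closed_family_def)
  thus "H \<in> many_components j k' V"
    using F F' by (intro many_componentsI[of V H F']) (auto simp: closed_family_def)
qed

text \<open>Writing \<open>\<Union>H\<close> for the planted vertex set makes this an event about
  \<open>H\<close> alone. The exponent is taken at the largest size \<open>D\<close> for all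
  \<open>j\<close>.\<close>

lemma short_cycles_prob:
  assumes m: "m \<le> n" "3 \<le> m" and D: "D * k + D \<le> m"
  shows "measure_pmf.prob (planted_two_factor n m) {H. \<exists>j\<in>{1..D}. H \<in> many_components j k (\<Union>H)}
    \<le> real D * ((2 ^ 2 ^ D * 2 ^ D) ^ k / fact k)"
  unfolding planted_two_factor_def
proof (rule prob_bind_le)
  fix V assume "V \<in> set_pmf (pmf_of_set {V. V \<subseteq> {1..n} \<and> card V = m})"
  hence V: "V \<subseteq> {1..n}" "card V = m" using set_pmf_of_set[OF vertex_sets(2,1)[OF m(1)]] by auto
  hence fV: "finite V" using finite_subset by blast
  define C :: real where "C = (2 ^ 2 ^ D * 2 ^ D) ^ k / fact k"
  let ?T = "two_regulars V" and ?B = "{H. \<exists>j\<in>{1..D}. H \<in> many_components j k (\<Union>H)}"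
  have T: "finite ?T" "?T \<noteq> {}" using finite_two_regulars[OF fV] two_regulars_nonempty[OF fV] V m(2) by auto
  hence cT: "real (card ?T) > 0" by (simp add: card_gt_0_iff)
  have mT: "many_components j k V \<subseteq> ?T" for j by (auto simp: many_components_def two_regulars_def)
  have "?T \<inter> ?B \<subseteq> (\<Union>j\<in>{1..D}. many_components j k V)"
    using two_regular_Union by (auto simp: two_regulars_def)
  hence "card (?T \<inter> ?B) \<le> card (\<Union>j\<in>{1..D}. many_components j k V)"
    using finite_subset[OF mT T(1)] by (intro card_mono) auto
  also have "\<dots> \<le> (\<Sum>j\<in>{1..D}. card (many_components j k V))" by (rule card_UN_le) simp
  finally have "real (card (?T \<inter> ?B)) \<le> real (\<Sum>j\<in>{1..D}. card (many_components j k V))" by (rule of_nat_mono)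
  also have "\<dots> = (\<Sum>j\<in>{1..D}. real (card (many_components j k V)))" by simp
  also have "\<dots> \<le> (\<Sum>j\<in>{1..D}. C * real (card ?T))"
  proof (rule sum_mono)
    fix j assume j: "j \<in> {1..D}"
    have "j * k + j \<le> D * k + D" using j by (intro add_mono mult_le_mono1) auto
    hence "real (card (many_components j k V)) \<le> (2 ^ 2 ^ j * 2 ^ j) ^ k / fact k * real (card ?T)"
      using D V by (intro card_many_components fV) simp
    also have "(2::real) ^ 2 ^ j \<le> 2 ^ 2 ^ D" "(2::real) ^ j \<le> 2 ^ D"
      using j by (intro power_increasing; simp)+
    hence "(2 ^ 2 ^ j * 2 ^ j) ^ k / fact k * real (card ?T) \<le> C * real (card ?T)"
      unfolding C_def by (intro mult_right_mono divide_right_mono power_mono mult_mono) simp_all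
    finally show "real (card (many_components j k V)) \<le> C * real (card ?T)" .
  qed
  also have "\<dots> = real D * C * real (card ?T)" by simp
  finally have "real (card (?T \<inter> ?B)) / real (card ?T) \<le> real D * C"
    using cT by (simp only: pos_divide_le_eq)
  thus "measure_pmf.prob (pmf_of_set ?T) ?B \<le> real D * ((2 ^ 2 ^ D * 2 ^ D) ^ k / fact k)"
    unfolding measure_pmf_of_set[OF T(2,1), of ?B] by (simp only: C_def)
qed simp

text \<open>\<open>(2 * C) ^ k / fact k\<close> is a single term of the series of
  \<open>exp (2 * C)\<close>.\<close>

lemma power_div_fact_le:
  fixes C :: real
  assumes "0 \<le> C"
  shows "C ^ k / fact k \<le> exp (2 * C) * (1 / 2) ^ k"
proof -
  have "(2 * C) ^ k / fact k \<le> (\<Sum>i\<le>k. (2 * C) ^ i / fact i)" using assms by (intro member_le_sum) auto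
  also have "\<dots> \<le> exp (2 * C)"
    using sum_le_suminf[OF summable_exp[of "2 * C"], of "{..k}"] assms
    by (simp add: exp_def scaleR_conv_of_real field_simps inverse_eq_divide)
  finally have "(2 * C) ^ k / fact k * (1 / 2) ^ k \<le> exp (2 * C) * (1 / 2) ^ k" by (rule mult_right_mono) simp
  thus ?thesis by (simp add: power_mult_distrib power_divide)
qed

text \<open>From \<open>ln x \<le> 4 * x^(1/4)\<close> one gets
  \<open>(ln n)^2 \<le> 16 * sqrt n\<close>, eventually less than half of \<open>c * n\<close>; the
  other half absorbs \<open>ln A\<close>.\<close>

lemma exp_linear_le_powr_ln:
  fixes A c :: real
  assumes "0 < A" "0 < c"
  shows "\<forall>\<^sub>F n in sequentially. A * exp (- c * real n) \<le> real n powr (- 1 * ln (real n))"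
proof (rule eventually_sequentiallyI[of "nat \<lceil>1 + (32 / c)\<^sup>2 + 2 * \<bar>ln A\<bar> / c\<rceil>"])
  fix n :: nat assume "nat \<lceil>1 + (32 / c)\<^sup>2 + 2 * \<bar>ln A\<bar> / c\<rceil> \<le> n"
  hence n0: "1 + (32 / c)\<^sup>2 + 2 * \<bar>ln A\<bar> / c \<le> real n" by linarith
  have "0 \<le> (32 / c)\<^sup>2" "0 \<le> 2 * \<bar>ln A\<bar> / c" using assms by auto
  hence n: "1 \<le> real n" "(32 / c)\<^sup>2 \<le> real n" "2 * \<bar>ln A\<bar> / c \<le> real n" using n0 by linarith+
  have "32 / c \<le> sqrt (real n)" using n(2) by (rule real_le_rsqrt)
  hence "32 \<le> c * sqrt (real n)" using assms(2) by (simp add: field_simps)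
  hence "32 * sqrt (real n) \<le> c * sqrt (real n) * sqrt (real n)" by (rule mult_right_mono) simp
  also have "c * sqrt (real n) * sqrt (real n) = c * real n" by (simp add: mult.assoc)
  finally have sq: "16 * sqrt (real n) \<le> c * real n / 2" by simp
  have "ln (real n) \<le> real n powr (1 / 4) / (1 / 4)" using n(1) by (intro ln_powr_bound) auto
  moreover have "0 \<le> ln (real n)" using n(1) by simp
  ultimately have "(ln (real n))\<^sup>2 \<le> (real n powr (1 / 4) / (1 / 4))\<^sup>2" by (intro power_mono)
  also have "\<dots> = 16 * (real n powr (1 / 4) * real n powr (1 / 4))" by (simp add: power2_eq_square)
  also have "real n powr (1 / 4) * real n powr (1 / 4) = sqrt (real n)"
    unfolding powr_add[symmetric] using n(1) by (simp add: powr_half_sqrt)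
  finally have "(ln (real n))\<^sup>2 \<le> c * real n / 2" using sq by linarith
  moreover have "ln A \<le> c * real n / 2"
  proof -
    have "2 * \<bar>ln A\<bar> \<le> c * real n" using n(3) assms(2) by (simp add: field_simps)
    thus ?thesis by linarith
  qed
  ultimately have "ln A + - c * real n \<le> - 1 * ln (real n) * ln (real n)" by (simp add: power2_eq_square)
  hence "exp (ln A + - c * real n) \<le> exp (- 1 * ln (real n) * ln (real n))"
    by (simp only: exp_le_cancel_iff)
  moreover have "exp (ln A + - c * real n) = A * exp (- c * real n)" using assms(1) by (simp only: exp_add exp_ln)
  moreover have "exp (- 1 * ln (real n) * ln (real n)) = real n powr (- 1 * ln (real n))"
    using n(1) by (simp add: powr_def)
  ultimately show "A * exp (- c * real n) \<le> real n powr (- 1 * ln (real n))" by metis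
qed

text \<open>With at least \<open>exp (c * n)\<close> candidates and at most
  \<open>exp (c * n / 2)\<close> of them in the ball, the success probability is exponentially
  small; both exceptions are exponentially rare as well.\<close>

lemma estimation_fails:
  fixes lam del :: real
  assumes "0 < del" "del \<le> 1" "0 < lam"
    and "lam * (sqrt (2 * del) + sqrt (1 - del))\<^sup>2 > 1"
  shows "\<exists>\<epsilon>>0. \<exists>A>0. \<exists>c>0. \<forall>\<^sub>F n in sequentially. \<forall>est\<in>estimators n.
    measure_pmf.prob (planted_and_estimate n lam del est) {(H, H'). reconstruction_error H H' < \<epsilon> / 2}
    \<le> A * exp (- c * real n)"
proof -
  obtain c \<eta>0 D0 where c: "c > 0" "\<eta>0 > 0" and ev: "\<forall>\<^sub>F n in sequentially. \<forall>V H. V \<subseteq> {1..n} \<longrightarrow>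
    card V = nat \<lfloor>del * real n\<rfloor> \<longrightarrow> two_regular V H \<longrightarrow>
    (\<forall>j\<in>{1..D0}. H \<notin> many_components j (nat \<lfloor>\<eta>0 * real n\<rfloor>) V) \<longrightarrow>
    measure_pmf.prob (random_subset (complete_edges n) (lam / real n))
      {X. \<not> exp (c * real n) \<le> real (card (planted_in n (card V) (H \<union> X)))} \<le> 2 * exp (- c * real n)"
    using many_factors[OF assms] by blast
  define D where "D = Suc D0"
  \<comment> \<open>Also bounding \<open>\<eta>\<close> by \<open>del / (2 * D)\<close> makes
    \<open>D * k + D \<le> m\<close>, as the component count requires; excluding fewer components
    excludes the larger number for \<open>\<eta>0\<close> too. \<open>D\<close> is a successor so
    that this quotient makes sense.\<close>
  define \<eta> where "\<eta> = min \<eta>0 (del / (2 * real D))"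
  have eta: "0 < \<eta>" "\<eta> \<le> \<eta>0" "real D * \<eta> \<le> del / 2"
  proof -
    have D: "real D > 0" by (simp add: D_def)
    show "0 < \<eta>" using c assms(1) D by (simp add: \<eta>_def)
    show "\<eta> \<le> \<eta>0" by (simp add: \<eta>_def)
    have "real D * \<eta> \<le> real D * (del / (2 * real D))" using D by (intro mult_left_mono) (auto simp: \<eta>_def)
    thus "real D * \<eta> \<le> del / 2" using D by simp
  qed
  \<comment> \<open>The factors \<open>1 + y\<close> cost \<open>y * (lam + 1) \<le> c / 8\<close>
    in the exponent. Then \<open>\<epsilon>\<close> is chosen such that
    \<open>y^(- 2 * \<epsilon> * n)\<close> costs another \<open>c / 8\<close>; out of the
    \<open>c / 2\<close> from the ball size, \<open>c / 4\<close> remains.\<close>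
  define y where "y = min (1 / 2) (c / (8 * (lam + 1)))"
  have y: "0 < y" "y < 1" "y * (lam + 1) \<le> c / 8"
  proof -
    show "0 < y" "y < 1" using c assms(3) by (auto simp: y_def)
    have "y * (lam + 1) \<le> c / (8 * (lam + 1)) * (lam + 1)" using assms(3) by (intro mult_right_mono) (auto simp: y_def)
    also have "\<dots> = c / 8" using assms(3) by (simp add: field_simps)
    finally show "y * (lam + 1) \<le> c / 8" .
  qed
  have lny: "ln y < 0" using y by simp
  define \<epsilon> where "\<epsilon> = c / (16 * (- ln y))"
  have eps: "\<epsilon> > 0" "2 * \<epsilon> * (- ln y) = c / 8" using c lny by (auto simp: \<epsilon>_def field_simps)
  define C :: real where "C = 2 ^ 2 ^ D * 2 ^ D"
  define c' where "c' = min (c / 4) (\<eta> * ln 2)"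
  have c': "0 < c'" "c' \<le> c / 4" "c' \<le> \<eta> * ln 2" using c eta by (auto simp: c'_def)
  define A where "A = 3 + 1 / y ^ 2 + 2 * real D * exp (2 * C)"
  have "C \<ge> 0" by (simp add: C_def)
  hence A: "A > 0" by (auto simp: A_def intro!: add_pos_nonneg)
  define n0 where "n0 = 1 + lam + 4 / del + 2 * (real D + 1) / del"
  have "\<forall>\<^sub>F n in sequentially. n0 \<le> real n"
    by (rule eventually_sequentiallyI[of "nat \<lceil>n0\<rceil>"]) linarith
  with ev have "\<forall>\<^sub>F n in sequentially. \<forall>est\<in>estimators n.
    measure_pmf.prob (planted_and_estimate n lam del est) {(H, H'). reconstruction_error H H' < \<epsilon> / 2}
    \<le> A * exp (- c' * real n)"
  proof (eventually_elim, intro ballI)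
    fix n est
    assume main: "\<forall>V H. V \<subseteq> {1..n} \<longrightarrow> card V = nat \<lfloor>del * real n\<rfloor> \<longrightarrow> two_regular V H \<longrightarrow>
      (\<forall>j\<in>{1..D0}. H \<notin> many_components j (nat \<lfloor>\<eta>0 * real n\<rfloor>) V) \<longrightarrow>
      measure_pmf.prob (random_subset (complete_edges n) (lam / real n))
        {X. \<not> exp (c * real n) \<le> real (card (planted_in n (card V) (H \<union> X)))} \<le> 2 * exp (- c * real n)"
      and n0: "n0 \<le> real n" and est: "est \<in> estimators n"
    have "0 \<le> 4 / del" "0 \<le> 2 * (real D + 1) / del" using assms(1) by auto
    hence n: "1 \<le> real n" "lam \<le> real n" "4 / del \<le> real n" "2 * (real D + 1) / del \<le> real n"
      using n0 assms(3) unfolding n0_def by linarith+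
    define m where "m = nat \<lfloor>del * real n\<rfloor>"
    define p where "p = lam / real n"
    define k where "k = nat \<lfloor>\<eta> * real n\<rfloor>"
    \<comment> \<open>Rounding up costs the constant factor \<open>1 / y ^ 2\<close>, which is put
      into \<open>A\<close>.\<close>
    define t where "t = nat \<lfloor>\<epsilon> * real n\<rfloor> + 1"
    have p: "0 \<le> p" "p \<le> 1" "p * real n = lam" using assms(3) n by (auto simp: p_def)
    have mr: "real m \<le> del * real n" "del * real n - 1 \<le> real m" using assms(1) by (auto simp: m_def)
    have mn: "real m \<le> real n"
      using mr(1) mult_right_mono[OF assms(2), of "real n"] by simp
    have m: "m \<le> n" "3 \<le> m"
    proof -
      show "m \<le> n" using mn by simp
      have "4 \<le> del * real n" using n(3) assms(1) by (simp add: field_simps)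
      thus "3 \<le> m" using mr(2) by linarith
    qed
    have Dk: "D * k + D \<le> m"
    proof -
      have "real k \<le> \<eta> * real n" using eta(1) by (simp add: k_def)
      hence "real D * real k \<le> real D * (\<eta> * real n)" by (rule mult_left_mono) simp
      also have "\<dots> \<le> del / 2 * real n" using mult_right_mono[OF eta(3), of "real n"] by (simp only: mult.assoc)
      also have "\<dots> = (del * real n) / 2" by simp
      finally have "real D * real k \<le> (del * real n) / 2" .
      moreover have "2 * (real D + 1) \<le> del * real n" using n(4) assms(1) by (simp add: field_simps)
      moreover have "z + d \<le> u" if "z \<le> x / 2" "2 * (d + 1) \<le> x" "x - 1 \<le> u" for z d x u :: real
        using that by (simp add: field_simps)
      ultimately have "real D * real k + real D \<le> real m" using mr(2) by blast
      hence "real (D * k + D) \<le> real m" by simp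
      thus ?thesis by (rule of_nat_le_iff[THEN iffD1])
    qed
    let ?J = "planted_joint n m p" and ?R = "random_subset (complete_edges n) p"
    have e1: "exp (c * real n / 2) / exp (c * real n) \<le> exp (- c' * real n)"
    proof -
      have "c' * real n \<le> c / 2 * real n" using c'(2) c(1) by (intro mult_right_mono) auto
      thus ?thesis by (simp add: exp_diff[symmetric])
    qed
    have nearJ: "measure_pmf.prob ?J {(H, G). exp (c * real n / 2) < real (card (near n \<epsilon> H G))} \<le>
        exp (- c' * real n) / y ^ 2"
      unfolding planted_joint_def
    proof (rule prob_bind_le)
      fix H assume "H \<in> set_pmf (planted_two_factor n m)"
      then obtain V where V: "V \<subseteq> {1..n}" "card V = m" "two_regular V H"
        using set_planted_two_factor[OF m] by blast
      have "\<epsilon> * real m \<le> \<epsilon> * real n" using mn eps(1) by (intro mult_left_mono) auto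
      hence t: "\<epsilon> * real (card V) \<le> real t" unfolding V(2) t_def by linarith
      have "measure_pmf.prob (map_pmf (\<lambda>X. (H, X \<union> H)) ?R) {(H, G). exp (c * real n / 2) < real (card (near n \<epsilon> H G))} =
          measure_pmf.prob ?R {X. exp (c * real n / 2) < real (card (near n \<epsilon> H (X \<union> H)))}"
        by (simp add: vimage_def)
      also have "\<dots> \<le> (1 + y * p) ^ card (complete_edges n) * (1 + y) ^ card V / (exp (c * real n / 2) * y ^ (2 * t))"
        using y by (intro near_prob[OF V(3,1) p(1,2) _ _ _ t]) auto
      also have "\<dots> \<le> exp (y * lam * real n) * exp (y * real n) / (exp (c * real n / 2) * (y ^ 2 * exp (- (c / 8 * real n))))"
      proof (intro frac_le mult_mono)
        have "(1 + y * p) ^ card (complete_edges n) \<le> exp (y * p) ^ card (complete_edges n)"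
          using y p by (intro power_mono) (auto intro: add_nonneg_nonneg)
        also have "\<dots> \<le> exp (y * p) ^ (n * n)"
          using y p by (intro power_increasing card_complete_edges_le) auto
        also have "\<dots> = exp (real (n * n) * (y * p))" by (rule exp_of_nat_mult[symmetric])
        also have "real (n * n) * (y * p) = y * (p * real n) * real n" by simp
        finally show "(1 + y * p) ^ card (complete_edges n) \<le> exp (y * lam * real n)" by (simp only: p(3))
        have "(1 + y) ^ card V \<le> exp y ^ card V" using y by (intro power_mono) auto
        also have "\<dots> = exp (real m * y)" by (simp only: exp_of_nat_mult V(2))
        also have "\<dots> \<le> exp (y * real n)" using mn y by (simp add: mult.commute)
        finally show "(1 + y) ^ card V \<le> exp (y * real n)" .
        show "y ^ 2 * exp (- (c / 8 * real n)) \<le> y ^ (2 * t)"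
        proof -
          define s where "s = nat \<lfloor>\<epsilon> * real n\<rfloor>"
          have s: "real s \<le> \<epsilon> * real n" using eps(1) by (simp add: s_def)
          have "c / 8 * real n = 2 * (\<epsilon> * real n) * (- ln y)" by (simp only: eps(2)[symmetric] mult_ac)
          also have "\<dots> \<ge> 2 * real s * (- ln y)" using s lny by (intro mult_right_mono) auto
          finally have "exp (- (c / 8 * real n)) \<le> exp (real (2 * s) * ln y)" by simp
          also have "\<dots> = y ^ (2 * s)" unfolding exp_of_nat_mult using y by simp
          finally have "y ^ 2 * exp (- (c / 8 * real n)) \<le> y ^ 2 * y ^ (2 * s)" using y by (intro mult_left_mono) auto
          also have "\<dots> = y ^ (2 * t)" by (simp add: t_def s_def power_add[symmetric])
          finally show ?thesis .
        qed
      qed (use y p in auto)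
      also have "\<dots> = exp (y * lam * real n + y * real n - c * real n / 2 + c / 8 * real n) / y ^ 2"
      proof -
        have "exp a * exp b / (exp u * (z * exp (- v))) = exp (a + b - u + v) / z" for a b u v z :: real
          by (simp add: exp_add exp_diff exp_minus divide_simps)
        thus ?thesis .
      qed
      also have "\<dots> \<le> exp (- c' * real n) / y ^ 2"
      proof (intro divide_right_mono, subst exp_le_cancel_iff)
        have "y * (lam + 1) * real n \<le> c / 8 * real n" using y(3) by (rule mult_right_mono) simp
        moreover have "c' * real n \<le> c / 4 * real n" using c'(2) by (rule mult_right_mono) simp
        ultimately show "y * lam * real n + y * real n - c * real n / 2 + c / 8 * real n \<le> - c' * real n"
          by (simp add: algebra_simps)
      qed simp
      finally show "measure_pmf.prob (map_pmf (\<lambda>X. (H, X \<union> H)) ?R)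
          {(H, G). exp (c * real n / 2) < real (card (near n \<epsilon> H G))} \<le> exp (- c' * real n) / y ^ 2" .
    qed simp
    let ?B = "{H. \<exists>j\<in>{1..D}. H \<in> many_components j k (\<Union>H)}"
    have badH: "measure_pmf.prob (planted_two_factor n m) ?B \<le> 2 * real D * exp (2 * C) * exp (- c' * real n)"
    proof -
      have "measure_pmf.prob (planted_two_factor n m) ?B \<le> real D * (C ^ k / fact k)"
        unfolding C_def by (rule short_cycles_prob[OF m Dk])
      also have "\<dots> \<le> real D * (exp (2 * C) * (1 / 2) ^ k)"
        using \<open>C \<ge> 0\<close> by (intro mult_left_mono power_div_fact_le) auto
      also have "(1 / 2 :: real) ^ k \<le> 2 * exp (- c' * real n)"
      proof -
        have "\<eta> * real n - 1 \<le> real k" unfolding k_def by linarith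
        hence "(\<eta> * real n - 1) * ln 2 \<le> real k * ln 2" by (intro mult_right_mono) auto
        moreover have "c' * real n \<le> \<eta> * ln 2 * real n" using c'(3) by (rule mult_right_mono) simp
        ultimately have "- (real k * ln 2) \<le> ln 2 - c' * real n" by (simp add: algebra_simps)
        hence "exp (- (real k * ln 2)) \<le> exp (ln 2 - c' * real n)" by simp
        also have "exp (- (real k * ln 2)) = (1 / 2) ^ k"
          unfolding exp_minus exp_of_nat_mult by (simp add: power_divide inverse_eq_divide)
        finally show ?thesis by (simp add: exp_diff exp_minus field_simps)
      qed
      hence "real D * (exp (2 * C) * (1 / 2) ^ k) \<le> real D * (exp (2 * C) * (2 * exp (- c' * real n)))"
        by (intro mult_left_mono) auto
      finally show ?thesis by (simp add: mult_ac)
    qed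
    have fewJ: "measure_pmf.prob ?J {(H, G). \<not> exp (c * real n) \<le> real (card (planted_in n m G))} \<le>
        2 * real D * exp (2 * C) * exp (- c' * real n) + 2 * exp (- c' * real n)"
    proof -
      have "measure_pmf.prob ?J {(H, G). \<not> exp (c * real n) \<le> real (card (planted_in n m G))} \<le>
        measure_pmf.prob (planted_two_factor n m) ?B + 2 * exp (- c' * real n)"
        unfolding planted_joint_def
      proof (rule prob_bind_le_except)
        fix H assume "H \<in> set_pmf (planted_two_factor n m)" and good: "H \<notin> ?B"
        then obtain V where V: "V \<subseteq> {1..n}" "card V = m" "two_regular V H"
          using set_planted_two_factor[OF m] by blast
        have "k \<le> nat \<lfloor>\<eta>0 * real n\<rfloor>"
          unfolding k_def using mult_right_mono[OF eta(2), of "real n"] by (intro nat_mono floor_mono) simp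
        note sub = many_components_antimono[OF this]
        have few: "\<forall>j\<in>{1..D0}. H \<notin> many_components j (nat \<lfloor>\<eta>0 * real n\<rfloor>) V"
        proof (intro ballI notI)
          fix j assume j: "j \<in> {1..D0}" and "H \<in> many_components j (nat \<lfloor>\<eta>0 * real n\<rfloor>) V"
          hence "H \<in> many_components j k (\<Union>H)"
            unfolding two_regular_Union[OF V(3)] by (intro subsetD[OF sub])
          moreover have "j \<in> {1..D}" using j by (simp add: D_def)
          ultimately have "H \<in> ?B" by (intro CollectI bexI)
          thus False using good by (rule notE[rotated])
        qed
        have "card V = nat \<lfloor>del * real n\<rfloor>" using V(2) by (simp only: m_def)
        from main[rule_format, OF V(1) this V(3) few[rule_format]]
        have "measure_pmf.prob ?R {X. \<not> exp (c * real n) \<le> real (card (planted_in n m (H \<union> X)))} \<le> 2 * exp (- c * real n)"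
          by (simp only: V(2) p_def)
        moreover have "c' * real n \<le> c * real n" using c'(2) c(1) by (intro mult_right_mono) auto
        hence "2 * exp (- c * real n) \<le> 2 * exp (- c' * real n)" by simp
        moreover have "measure_pmf.prob (map_pmf (\<lambda>X. (H, X \<union> H)) ?R)
            {(H, G). \<not> exp (c * real n) \<le> real (card (planted_in n m G))} =
            measure_pmf.prob ?R {X. \<not> exp (c * real n) \<le> real (card (planted_in n m (H \<union> X)))}"
          by (simp add: vimage_def Un_commute)
        ultimately show "measure_pmf.prob (map_pmf (\<lambda>X. (H, X \<union> H)) ?R)
            {(H, G). \<not> exp (c * real n) \<le> real (card (planted_in n m G))} \<le> 2 * exp (- c' * real n)"
          by linarith
      qed simp
      thus ?thesis using badH by linarith
    qed
    have "measure_pmf.prob (planted_and_estimate n lam del est) {(H, H'). reconstruction_error H H' < \<epsilon> / 2} \<le>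
      exp (c * real n / 2) / exp (c * real n) +
      measure_pmf.prob ?J {(H, G). exp (c * real n / 2) < real (card (near n \<epsilon> H G))} +
      measure_pmf.prob ?J {(H, G). \<not> exp (c * real n) \<le> real (card (planted_in n m G))}"
      using p m unfolding p_def by (intro success_bound[OF est m_def]) auto
    also have "\<dots> \<le> exp (- c' * real n) + exp (- c' * real n) / y ^ 2 +
        (2 * real D * exp (2 * C) * exp (- c' * real n) + 2 * exp (- c' * real n))"
      using e1 nearJ fewJ by (intro add_mono)
    also have "\<dots> = (3 + 1 / y ^ 2 + 2 * real D * exp (2 * C)) * exp (- c' * real n)"
      by (simp add: algebra_simps)
    finally show "measure_pmf.prob (planted_and_estimate n lam del est) {(H, H'). reconstruction_error H H' < \<epsilon> / 2}
      \<le> A * exp (- c' * real n)" by (simp only: A_def)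
  qed
  thus ?thesis using eps(1) A c'(1) by blast
qed

theorem theorem3:
  fixes lam del :: real
  assumes "0 < del" "del \<le> 1" "0 < lam"
    and "lam > 1 / (sqrt (2 * del) + sqrt (1 - del))\<^sup>2"
  shows "\<exists>\<epsilon>>0.
    (\<exists>c>0. \<forall>\<^sub>F n in sequentially. \<forall>est \<in> estimators n.
       measure_pmf.prob (planted_and_estimate n lam del est)
         {(H, H'). reconstruction_error H H' \<ge> \<epsilon> / 2}
       \<ge> 1 - real n powr (- c * ln (real n))) \<and>
    (\<forall>\<^sub>F n in sequentially. \<forall>est \<in> estimators n.
       measure_pmf.expectation (planted_and_estimate n lam del est)
         (\<lambda>(H, H'). reconstruction_error H H') \<ge> \<epsilon> / 4)"
proof -
  have "(sqrt (2 * del) + sqrt (1 - del))\<^sup>2 > 0"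
    using assms by (intro zero_less_power add_pos_nonneg) auto
  hence "lam * (sqrt (2 * del) + sqrt (1 - del))\<^sup>2 > 1"
    using assms(4) by (simp add: pos_divide_less_eq)
  from estimation_fails[OF assms(1-3) this]
  obtain \<epsilon> A c where e: "\<epsilon> > 0" and A: "A > 0" and c: "c > 0" and ev: "\<forall>\<^sub>F n in sequentially. \<forall>est\<in>estimators n.
    measure_pmf.prob (planted_and_estimate n lam del est) {(H, H'). reconstruction_error H H' < \<epsilon> / 2}
    \<le> A * exp (- c * real n)" by blast
  have compl: "{(H, H'). reconstruction_error H H' \<ge> \<epsilon> / 2} = UNIV - {(H, H'). reconstruction_error H H' < \<epsilon> / 2}"
    by auto
  have far: "measure_pmf.prob M {(H, H'). reconstruction_error H H' \<ge> \<epsilon> / 2} =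
      1 - measure_pmf.prob M {(H, H'). reconstruction_error H H' < \<epsilon> / 2}" for M
    unfolding compl using measure_pmf.prob_compl[of "{(H, H'). reconstruction_error H H' < \<epsilon> / 2}" M] by simp
  \<comment> \<open>An exponential bound is eventually below \<open>n^(- ln n)\<close>, so the
    constant in the exponent can be 1.\<close>
  have first: "\<forall>\<^sub>F n in sequentially. \<forall>est\<in>estimators n.
       measure_pmf.prob (planted_and_estimate n lam del est) {(H, H'). reconstruction_error H H' \<ge> \<epsilon> / 2}
       \<ge> 1 - real n powr (- 1 * ln (real n))"
    using ev exp_linear_le_powr_ln[OF A c]
  proof eventually_elim
    case (elim n)
    show ?case
    proof
      fix est assume "est \<in> estimators n"
      from elim(1)[rule_format, OF this] elim(2)
      show "1 - real n powr (- 1 * ln (real n)) \<le>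
        measure_pmf.prob (planted_and_estimate n lam del est) {(H, H'). \<epsilon> / 2 \<le> reconstruction_error H H'}"
        unfolding far by linarith
    qed
  qed
  have "\<forall>\<^sub>F n in sequentially. 4 / del \<le> real n"
    by (rule eventually_sequentiallyI[of "nat \<lceil>4 / del\<rceil>"]) linarith
  \<comment> \<open>From here on \<open>A * exp (- c * n) \<le> A / (c * n) \<le> 1 / 2\<close>, by
    \<open>x \<le> exp x\<close>.\<close>
  moreover have "\<forall>\<^sub>F n in sequentially. max 1 (2 * A / c) \<le> real n"
    by (rule eventually_sequentiallyI[of "nat \<lceil>max 1 (2 * A / c)\<rceil>"]) linarith
  ultimately have "\<forall>\<^sub>F n in sequentially. \<forall>est\<in>estimators n.
       measure_pmf.expectation (planted_and_estimate n lam del est) (\<lambda>(H, H'). reconstruction_error H H') \<ge> \<epsilon> / 4"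
    using ev
  proof eventually_elim
    case (elim n)
    show ?case
    proof
      fix est assume est: "est \<in> estimators n"
      let ?P = "planted_and_estimate n lam del est"
      let ?err = "\<lambda>(H, H'). reconstruction_error H H'"
      define m where "m = nat \<lfloor>del * real n\<rfloor>"
      have "4 \<le> del * real n" using elim(1) assms(1) by (simp add: field_simps)
      hence m3: "3 \<le> m" unfolding m_def by linarith
      have "del * real n \<le> real n" using mult_right_mono[OF assms(2), of "real n"] by simp
      hence mn: "m \<le> n" unfolding m_def by linarith
      have "planted_cycles n lam del = planted_joint n m (lam / real n)"
        using planted_cycles_alt[of del n lam] mn by (simp add: planted_joint_def m_def)
      hence joint: "?P = bind_pmf (planted_joint n m (lam / real n)) (\<lambda>(H, G). map_pmf (\<lambda>H'. (H, H')) (est G))"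
        by (simp add: planted_and_estimate_def map_pmf_def)
      have "set_pmf ?P \<subseteq> Pow (complete_edges n) \<times> Pow (complete_edges n)"
      proof
        fix a assume "a \<in> set_pmf ?P"
        then obtain H G H' where a: "(H, G) \<in> set_pmf (planted_joint n m (lam / real n))" "H' \<in> set_pmf (est G)" "a = (H, H')"
          unfolding joint by auto
        have G: "G \<subseteq> complete_edges n" "H \<subseteq> G"
          using set_planted_joint[OF mn m3 a(1)] by (auto simp: planted_in_def)
        have "set_pmf (est G) \<subseteq> Pow (complete_edges n)" using est G(1) by (simp add: estimators_def)
        thus "a \<in> Pow (complete_edges n) \<times> Pow (complete_edges n)" using a G by auto
      qed
      hence "finite (set_pmf ?P)" by (rule finite_subset) (simp add: finite_complete_edges)
      note int = integrable_measure_pmf_finite[OF this]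
      have "A / (c * real n) \<le> 1 / 2" using elim(2) c A by (simp add: field_simps)
      moreover have "A * exp (- c * real n) \<le> A / (c * real n)"
      proof -
        have "c * real n \<le> exp (c * real n)" using exp_ge_add_one_self[of "c * real n"] by linarith
        hence "A / exp (c * real n) \<le> A / (c * real n)" using A c elim(2) by (intro divide_left_mono) auto
        thus ?thesis by (simp add: exp_minus divide_inverse)
      qed
      ultimately have half: "measure_pmf.prob ?P {(H, H'). reconstruction_error H H' \<ge> \<epsilon> / 2} \<ge> 1 / 2"
        using elim(3)[rule_format, OF est] unfolding far by linarith
      \<comment> \<open>Markov's inequality: the error is nonnegative and at least
        \<open>\<epsilon> / 2\<close> with probability at least one half.\<close>
      have "\<epsilon> / 4 = \<epsilon> / 2 * (1 / 2)" by simp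
      also have "\<dots> \<le> \<epsilon> / 2 * measure_pmf.prob ?P {(H, H'). reconstruction_error H H' \<ge> \<epsilon> / 2}"
        using half e by (intro mult_left_mono) auto
      also have "\<dots> = (\<integral>a. \<epsilon> / 2 * indicat_real {(H, H'). reconstruction_error H H' \<ge> \<epsilon> / 2} a \<partial>measure_pmf ?P)"
        by simp
      also have "\<dots> \<le> measure_pmf.expectation ?P ?err"
        by (intro integral_mono int) (auto simp: indicator_def reconstruction_error_def)
      finally show "\<epsilon> / 4 \<le> measure_pmf.expectation ?P ?err" .
    qed
  qed
  thus ?thesis using e first by (intro exI[of _ \<epsilon>] conjI exI[of _ 1]) auto
qed

end
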